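(* Let $P\subset N_{\mathbb{R}}$ be an empty three-dimensional lattice polytope (with $N\cong\mathbb{Z}^3$), and let $X_P$ be the associated affine Gorenstein toric variety. For $r\in\widetilde M$ set $$\varphi_r(v):=\langle r,(v,1)\rangle,\qquad F_r:=P\cap\{\varphi_r=1\}.$$ For every facet $F\subset P$ let $s_F\in\widetilde M$ be the primitive generator of the corresponding ray of $\sigma^\vee$, and let $\mathcal S(P)$ be the set of square facets of $P$. Then: (a) For $r\in\widetilde M$ with $r\neq R^*$, one has $T^1_{X_P}(-r)\neq 0$ if and only if $r=R^*-ns_F$ for some $F\in\mathcal S(P)$ and some integer $n\geq 1$. In this case $F_r=F$ and $$T^1_{X_P}\bigl(-(R^*-ns_F)\bigr)\cong\mathbb{C}.$$ (b) $F_{R^*}=P$, and every $r\in\widetilde M$ with $T^1_{X_P}(-r)\neq 0$ satisfies $\varphi_r\leq 1$ on $P$. (c) Consequently, $$T^1_{X_P}=T^1_{X_P}(-R^* )\oplus\bigoplus_{F\in\mathcal S(P)}\ \bigoplus_{n\geq 1}T^1_{X_P}\bigl(-(R^*-ns_F)\bigr).$$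
   Context: Work over $\mathbb{C}$. Let $M=\operatorname{Hom}_{\mathbb{Z}}(N,\mathbb{Z})$, $\widetilde N=N\oplus\mathbb{Z}$, $\widetilde M=M\oplus\mathbb{Z}$. For a full-dimensional lattice polytope $P\subset N_{\mathbb{R}}$ with vertices $v^1,\dots,v^p$, let $\sigma=\operatorname{cone}\{(v^1,1),\dots,(v^p,1)\}\subset\widetilde N_{\mathbb{R}}$, $\sigma^\vee\subset\widetilde M_{\mathbb{R}}$ its dual cone, $S_P=\sigma^\vee\cap\widetilde M$, and $X_P=\operatorname{Spec}\mathbb{C}[S_P]$. $P$ is empty if $P\cap N=\operatorname{Vert}(P)$. The Gorenstein degree is $R^*=(0,1)\in\widetilde M$. For a facet $F\subset P$, $s_F\in\widetilde M$ is the primitive generator of the ray of $\sigma^\vee$ corresponding to $F$, i.e. the primitive element of $\widetilde M$ that is nonnegative on $\sigma$ and satisfies $\langle s_F,(v,1)\rangle=0$ exactly for $v\in F$ (among $v\in P$). A square facet is a facet that is lattice equivalent (by an affine lattice isomorphism of the lattices in the affine spans) to the unit square $\operatorname{conv}\{(0,0),(1,0),(0,1),(1,1)\}$; every two-dimensional face of an empty lattice polytope is lattice equivalent to the standard triangle or to the unit square. For $A=\mathbb{C}[S_P]$, $T^1_{X_P}=\operatorname{Ext}^1_A(L_{A/\mathbb{C}},A)$ is the first André–Quillen (cotangent) cohomology, i.e. the space of first-order deformations of $X_P$. The $\widetilde M$-grading of $A$ with $\deg\chi^s=s$ induces a grading on $T^1_{X_P}$, and $T^1_{X_P}(-r)$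 is the homogeneous component of degree $-r$. *)

theory Defs
  imports
    "HOL-Analysis.Analysis"
    "HOL-Library.Poly_Mapping"
    "HOL-Library.Function_Algebras"
begin

section \<open>Lattices, lattice polytopes and their cones\<close>

text \<open>
  A basis of $N$ is fixed, so $N = \mathbb{Z}^n$ sits inside \<open>real ^ 'n\<close>, and $M$ is written in
  the dual basis: \<open>(m, a) :: (int ^ 'n) \<times> int\<close> is an element of $M \oplus \mathbb{Z}$, and the
  pairing is the standard inner product.
\<close>

type_synonym 'n mlat = "(int ^ 'n) \<times> int"

definition lattice_points :: "(real ^ 'n) set" where
  "lattice_points = {x. \<forall>i. x $ i \<in> \<int>}"

definition real_of_mlat :: "'n::finite mlat \<Rightarrow> (real ^ 'n) \<times> real" where
  "real_of_mlat r = ((\<chi> i. of_int (fst r $ i)), of_int (snd r))"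

definition mlat_scale :: "int \<Rightarrow> 'n::finite mlat \<Rightarrow> 'n mlat" where
  "mlat_scale k r = (k *s fst r, k * snd r)"

definition primitive_mlat :: "'n::finite mlat \<Rightarrow> bool" where
  "primitive_mlat s \<longleftrightarrow> s \<noteq> 0 \<and> (\<forall>k t. s = mlat_scale k t \<longrightarrow> k = 1 \<or> k = -1)"

definition vertices :: "(real ^ 'n) set \<Rightarrow> (real ^ 'n) set" where
  "vertices P = {v. v extreme_point_of P}"

definition lattice_polytope :: "(real ^ 'n::finite) set \<Rightarrow> bool" where
  "lattice_polytope P \<longleftrightarrow> polytope P \<and> vertices P \<subseteq> lattice_points"

definition full_dimensional :: "(real ^ 'n::finite) set \<Rightarrow> bool" where
  "full_dimensional P \<longleftrightarrow> aff_dim P = int (CARD('n))"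

definition empty_polytope :: "(real ^ 'n::finite) set \<Rightarrow> bool" where
  "empty_polytope P \<longleftrightarrow> P \<inter> lattice_points = vertices P"

definition sigma_cone :: "(real ^ 'n::finite) set \<Rightarrow> ((real ^ 'n) \<times> real) set" where
  "sigma_cone P = convex_cone hull ((\<lambda>v. (v, 1)) ` vertices P)"

definition dual_cone :: "'a::real_inner set \<Rightarrow> 'a set" where
  "dual_cone C = {u. \<forall>x\<in>C. 0 \<le> u \<bullet> x}"

definition S_monoid :: "(real ^ 'n::finite) set \<Rightarrow> 'n mlat set" where
  "S_monoid P = {s. real_of_mlat s \<in> dual_cone (sigma_cone P)}"

definition R_star :: "'n::finite mlat" where
  "R_star = (0, 1)"

definition phi :: "'n::finite mlat \<Rightarrow> real ^ 'n \<Rightarrow> real" where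
  "phi r v = real_of_mlat r \<bullet> (v, 1)"

definition F_at :: "(real ^ 'n::finite) set \<Rightarrow> 'n mlat \<Rightarrow> (real ^ 'n) set" where
  "F_at P r = {v \<in> P. phi r v = 1}"

definition s_facet :: "(real ^ 'n::finite) set \<Rightarrow> (real ^ 'n) set \<Rightarrow> 'n mlat" where
  "s_facet P F = (THE s. primitive_mlat s
     \<and> (\<forall>x\<in>sigma_cone P. 0 \<le> real_of_mlat s \<bullet> x)
     \<and> (\<forall>v\<in>P. real_of_mlat s \<bullet> (v, 1) = 0 \<longleftrightarrow> v \<in> F))"

definition lattice_equivalent :: "(real ^ 'm::finite) set \<Rightarrow> (real ^ 'n::finite) set \<Rightarrow> bool" where
  "lattice_equivalent Q F \<longleftrightarrow> (\<exists>a L. linear L \<and>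
     (let f = (\<lambda>x. a + L x) in
        bij_betw f (affine hull Q) (affine hull F) \<and>
        f ` (affine hull Q \<inter> lattice_points) = affine hull F \<inter> lattice_points \<and>
        f ` Q = F))"

definition unit_square :: "(real ^ 2) set" where
  "unit_square = convex hull {vector [0, 0], vector [1, 0], vector [0, 1], vector [1, 1]}"

definition square_facets :: "(real ^ 'n::finite) set \<Rightarrow> (real ^ 'n) set set" where
  "square_facets P = {F. F facet_of P \<and> lattice_equivalent unit_square F}"


section \<open>Monoid algebras and free algebras over the complex numbers\<close>

text \<open>
  \<open>'k \<Rightarrow>\<^sub>0 complex\<close> is the monoid algebra of \<open>'k\<close>.  In particular, the polynomials in variables
  from \<open>'x\<close> are \<open>'x pol\<close>, the monoid algebra of the monomials \<open>'x \<Rightarrow>\<^sub>0 nat\<close>.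
\<close>

definition const :: "complex \<Rightarrow> ('k::comm_monoid_add \<Rightarrow>\<^sub>0 complex)" where
  "const c = Poly_Mapping.single 0 c"

definition monoid_algebra :: "'k set \<Rightarrow> ('k \<Rightarrow>\<^sub>0 complex) set" where
  "monoid_algebra S = {f. Poly_Mapping.keys f \<subseteq> S}"

definition coord_ring :: "(real ^ 'n::finite) set \<Rightarrow> ('n mlat \<Rightarrow>\<^sub>0 complex) set" where
  "coord_ring P = monoid_algebra (S_monoid P)"

type_synonym 'x pol = "('x \<Rightarrow>\<^sub>0 nat) \<Rightarrow>\<^sub>0 complex"

definition pvar :: "'x \<Rightarrow> 'x pol" where
  "pvar x = Poly_Mapping.single (Poly_Mapping.single x 1) 1"

text \<open>The polynomial ring $\mathbb{C}[X]$ on a set \<open>X\<close> of variables.\<close>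

definition free_alg :: "'x set \<Rightarrow> 'x pol set" where
  "free_alg X = {p. \<forall>m\<in>Poly_Mapping.keys p. Poly_Mapping.keys m \<subseteq> X}"

text \<open>The algebra homomorphism out of a polynomial ring with prescribed values on the variables.\<close>

definition free_lift ::
  "('x \<Rightarrow> ('k::comm_monoid_add \<Rightarrow>\<^sub>0 complex)) \<Rightarrow> 'x pol \<Rightarrow> ('k \<Rightarrow>\<^sub>0 complex)" where
  "free_lift g p = (\<Sum>m\<in>Poly_Mapping.keys p.
     const (Poly_Mapping.lookup p m) * (\<Prod>x\<in>Poly_Mapping.keys m. g x ^ Poly_Mapping.lookup m x))"

definition free_map :: "('x \<Rightarrow> 'y) \<Rightarrow> 'x pol \<Rightarrow> 'y pol" where
  "free_map g = free_lift (\<lambda>x. pvar (g x))"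

text \<open>The counit $\mathbb{C}[B] \to B$, which evaluates the variable $[b]$ at $b$.\<close>

definition counit :: "('k::comm_monoid_add \<Rightarrow>\<^sub>0 complex) pol \<Rightarrow> ('k \<Rightarrow>\<^sub>0 complex)" where
  "counit = free_lift (\<lambda>b. b)"


section \<open>First Andre-Quillen cohomology\<close>

text \<open>
  Let \<open>A\<close> be a subalgebra of a monoid algebra.  Its cotangent complex is
  $L_{A/\mathbb{C}} = \Omega_{P_\bullet/\mathbb{C}} \otimes_{P_\bullet} A$ for the standard
  simplicial resolution $P_0 = \mathbb{C}[A]$, $P_{n+1} = \mathbb{C}[P_n]$.  It consists of free
  \<open>A\<close>-modules, and $\mathrm{Hom}_A(\Omega_{P_n} \otimes A, A) = \mathrm{Der}_{\mathbb{C}}(P_n, A)$,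
  so $\mathrm{Ext}^1_A(L_{A/\mathbb{C}}, A)$ is the first cohomology of the alternating-sum complex
  $\mathrm{Der}(P_0, A) \to \mathrm{Der}(P_1, A) \to \mathrm{Der}(P_2, A)$.

  The face maps are $d_i = \mathbb{C}[\cdot]^{i}\, \varepsilon$ with \<open>\<epsilon>\<close> the counit.
\<close>

definition P0 :: "('k::comm_monoid_add \<Rightarrow>\<^sub>0 complex) set \<Rightarrow> ('k \<Rightarrow>\<^sub>0 complex) pol set" where
  "P0 A = free_alg A"

definition P1 :: "('k::comm_monoid_add \<Rightarrow>\<^sub>0 complex) set \<Rightarrow> ('k \<Rightarrow>\<^sub>0 complex) pol pol set" where
  "P1 A = free_alg (P0 A)"

definition P2 :: "('k::comm_monoid_add \<Rightarrow>\<^sub>0 complex) set \<Rightarrow> ('k \<Rightarrow>\<^sub>0 complex) pol pol pol set" where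
  "P2 A = free_alg (P1 A)"

text \<open>
  \<open>derivations aug B A\<close>: the $\mathbb{C}$-linear derivations from \<open>B\<close> to \<open>A\<close>, where \<open>B\<close> acts on
  \<open>A\<close> through the augmentation \<open>aug\<close>.  They are set to 0 outside \<open>B\<close>, so that equal derivations
  are equal as functions.
\<close>

definition derivations ::
  "(('j::comm_monoid_add \<Rightarrow>\<^sub>0 complex) \<Rightarrow> ('k::comm_monoid_add \<Rightarrow>\<^sub>0 complex))
    \<Rightarrow> ('j \<Rightarrow>\<^sub>0 complex) set \<Rightarrow> ('k \<Rightarrow>\<^sub>0 complex) set
    \<Rightarrow> (('j \<Rightarrow>\<^sub>0 complex) \<Rightarrow> ('k \<Rightarrow>\<^sub>0 complex)) set" where
  "derivations aug B A = {D.
     (\<forall>p\<in>B. D p \<in> A) \<and> (\<forall>p. p \<notin> B \<longrightarrow> D p = 0) \<and>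
     (\<forall>p\<in>B. \<forall>q\<in>B. D (p + q) = D p + D q) \<and>
     (\<forall>c. \<forall>p\<in>B. D (const c * p) = const c * D p) \<and>
     (\<forall>p\<in>B. \<forall>q\<in>B. D (p * q) = aug p * D q + aug q * D p)}"

type_synonym 'k cochain1 = "('k \<Rightarrow>\<^sub>0 complex) pol pol \<Rightarrow> ('k \<Rightarrow>\<^sub>0 complex)"

definition cochains0 ::
  "('k::comm_monoid_add \<Rightarrow>\<^sub>0 complex) set \<Rightarrow> (('k \<Rightarrow>\<^sub>0 complex) pol \<Rightarrow> ('k \<Rightarrow>\<^sub>0 complex)) set" where
  "cochains0 A = derivations counit (P0 A) A"

definition cochains1 :: "('k::comm_monoid_add \<Rightarrow>\<^sub>0 complex) set \<Rightarrow> 'k cochain1 set" where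
  "cochains1 A = derivations (\<lambda>q. counit (counit q)) (P1 A) A"

definition cocycles1 :: "('k::comm_monoid_add \<Rightarrow>\<^sub>0 complex) set \<Rightarrow> 'k cochain1 set" where
  "cocycles1 A = {D \<in> cochains1 A. \<forall>w\<in>P2 A.
     D (counit w) - D (free_map counit w) + D (free_map (free_map counit) w) = 0}"

definition coboundaries1 :: "('k::comm_monoid_add \<Rightarrow>\<^sub>0 complex) set \<Rightarrow> 'k cochain1 set" where
  "coboundaries1 A = (\<lambda>E. (\<lambda>q. if q \<in> P1 A then E (counit q) - E (free_map counit q) else 0))
     ` cochains0 A"

text \<open>
  Elements of $T^1$ are cosets of \<open>coboundaries1 A\<close>.  Coboundaries are added again in
  \<open>T1_scale\<close> and \<open>T1_sum\<close> so that the scalar 0 and the empty sum also give a coset.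
\<close>

definition cochain_scale ::
  "complex \<Rightarrow> ('x \<Rightarrow> ('k::comm_monoid_add \<Rightarrow>\<^sub>0 complex)) \<Rightarrow> 'x \<Rightarrow> ('k \<Rightarrow>\<^sub>0 complex)" where
  "cochain_scale c D = (\<lambda>q. const c * D q)"

definition T1 :: "('k::comm_monoid_add \<Rightarrow>\<^sub>0 complex) set \<Rightarrow> 'k cochain1 set set" where
  "T1 A = (\<lambda>D. {D + b | b. b \<in> coboundaries1 A}) ` cocycles1 A"

definition T1_zero :: "('k::comm_monoid_add \<Rightarrow>\<^sub>0 complex) set \<Rightarrow> 'k cochain1 set" where
  "T1_zero A = coboundaries1 A"

definition T1_add :: "'k::comm_monoid_add cochain1 set \<Rightarrow> 'k cochain1 set \<Rightarrow> 'k cochain1 set" where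
  "T1_add X Y = {x + y | x y. x \<in> X \<and> y \<in> Y}"

definition T1_scale ::
  "('k::comm_monoid_add \<Rightarrow>\<^sub>0 complex) set \<Rightarrow> complex \<Rightarrow> 'k cochain1 set \<Rightarrow> 'k cochain1 set" where
  "T1_scale A c X = {cochain_scale c x + b | x b. x \<in> X \<and> b \<in> coboundaries1 A}"

definition T1_sum ::
  "('k::comm_monoid_add \<Rightarrow>\<^sub>0 complex) set \<Rightarrow> ('i \<Rightarrow> 'k cochain1 set) \<Rightarrow> 'i set \<Rightarrow> 'k cochain1 set" where
  "T1_sum A X I = {(\<Sum>i\<in>I. x i) + b | x b. (\<forall>i\<in>I. x i \<in> X i) \<and> b \<in> coboundaries1 A}"


section \<open>The grading\<close>

text \<open>
  A grading of a complex vector space by a lattice \<open>'k\<close> is the same as an action of the torus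
  $\mathrm{Hom}(\texttt{'k}, \mathbb{C}^*)$ by semisimple algebraic automorphisms, \<open>t\<close> acting as
  \<open>t d\<close> in degree \<open>d\<close>.  The torus acts on \<open>A\<close> by algebra automorphisms, hence by functoriality on
  the standard resolution, on derivations and on $T^1$, and the component of degree \<open>d\<close> of $T^1$ is
  the weight space of weight \<open>d\<close>.  (The standard resolution has variables also for inhomogeneous
  elements of \<open>A\<close>, so degrees cannot be read off from its variables.)
\<close>

definition torus :: "('k::ab_group_add \<Rightarrow> complex) set" where
  "torus = {t. t 0 = 1 \<and> (\<forall>a b. t (a + b) = t a * t b)}"

definition torus_act :: "('k \<Rightarrow> complex) \<Rightarrow> ('k \<Rightarrow>\<^sub>0 complex) \<Rightarrow> ('k \<Rightarrow>\<^sub>0 complex)" where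
  "torus_act t f =
     (\<Sum>m\<in>Poly_Mapping.keys f. Poly_Mapping.single m (t m * Poly_Mapping.lookup f m))"

text \<open>$(t \cdot D)(q) = t \cdot D(t^{-1} \cdot q)$\<close>

definition torus_act_cochain ::
  "('k::ab_group_add \<Rightarrow> complex) \<Rightarrow> 'k cochain1 \<Rightarrow> 'k cochain1" where
  "torus_act_cochain t D = (\<lambda>q.
     torus_act t (D (free_map (free_map (torus_act (\<lambda>m. inverse (t m)))) q)))"

definition T1_deg ::
  "('k::ab_group_add \<Rightarrow>\<^sub>0 complex) set \<Rightarrow> 'k \<Rightarrow> 'k cochain1 set set" where
  "T1_deg A d = {X \<in> T1 A. \<forall>t\<in>torus. torus_act_cochain t ` X = T1_scale A (t d) X}"

definition T1_part_iso_complex ::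
  "('k::ab_group_add \<Rightarrow>\<^sub>0 complex) set \<Rightarrow> 'k cochain1 set set \<Rightarrow> bool" where
  "T1_part_iso_complex A W \<longleftrightarrow> (\<exists>h :: complex \<Rightarrow> 'k cochain1 set. bij_betw h UNIV W \<and>
     (\<forall>a b. h (a + b) = T1_add (h a) (h b)) \<and>
     (\<forall>a b. h (a * b) = T1_scale A a (h b)))"

text \<open>
  $T^1$ is the internal direct sum of the family \<open>W\<close> indexed by \<open>I\<close>: every class is the sum of a
  unique finitely supported family of classes in the \<open>W i\<close>.
\<close>

definition T1_direct_sum ::
  "('k::ab_group_add \<Rightarrow>\<^sub>0 complex) set \<Rightarrow> 'i set \<Rightarrow> ('i \<Rightarrow> 'k cochain1 set set) \<Rightarrow> bool" where
  "T1_direct_sum A I W \<longleftrightarrow> (\<forall>i\<in>I. W i \<subseteq> T1 A) \<and>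
     (\<forall>X\<in>T1 A. \<exists>!c. (\<forall>i\<in>I. c i \<in> W i) \<and> (\<forall>i. i \<notin> I \<longrightarrow> c i = T1_zero A) \<and>
        finite {i. c i \<noteq> T1_zero A} \<and> X = T1_sum A c {i. c i \<noteq> T1_zero A})"

end

theory Submission
  imports Defs "HOL-Computational_Algebra.Polynomial" "HOL-Real_Asymp.Real_Asymp"
begin

text \<open>
  For $A = \mathbb{C}[S]$ the standard resolution gives
  $T^1_A = \mathrm{Hom}_{P_0}(I, A) / \mathrm{Der}(P_0, A)$ with $I$ the kernel of
  $P_0 = \mathbb{C}[A] \to A$.  Since \<open>S\<close> generates a free group, every homomorphism $I \to A$
  extends to a derivation of $P_0$ into the Laurent ring $\mathbb{C}[\widetilde M]$, so a class is
  given by a function $g : S \to \mathbb{C}[\widetilde M]$ with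
  $\chi^s g(t) + \chi^t g(s) - g(s + t) \in A$.  The component of degree $-R$ of \<open>g\<close> is a function
  $\gamma : S \to \mathbb{C}$ that is additive as long as the sum stays in
  $K_R = \{s \in S : s - R \notin S\}$, and it is trivial iff it is additive on $K_R$.

  $K_R$ is the union over the vertices \<open>w\<close> of the pieces $\langle s, w\rangle < \langle R, w\rangle$, on
  each of which $\gamma$ is linear.  Emptiness makes the edges primitive, so two linear functions at
  an edge agree as far as the values of \<open>R\<close> at its ends allow.  If some value is at least two, the
  edges of the simplex algorithm connect all pieces and $\gamma$ is trivial.  Otherwise the vertices
  of value one span the face $F_R$; if $R \neq R^*$ it is a vertex, an edge, a unimodular triangle or
  a unimodular parallelogram \<open>abcd\<close>, and only the last one carries a nontrivial $\gamma$, namely the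
  multiples of $\min(\langle s, a\rangle, \langle s, b\rangle)$.
\<close>

section \<open>Evaluation of polynomials\<close>

text \<open>The constant two comes from an edge \<open>ab\<close>. Primitivity gives
  \<open>e\<close> with the values (0,1) at its ends; together with \<open>R_star - e\<close> and
  the functionals that vanish on the edge it generates the lattice. The two linear functions are
  compared on elements whose value at each end is below that of R. If both values are one, only the
  functionals vanishing on the edge are common, and a multiple of each end evaluation stays free. In
  a triangle a functional separates these evaluations and the free multiples vanish; around a
  parallelogram the relation a + c = b + d lets exactly one survive. The homological obstacle is
  that the resolution has a variable for every element of A, inhomogeneous ones included, so a
  cocycle is not visibly a function on S. Linear extension from the characters, with an A-valued
  correction at the remaining variables, removes it. A second obstacle is that trivialisations are
  found one degree at a time but must add up to a Laurent polynomial.\<close>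

definition mon_eval :: "('x \<Rightarrow> 'r::comm_ring_1) \<Rightarrow> ('x \<Rightarrow>\<^sub>0 nat) \<Rightarrow> 'r" where
  "mon_eval g m = (\<Prod>x\<in>Poly_Mapping.keys m. g x ^ Poly_Mapping.lookup m x)"

text \<open>The coefficient map \<open>c\<close> is a parameter because polynomials are evaluated in
  two kinds of rings: in a monoid algebra for \<open>free_lift\<close>, and in polynomials over one
  for \<open>der_ext\<close>.\<close>

definition ev :: "(complex \<Rightarrow> 'r::comm_ring_1) \<Rightarrow> ('x \<Rightarrow> 'r) \<Rightarrow> 'x pol \<Rightarrow> 'r" where
  "ev c g p = (\<Sum>m\<in>Poly_Mapping.keys p. c (Poly_Mapping.lookup p m) * mon_eval g m)"

lemma mon_eval_superset:
  assumes "finite X" "Poly_Mapping.keys m \<subseteq> X"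
  shows "mon_eval g m = (\<Prod>x\<in>X. g x ^ Poly_Mapping.lookup m x)"
  unfolding mon_eval_def
  by (rule prod.mono_neutral_left) (use assms in \<open>auto simp: in_keys_iff\<close>)

lemma mon_eval_add: "mon_eval g (m + m') = mon_eval g m * mon_eval g m'"
proof -
  let ?X = "Poly_Mapping.keys m \<union> Poly_Mapping.keys m'"
  have "mon_eval g (m + m') = (\<Prod>x\<in>?X. g x ^ Poly_Mapping.lookup (m + m') x)"
    by (rule mon_eval_superset) (use Poly_Mapping.keys_add[of m m'] in auto)
  also have "\<dots> = (\<Prod>x\<in>?X. g x ^ Poly_Mapping.lookup m x) * (\<Prod>x\<in>?X. g x ^ Poly_Mapping.lookup m' x)"
    by (simp add: lookup_add power_add prod.distrib)
  also have "\<dots> = mon_eval g m * mon_eval g m'"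
    by (simp add: mon_eval_superset[of ?X])
  finally show ?thesis .
qed

lemma mon_eval_0 [simp]: "mon_eval g 0 = 1"
  by (simp add: mon_eval_def)

lemma mon_eval_single: "mon_eval g (Poly_Mapping.single x n) = g x ^ n"
  by (cases "n = 0") (simp_all add: mon_eval_def)

lemma poly_mapping_induct_single [case_names zero add]:
  assumes "P 0" and "\<And>p m c. P p \<Longrightarrow> P (p + Poly_Mapping.single m c)"
  shows "P (p :: 'a \<Rightarrow>\<^sub>0 'b::ab_group_add)"
proof (induction p rule: update_induct)
  case const then show ?case using assms(1) by simp
next
  case (update f a b)
  have "Poly_Mapping.update a b f = f + Poly_Mapping.single a b"
    by (rule poly_mapping_eqI)
      (use update(1) in \<open>auto simp: lookup_update lookup_add lookup_single in_keys_iff when_def\<close>)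
  then show ?case using assms(2)[OF update(3)] by simp
qed

definition ring_hom :: "('a::comm_ring_1 \<Rightarrow> 'b::comm_ring_1) \<Rightarrow> bool" where
  "ring_hom f \<longleftrightarrow> f 1 = 1 \<and> (\<forall>a b. f (a + b) = f a + f b) \<and> (\<forall>a b. f (a * b) = f a * f b)"

lemma ring_homD:
  assumes "ring_hom f"
  shows "f 1 = 1" "f 0 = 0" "f (a + b) = f a + f b" "f (a * b) = f a * f b" "f (- a) = - f a"
    "f (a - b) = f a - f b" "f (a ^ n) = f a ^ n"
proof -
  show 1: "f 1 = 1" and add: "\<And>a b. f (a + b) = f a + f b" and mult: "\<And>a b. f (a * b) = f a * f b"
    using assms by (auto simp: ring_hom_def)
  show 0: "f 0 = 0" using add[of 0 0] by simp
  show m: "f (- a) = - f a" for a using add[of a "- a"] 0 by (simp add: eq_neg_iff_add_eq_0 add.commute)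
  show "f (a - b) = f a - f b" using add[of a "- b"] m[of b] by simp
  show "f (a ^ n) = f a ^ n" by (induction n) (simp_all add: 1 mult)
qed

lemma ring_hom_prod: "ring_hom f \<Longrightarrow> f (\<Prod>i\<in>I. g i) = (\<Prod>i\<in>I. f (g i))"
  by (induction I rule: infinite_finite_induct) (simp_all add: ring_homD)

lemma ring_hom_comp: "ring_hom f \<Longrightarrow> ring_hom g \<Longrightarrow> ring_hom (\<lambda>x. f (g x))"
  by (simp add: ring_hom_def)

lemma ring_hom_id: "ring_hom (\<lambda>x. x)"
  by (simp add: ring_hom_def)

text \<open>Additive extension from monomials is treated once, for an arbitrary coefficient function
  \<open>F\<close>; \<open>ev\<close> and the linear extension \<open>lin\<close> are both of this
  form.\<close>

lemma lin_ext_superset: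
  fixes F :: "'m \<Rightarrow> 'c::zero \<Rightarrow> 'r::comm_monoid_add"
  assumes "\<And>m. F m 0 = 0" "finite X" "Poly_Mapping.keys p \<subseteq> X"
  shows "(\<Sum>m\<in>Poly_Mapping.keys p. F m (Poly_Mapping.lookup p m)) = (\<Sum>m\<in>X. F m (Poly_Mapping.lookup p m))"
  by (rule sum.mono_neutral_left) (use assms in \<open>auto simp: in_keys_iff\<close>)

lemma lin_ext_add:
  fixes F :: "'m \<Rightarrow> 'c::ab_group_add \<Rightarrow> 'r::ab_group_add"
  assumes "\<And>m a b. F m (a + b) = F m a + F m b"
  shows "(\<Sum>m\<in>Poly_Mapping.keys (p + q). F m (Poly_Mapping.lookup (p + q) m)) =
    (\<Sum>m\<in>Poly_Mapping.keys p. F m (Poly_Mapping.lookup p m)) +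
    (\<Sum>m\<in>Poly_Mapping.keys q. F m (Poly_Mapping.lookup q m))"
proof -
  let ?X = "Poly_Mapping.keys p \<union> Poly_Mapping.keys q"
  have 0: "F m 0 = 0" for m using assms[of m 0 0] by simp
  have "(\<Sum>m\<in>Poly_Mapping.keys (p + q). F m (Poly_Mapping.lookup (p + q) m)) =
      (\<Sum>m\<in>?X. F m (Poly_Mapping.lookup (p + q) m))"
    by (rule lin_ext_superset) (use 0 Poly_Mapping.keys_add[of p q] in auto)
  also have "\<dots> = (\<Sum>m\<in>?X. F m (Poly_Mapping.lookup p m)) + (\<Sum>m\<in>?X. F m (Poly_Mapping.lookup q m))"
    by (simp add: lookup_add assms sum.distrib)
  finally show ?thesis using 0 by (simp add: lin_ext_superset[where X = ?X and F = F])
qed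

lemma lin_ext_single:
  assumes "F m 0 = 0"
  shows "(\<Sum>k\<in>Poly_Mapping.keys (Poly_Mapping.single m c). F k (Poly_Mapping.lookup (Poly_Mapping.single m c) k)) = F m c"
  by (cases "c = 0") (simp_all add: assms)

context
  fixes c :: "complex \<Rightarrow> 'r::comm_ring_1" and g :: "'x \<Rightarrow> 'r"
  assumes c: "ring_hom c"
begin

lemma ev_add: "ev c g (p + q) = ev c g p + ev c g q"
  unfolding ev_def by (rule lin_ext_add[where F = "\<lambda>m a. c a * mon_eval g m"])
    (simp add: ring_homD[OF c] algebra_simps)

lemma ev_single: "ev c g (Poly_Mapping.single m a) = c a * mon_eval g m"
  unfolding ev_def by (rule lin_ext_single[where F = "\<lambda>m a. c a * mon_eval g m"])
    (simp add: ring_homD[OF c])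

lemma ev_mult: "ev c g (p * q) = ev c g p * ev c g q"
proof (induction p rule: poly_mapping_induct_single)
  case zero then show ?case using ev_add[of 0 0] by simp
next
  case (add p m a)
  have "ev c g (Poly_Mapping.single m a * q) = ev c g (Poly_Mapping.single m a) * ev c g q"
  proof (induction q rule: poly_mapping_induct_single)
    case zero then show ?case using ev_add[of 0 0] by simp
  next
    case (add q m' a')
    then show ?case
      by (simp add: distrib_left ev_add mult_single ev_single mon_eval_add ring_homD[OF c])
  qed
  then show ?case using add by (simp add: distrib_right ev_add)
qed

lemma ring_hom_ev: "ring_hom (ev c g)"
  unfolding ring_hom_def using ev_add ev_mult ev_single[of 0 1]
  by (simp add: ring_homD[OF c] flip: single_one)

lemma ev_pvar [simp]: "ev c g (pvar x) = g x"
  by (simp add: pvar_def ev_single ring_homD[OF c] mon_eval_single)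

lemma ev_const [simp]: "ev c g (const a) = c a"
  by (simp add: const_def ev_single ring_homD[OF c])

end

lemma ring_hom_const: "ring_hom const"
  by (simp add: ring_hom_def const_def single_add mult_single)

lemma free_lift_ev: "free_lift = ev const"
  by (intro ext) (simp add: free_lift_def ev_def mon_eval_def)

lemma ring_hom_free_lift: "ring_hom (free_lift g)"
  by (simp add: free_lift_ev ring_hom_ev ring_hom_const)

lemma free_lift_pvar [simp]: "free_lift g (pvar x) = g x"
  by (simp add: free_lift_ev ring_hom_const)

lemma free_lift_const [simp]: "free_lift g (const a) = const a"
  by (simp add: free_lift_ev ring_hom_const)

lemma ring_hom_counit: "ring_hom counit"
  and counit_pvar [simp]: "counit (pvar b) = b"
  and counit_const [simp]: "counit (const a) = const a"
  by (simp_all add: counit_def ring_hom_free_lift)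

lemma ring_hom_free_map: "ring_hom (free_map g)"
  and free_map_pvar [simp]: "free_map g (pvar x) = pvar (g x)"
  and free_map_const [simp]: "free_map g (const a) = const a"
  by (simp_all add: free_map_def ring_hom_free_lift)

section \<open>The subalgebra on a set of variables\<close>

lemma const_mult_single: "const c * Poly_Mapping.single m a = Poly_Mapping.single m (c * a)"
  by (simp add: const_def mult_single)

lemma lookup_const_mult: "Poly_Mapping.lookup (const c * p) m = c * Poly_Mapping.lookup p m"
  by (induction p rule: poly_mapping_induct_single)
    (simp_all add: distrib_left lookup_add const_mult_single lookup_single when_def)

lemma single_mon_eval:
  "Poly_Mapping.single m 1 = mon_eval pvar (m :: 'x \<Rightarrow>\<^sub>0 nat)"
proof (induction m rule: update_induct)
  case const then show ?case by simp
next
  case (update f a b)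
  have *: "Poly_Mapping.update a b f = f + Poly_Mapping.single a b"
    by (rule poly_mapping_eqI)
      (use update(1) in \<open>auto simp: lookup_update lookup_add lookup_single in_keys_iff when_def\<close>)
  have "Poly_Mapping.single (Poly_Mapping.single a b) 1 = pvar a ^ b"
  proof (induction b)
    case (Suc b)
    have "Poly_Mapping.single (Poly_Mapping.single a (Suc b)) (1::complex) = pvar a * Poly_Mapping.single (Poly_Mapping.single a b) 1"
      by (simp add: pvar_def mult_single flip: single_add)
    then show ?case using Suc by simp
  qed simp
  then have "Poly_Mapping.single (f + Poly_Mapping.single a b) 1 = mon_eval pvar f * pvar a ^ b"
    by (metis mult_single mult_1 update(3))
  then show ?case
    by (simp add: * mon_eval_add mon_eval_single)
qed

lemma keys_uminus: "Poly_Mapping.keys (- p :: 'a \<Rightarrow>\<^sub>0 'b::ab_group_add) = Poly_Mapping.keys p"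
  unfolding set_eq_iff in_keys_iff by simp

lemma free_alg_closed:
  assumes "p \<in> free_alg X" "q \<in> free_alg X"
  shows "p + q \<in> free_alg X" "p * q \<in> free_alg X" "- p \<in> free_alg X" "p - q \<in> free_alg X"
proof -
  show "p + q \<in> free_alg X"
    using assms Poly_Mapping.keys_add[of p q] unfolding free_alg_def by blast
  show "p * q \<in> free_alg X"
    unfolding free_alg_def
  proof (intro CollectI ballI)
    fix m assume "m \<in> Poly_Mapping.keys (p * q)"
    then obtain a b where "a \<in> Poly_Mapping.keys p" "b \<in> Poly_Mapping.keys q" "m = a + b"
      using keys_mult[of p q] by blast
    then show "Poly_Mapping.keys m \<subseteq> X"
      using assms Poly_Mapping.keys_add[of a b] unfolding free_alg_def by blast
  qed
  have m: "- p \<in> free_alg X" if "p \<in> free_alg X" for p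
    using that by (simp only: free_alg_def keys_uminus mem_Collect_eq)
  show "- p \<in> free_alg X" by (rule m[OF assms(1)])
  show "p - q \<in> free_alg X"
    using Poly_Mapping.keys_add[of p "- q"] assms(1) m[OF assms(2)] unfolding free_alg_def by auto
qed

lemma free_alg_const: "const c \<in> free_alg X"
  by (cases "c = 0") (simp_all add: free_alg_def const_def)

lemma free_alg_01: "0 \<in> free_alg X" "1 \<in> free_alg X"
  by (simp_all add: free_alg_def)

lemma free_alg_pvar: "x \<in> X \<Longrightarrow> pvar x \<in> free_alg X"
  by (simp add: free_alg_def pvar_def)

lemma free_alg_prod: "(\<And>i. i \<in> I \<Longrightarrow> f i \<in> free_alg X) \<Longrightarrow> (\<Prod>i\<in>I. f i) \<in> free_alg X"
  by (induction I rule: infinite_finite_induct) (simp_all add: free_alg_closed free_alg_01)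

lemma free_alg_power: "p \<in> free_alg X \<Longrightarrow> p ^ n \<in> free_alg X"
  by (induction n) (simp_all add: free_alg_closed free_alg_01)

lemma poly_mapping_sum_single:
  "(p :: 'a \<Rightarrow>\<^sub>0 'b::comm_monoid_add) = (\<Sum>m\<in>Poly_Mapping.keys p. Poly_Mapping.single m (Poly_Mapping.lookup p m))"
  by (rule poly_mapping_eqI)
    (auto simp: lookup_sum lookup_single when_def in_keys_iff sum.delta)

lemma sum_closed_induct:
  assumes "P 0" "\<And>p q. P p \<Longrightarrow> P q \<Longrightarrow> P (p + q)" "\<And>i. i \<in> I \<Longrightarrow> P (f i)"
  shows "P (\<Sum>i\<in>I. f i :: 'a::comm_monoid_add)"
  using assms(3) by (induction I rule: infinite_finite_induct) (auto intro: assms(1,2))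

lemma prod_closed_induct:
  assumes "P 1" "\<And>p q. P p \<Longrightarrow> P q \<Longrightarrow> P (p * q)" "\<And>i. i \<in> I \<Longrightarrow> P (f i)"
  shows "P (\<Prod>i\<in>I. f i :: 'a::comm_monoid_mult)"
  using assms(3) by (induction I rule: infinite_finite_induct) (auto intro: assms(1,2))

lemma power_closed_induct:
  assumes "P 1" "\<And>p q. P p \<Longrightarrow> P q \<Longrightarrow> P (p * q)" "P x"
  shows "P (x ^ n :: 'a::comm_monoid_mult)"
  by (induction n) (auto intro: assms)

lemma free_alg_induct [consumes 1, case_names const pvar add mult]:
  assumes p: "p \<in> free_alg X"
    and const: "\<And>c. P (const c)" and pvar: "\<And>x. x \<in> X \<Longrightarrow> P (pvar x)"
    and add: "\<And>p q. p \<in> free_alg X \<Longrightarrow> q \<in> free_alg X \<Longrightarrow> P p \<Longrightarrow> P q \<Longrightarrow> P (p + q)"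
    and mult: "\<And>p q. p \<in> free_alg X \<Longrightarrow> q \<in> free_alg X \<Longrightarrow> P p \<Longrightarrow> P q \<Longrightarrow> P (p * q)"
  shows "P p"
proof -
  \<comment> \<open>Membership is carried along, because the cases for sums and products assume it
    of both operands.\<close>
  let ?Q = "\<lambda>p. p \<in> free_alg X \<and> P p"
  have c: "?Q (const c)" for c by (simp add: free_alg_const const)
  have 0: "?Q 0" using c[of 0] by (simp add: const_def)
  have 1: "?Q 1" using c[of 1] by (simp add: const_def)
  have A: "?Q p \<Longrightarrow> ?Q q \<Longrightarrow> ?Q (p + q)" for p q by (simp add: free_alg_closed add)
  have M: "?Q p \<Longrightarrow> ?Q q \<Longrightarrow> ?Q (p * q)" for p q by (simp add: free_alg_closed mult)
  have mon: "?Q (mon_eval pvar m)" if "Poly_Mapping.keys m \<subseteq> X" for m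
    unfolding mon_eval_def
  proof (rule prod_closed_induct[where P = ?Q, OF 1 M])
    fix x assume "x \<in> Poly_Mapping.keys m"
    then have x: "?Q (pvar x)" using that by (auto simp: free_alg_pvar pvar)
    show "?Q (pvar x ^ Poly_Mapping.lookup m x)"
      by (rule power_closed_induct[where P = ?Q, OF 1 M x])
  qed auto
  have "?Q (\<Sum>m\<in>Poly_Mapping.keys p. Poly_Mapping.single m (Poly_Mapping.lookup p m))"
  proof (rule sum_closed_induct[where P = ?Q, OF 0 A])
    fix m assume "m \<in> Poly_Mapping.keys p"
    then have "?Q (const (Poly_Mapping.lookup p m) * mon_eval pvar m)"
      using p by (intro M c mon) (auto simp: free_alg_def)
    then show "?Q (Poly_Mapping.single m (Poly_Mapping.lookup p m))"
      by (simp add: const_mult_single flip: single_mon_eval)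
  qed auto
  then show ?thesis by (simp flip: poly_mapping_sum_single)
qed

lemma pol_induct [case_names const pvar add mult]:
  fixes p :: "'x pol"
  assumes "\<And>c. P (const c)" "\<And>x. P (pvar x)"
    "\<And>p q. P p \<Longrightarrow> P q \<Longrightarrow> P (p + q)" "\<And>p q. P p \<Longrightarrow> P q \<Longrightarrow> P (p * q)"
  shows "P p"
proof -
  have "p \<in> free_alg UNIV" by (simp add: free_alg_def)
  then show ?thesis by (induction rule: free_alg_induct) (use assms in auto)
qed

lemma ring_hom_pol_eqI:
  fixes p :: "'x pol"
  assumes "ring_hom f" "ring_hom g" "\<And>c. f (const c) = g (const c)" "\<And>x. f (pvar x) = g (pvar x)"
  shows "f p = g p"
  by (induction p rule: pol_induct) (use assms in \<open>simp_all add: ring_homD\<close>)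

lemma free_map_comp: "free_map f (free_map g p) = free_map (\<lambda>x. f (g x)) p"
  by (rule ring_hom_pol_eqI[where f = "\<lambda>p. free_map f (free_map g p)"])
    (simp_all add: ring_hom_comp ring_hom_free_map)

lemma free_map_ident: "free_map (\<lambda>x. x) p = p"
  by (rule ring_hom_pol_eqI[where g = "\<lambda>p. p"])
    (simp_all add: ring_hom_id ring_hom_free_map)

text \<open>Naturality of the counit. Taken at \<open>counit\<close> and at
  \<open>free_map counit\<close> it gives simplicial identities of the standard resolution; taken at
  the torus action it shows that the action commutes with the faces.\<close>

lemma counit_free_map:
  assumes "ring_hom f" "\<And>c. f (const c) = const c"
  shows "counit (free_map f p) = f (counit p)"
  by (rule ring_hom_pol_eqI[where f = "\<lambda>p. counit (free_map f p)" and g = "\<lambda>p. f (counit p)"])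
    (simp_all add: assms ring_hom_comp ring_hom_free_map ring_hom_counit)

lemma counit_counit: "counit (free_map counit p) = counit (counit p)"
  by (rule counit_free_map) (simp_all add: ring_hom_counit)

definition subalg :: "('k::comm_monoid_add \<Rightarrow>\<^sub>0 complex) set \<Rightarrow> bool" where
  "subalg A \<longleftrightarrow> (\<forall>c. const c \<in> A) \<and> (\<forall>a\<in>A. \<forall>b\<in>A. a + b \<in> A \<and> a * b \<in> A)"

lemma subalg_free_alg: "subalg (free_alg X)"
  by (simp add: subalg_def free_alg_const free_alg_closed)

lemma free_lift_in:
  assumes "subalg A" "\<And>x. x \<in> X \<Longrightarrow> g x \<in> A" "p \<in> free_alg X"
  shows "free_lift g p \<in> A"
  using assms(3)
  by (induction rule: free_alg_induct)
    (use assms(1,2) in \<open>simp_all add: subalg_def ring_homD[OF ring_hom_free_lift]\<close>)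

lemma counit_in: "subalg A \<Longrightarrow> p \<in> free_alg A \<Longrightarrow> counit p \<in> A"
  unfolding counit_def by (rule free_lift_in)

lemma free_map_in: "(\<And>x. x \<in> X \<Longrightarrow> g x \<in> Y) \<Longrightarrow> p \<in> free_alg X \<Longrightarrow> free_map g p \<in> free_alg Y"
  unfolding free_map_def by (rule free_lift_in) (auto simp: subalg_free_alg free_alg_pvar)

section \<open>Derivations of a polynomial ring\<close>

text \<open>The coefficient of \<open>\<epsilon>\<close> in the value at \<open>a x + \<epsilon> e x\<close>.\<close>

definition der_ext :: "('x \<Rightarrow> ('k::comm_monoid_add \<Rightarrow>\<^sub>0 complex)) \<Rightarrow> ('x \<Rightarrow> ('k \<Rightarrow>\<^sub>0 complex)) \<Rightarrow> 'x pol \<Rightarrow> ('k \<Rightarrow>\<^sub>0 complex)" where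
  "der_ext a e p = Polynomial.coeff (ev (\<lambda>c. [:const c:]) (\<lambda>x. [:a x, e x:]) p) 1"

lemma ring_hom_pCons_const: "ring_hom (\<lambda>c. [:const c:])"
  using ring_hom_const unfolding ring_hom_def by (simp add: one_pCons mult.commute)

lemma ring_hom_coeff_0: "ring_hom (\<lambda>p. Polynomial.coeff p 0)"
  by (simp add: ring_hom_def coeff_mult_0)

text \<open>Coefficient 1 of a product involves only the coefficients 0 and 1 of the factors, so
  polynomials serve as dual numbers. Identifying coefficient 0 with evaluation at \<open>a\<close>
  turns the product formula into the Leibniz rule.\<close>

lemma der_ext_coeff_0:
  "Polynomial.coeff (ev (\<lambda>c. [:const c:]) (\<lambda>x. [:a x, e x:]) p) 0 = free_lift a p"
  by (rule ring_hom_pol_eqI[where f = "\<lambda>p. Polynomial.coeff (ev (\<lambda>c. [:const c:]) (\<lambda>x. [:a x, e x:]) p) 0"])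
    (simp_all add: ring_hom_free_lift ring_hom_comp[OF ring_hom_coeff_0] ring_hom_ev ring_hom_pCons_const)

lemma der_ext_add: "der_ext a e (p + q) = der_ext a e p + der_ext a e q"
  by (simp add: der_ext_def ev_add ring_hom_pCons_const)

lemma der_ext_mult: "der_ext a e (p * q) = free_lift a p * der_ext a e q + free_lift a q * der_ext a e p"
  by (simp add: der_ext_def ev_mult ring_hom_pCons_const coeff_mult der_ext_coeff_0 mult.commute)

lemma der_ext_const [simp]: "der_ext a e (const c) = 0"
  by (simp add: der_ext_def ring_hom_pCons_const)

lemma der_ext_pvar [simp]: "der_ext a e (pvar x) = e x"
  by (simp add: der_ext_def ring_hom_pCons_const)

lemma der_ext_0 [simp]: "der_ext a e 0 = 0"
  using der_ext_add[of a e 0 0] by simp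

lemma der_ext_uminus: "der_ext a e (- p) = - der_ext a e p"
  using der_ext_add[of a e p "- p"] by (simp add: eq_neg_iff_add_eq_0 add.commute)

lemma der_ext_diff: "der_ext a e (p - q) = der_ext a e p - der_ext a e q"
  using der_ext_add[of a e p "- q"] by (simp add: der_ext_uminus)

section \<open>Cocycles on a monoid algebra\<close>

abbreviation chi :: "'k \<Rightarrow> 'k \<Rightarrow>\<^sub>0 complex" where
  "chi s \<equiv> Poly_Mapping.single s 1"

lemma chi_mult: "chi s * chi t = chi (s + t)"
  by (simp add: mult_single)

lemma chi_cancel: "chi (- s) * (chi s * a) = a" "chi s * (chi (- s) * a) = a"
  for s :: "'k::ab_group_add"
  by (simp_all add: mult_single flip: mult.assoc)

text \<open>The linear extension of \<open>g\<close> from the characters. The target may be any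
  monoid algebra, since the section of the counit in \<open>cocycle_rep\<close> has values in
  polynomials.\<close>

definition lin :: "('k \<Rightarrow> ('j::comm_monoid_add \<Rightarrow>\<^sub>0 complex)) \<Rightarrow> ('k \<Rightarrow>\<^sub>0 complex) \<Rightarrow> ('j \<Rightarrow>\<^sub>0 complex)" where
  "lin g a = (\<Sum>s\<in>Poly_Mapping.keys a. const (Poly_Mapping.lookup a s) * g s)"

lemma lin_single: "lin g (Poly_Mapping.single s c) = const c * g s"
  unfolding lin_def
  by (rule lin_ext_single[where F = "\<lambda>s c. const c * g s"]) (simp add: ring_homD[OF ring_hom_const])

lemma lin_const_arg: "lin g (const c) = const c * g 0"
  unfolding const_def lin_single by (simp add: const_def)

lemma const_1: "const 1 = 1"
  using ring_homD(1)[OF ring_hom_const] .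

lemma lin_chi [simp]: "lin g (chi s) = g s"
  by (simp add: lin_single const_1)

lemma lin_add: "lin g (a + b) = lin g a + lin g b"
  unfolding lin_def
  by (rule lin_ext_add[where F = "\<lambda>s c. const c * g s"]) (simp add: ring_homD[OF ring_hom_const] algebra_simps)

lemma lin_0 [simp]: "lin g 0 = 0"
  by (simp add: lin_def)

lemma lin_const_mult: "lin g (const c * a) = const c * lin g a"
  by (induction a rule: poly_mapping_induct_single)
    (simp_all add: distrib_left lin_add const_mult_single lin_single ring_homD[OF ring_hom_const] mult.assoc)

lemma lin_plus: "lin (\<lambda>s. g s + h s) a = lin g a + lin h a"
  by (simp add: lin_def distrib_left sum.distrib)

lemma lin_const: "lin (\<lambda>s. const c * g s) a = const c * lin g a"
  by (simp add: lin_def sum_distrib_left mult_ac)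

lemma der_ext_plus: "der_ext a (\<lambda>x. e x + e' x) p = der_ext a e p + der_ext a e' p"
  by (induction p rule: pol_induct) (simp_all add: der_ext_add der_ext_mult algebra_simps)

lemma der_ext_const_scale: "der_ext a (\<lambda>x. const c * e x) p = const c * der_ext a e p"
  by (induction p rule: pol_induct) (simp_all add: der_ext_add der_ext_mult algebra_simps)

text \<open>The differential of degree 0, written for an arbitrary function \<open>E\<close> so that
  it applies to derivations into the whole group algebra. The value 0 off \<open>P1 A\<close>
  follows the convention of \<open>derivations\<close>.\<close>

definition bd :: "('k::comm_monoid_add \<Rightarrow>\<^sub>0 complex) set \<Rightarrow> (('k \<Rightarrow>\<^sub>0 complex) pol \<Rightarrow> ('k \<Rightarrow>\<^sub>0 complex)) \<Rightarrow> 'k cochain1" where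
  "bd A E = (\<lambda>q. if q \<in> P1 A then E (counit q) - E (free_map counit q) else 0)"

lemma coboundaries1_bd: "coboundaries1 A = bd A ` cochains0 A"
  by (simp add: coboundaries1_def bd_def)

text \<open>The derivation along the counit whose value at every variable \<open>[a]\<close>,
  homogeneous or not, is dictated by linearity from the values of \<open>g\<close> on
  characters.\<close>

definition Der :: "('k::comm_monoid_add \<Rightarrow> ('k \<Rightarrow>\<^sub>0 complex)) \<Rightarrow> ('k \<Rightarrow>\<^sub>0 complex) pol \<Rightarrow> ('k \<Rightarrow>\<^sub>0 complex)" where
  "Der g = der_ext (\<lambda>b. b) (lin g)"

lemma Der_simps:
  "Der g (p + q) = Der g p + Der g q"
  "Der g (p * q) = counit p * Der g q + counit q * Der g p"
  "Der g (const c) = 0" "Der g (pvar a) = lin g a" "Der g 0 = 0" "Der g (p - q) = Der g p - Der g q"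
  by (simp_all add: Der_def der_ext_add der_ext_mult der_ext_diff counit_def)

text \<open>A coboundary over the group algebra. For \<open>g\<close> in \<open>Z\<close> its values
  fall into \<open>A\<close>, which makes it a cocycle over \<open>A\<close> that may fail to be a
  coboundary over \<open>A\<close>.\<close>

definition Dcoc :: "('k::comm_monoid_add \<Rightarrow>\<^sub>0 complex) set \<Rightarrow> ('k \<Rightarrow> ('k \<Rightarrow>\<^sub>0 complex)) \<Rightarrow> 'k cochain1" where
  "Dcoc A g = bd A (Der g)"

lemma Der_plus: "Der (\<lambda>s. g s + h s) p = Der g p + Der h p"
  unfolding Der_def lin_plus by (rule der_ext_plus)

lemma Der_const: "Der (\<lambda>s. const c * g s) p = const c * Der g p"
  unfolding Der_def lin_const by (rule der_ext_const_scale)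

lemma Dcoc_plus: "Dcoc A (\<lambda>s. g s + h s) = Dcoc A g + Dcoc A h"
  by (simp add: Dcoc_def bd_def fun_eq_iff Der_plus)

lemma Dcoc_const: "Dcoc A (\<lambda>s. const c * g s) = cochain_scale c (Dcoc A g)"
  by (simp add: Dcoc_def bd_def fun_eq_iff Der_const cochain_scale_def algebra_simps)

lemma lin_zero [simp]: "lin (\<lambda>s. 0) a = 0"
  by (simp add: lin_def)

lemma Dcoc_zero: "Dcoc A (\<lambda>s. 0) = 0"
  using Dcoc_plus[of A "\<lambda>s. 0" "\<lambda>s. 0"] by simp

section \<open>Monoid algebras and derivations modulo the algebra\<close>

locale monoid_alg =
  fixes S :: "'k::ab_group_add set"
  assumes zero_S: "0 \<in> S" and add_S: "s \<in> S \<Longrightarrow> t \<in> S \<Longrightarrow> s + t \<in> S"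
begin

abbreviation A :: "('k \<Rightarrow>\<^sub>0 complex) set" where "A \<equiv> monoid_algebra S"

lemma A_single: "s \<in> S \<Longrightarrow> Poly_Mapping.single s c \<in> A"
  by (simp add: monoid_algebra_def)

lemma A_0: "0 \<in> A" and A_const: "const c \<in> A"
  using A_single[OF zero_S] by (auto simp: monoid_algebra_def const_def zero_S)

lemma A_add: "a \<in> A \<Longrightarrow> b \<in> A \<Longrightarrow> a + b \<in> A"
  using Poly_Mapping.keys_add[of a b] unfolding monoid_algebra_def by blast

lemma A_mult: "a \<in> A \<Longrightarrow> b \<in> A \<Longrightarrow> a * b \<in> A"
  using keys_mult[of a b] add_S unfolding monoid_algebra_def by blast

lemma A_uminus: "a \<in> A \<Longrightarrow> - a \<in> A"
  by (simp only: monoid_algebra_def keys_uminus mem_Collect_eq)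

lemma A_diff: "a \<in> A \<Longrightarrow> b \<in> A \<Longrightarrow> a - b \<in> A"
  using A_add[of a "- b"] A_uminus[of b] by simp

lemma A_sum: "(\<And>i. i \<in> I \<Longrightarrow> f i \<in> A) \<Longrightarrow> (\<Sum>i\<in>I. f i) \<in> A"
  by (induction I rule: infinite_finite_induct) (simp_all add: A_add A_0)

lemma subalg_A: "subalg A"
  by (simp add: subalg_def A_const A_add A_mult)

lemma A_induct [consumes 1, case_names zero add single]:
  assumes "a \<in> A" "P 0" "\<And>a b. a \<in> A \<Longrightarrow> b \<in> A \<Longrightarrow> P a \<Longrightarrow> P b \<Longrightarrow> P (a + b)"
    "\<And>s c. s \<in> S \<Longrightarrow> P (const c * chi s)"
  shows "P a"
proof -
  have "(\<Sum>s\<in>Poly_Mapping.keys a. Poly_Mapping.single s (Poly_Mapping.lookup a s)) \<in> A \<and>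
      P (\<Sum>s\<in>Poly_Mapping.keys a. Poly_Mapping.single s (Poly_Mapping.lookup a s))"
  proof (rule sum_closed_induct[where P = "\<lambda>a. a \<in> A \<and> P a"])
    show "0 \<in> A \<and> P 0" using A_0 assms(2) by blast
    show "p + q \<in> A \<and> P (p + q)" if "p \<in> A \<and> P p" "q \<in> A \<and> P q" for p q
      using that A_add assms(3) by blast
  next
    fix s assume "s \<in> Poly_Mapping.keys a"
    then have "s \<in> S" using assms(1) by (auto simp: monoid_algebra_def)
    then show "Poly_Mapping.single s (Poly_Mapping.lookup a s) \<in> A \<and> P (Poly_Mapping.single s (Poly_Mapping.lookup a s))"
      using A_single assms(4)[of s "Poly_Mapping.lookup a s"] by (simp add: const_mult_single)
  qed
  then show ?thesis by (simp flip: poly_mapping_sum_single)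
qed

text \<open>With L the group algebra, these are the derivations of A into L/A, recorded on
  characters by representatives in L.\<close>

definition Z :: "('k \<Rightarrow> ('k \<Rightarrow>\<^sub>0 complex)) set" where
  "Z = {g. \<forall>s\<in>S. \<forall>t\<in>S. chi s * g t + chi t * g s - g (s + t) \<in> A}"

text \<open>For additive \<open>l\<close> the function \<open>chi s * l s\<close> is a derivation
  into L itself. Thus \<open>Z\<close> modulo \<open>Bd\<close> is the cokernel of Der(A, L) to
  Der(A, L/A), which the long exact sequence identifies with T^1 as soon as T^1 with coefficients in
  L vanishes.\<close>

definition Bd :: "('k \<Rightarrow> ('k \<Rightarrow>\<^sub>0 complex)) set" where
  "Bd = {g. \<exists>l. (\<forall>s\<in>S. \<forall>t\<in>S. l (s + t) = l s + l t) \<and> (\<forall>s\<in>S. g s - chi s * l s \<in> A)}"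

lemma lin_in: "(\<And>s. s \<in> S \<Longrightarrow> g s \<in> A) \<Longrightarrow> a \<in> A \<Longrightarrow> lin g a \<in> A"
  unfolding lin_def by (intro A_sum A_mult A_const) (auto simp: monoid_algebra_def)

lemma lin_mult:
  assumes g: "g \<in> Z" and "a \<in> A" "b \<in> A"
  shows "a * lin g b + b * lin g a - lin g (a * b) \<in> A"
  using \<open>a \<in> A\<close>
proof (induction rule: A_induct)
  case zero show ?case by (simp add: A_0)
next
  case (add a a')
  have "(a + a') * lin g b + b * lin g (a + a') - lin g ((a + a') * b) =
     (a * lin g b + b * lin g a - lin g (a * b)) + (a' * lin g b + b * lin g a' - lin g (a' * b))"
    by (simp add: lin_add algebra_simps)
  then show ?case using add A_add by simp
next
  case (single s c)
  show ?case using \<open>b \<in> A\<close>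
  proof (induction rule: A_induct)
    case zero show ?case by (simp add: A_0)
  next
    case (add b b')
    let ?a = "const c * chi s"
    have "?a * lin g (b + b') + (b + b') * lin g ?a - lin g (?a * (b + b')) =
       (?a * lin g b + b * lin g ?a - lin g (?a * b)) + (?a * lin g b' + b' * lin g ?a - lin g (?a * b'))"
      by (simp add: lin_add algebra_simps)
    then show ?case using add A_add by simp
  next
    case (single t d)
    have "const c * chi s * (const d * chi t) = const c * (const d * (chi s * chi t))"
      by (simp add: algebra_simps)
    then have "const c * chi s * lin g (const d * chi t) + const d * chi t * lin g (const c * chi s) -
        lin g (const c * chi s * (const d * chi t)) =
      const c * const d * (chi s * g t + chi t * g s - g (s + t))"
      by (simp add: lin_const_mult chi_mult) (simp add: algebra_simps)
    also have "\<dots> \<in> A"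
      using g single \<open>s \<in> S\<close> by (intro A_mult A_const) (auto simp: Z_def)
    finally show ?case .
  qed
qed

lemma counit_in_A: "p \<in> P0 A \<Longrightarrow> counit p \<in> A"
  unfolding P0_def by (rule counit_in[OF subalg_A])

text \<open>Modulo \<open>A\<close> the Leibniz rule holds for \<open>g\<close>, so
  \<open>Der g\<close> sees only the image under the counit. The two faces of an element of
  \<open>P1 A\<close> have the same image there, hence their values differ by an element of
  \<open>A\<close>.\<close>

lemma Der_mod_A:
  assumes "g \<in> Z" "p \<in> P0 A"
  shows "Der g p - lin g (counit p) \<in> A"
  using assms(2) unfolding P0_def
proof (induction rule: free_alg_induct)
  case (const c)
  \<comment> \<open>The Leibniz rule at \<open>0 + 0\<close> puts \<open>g 0\<close> into
    \<open>A\<close>, which settles the constants.\<close>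
  have "chi 0 * g 0 + chi 0 * g 0 - g (0 + 0) \<in> A"
    using assms(1) zero_S unfolding Z_def by blast
  then have "g 0 \<in> A" by simp
  then have "- (const c * g 0) \<in> A" by (intro A_uminus A_mult A_const)
  then show ?case by (simp add: Der_simps lin_const_arg)
next
  case (pvar x)
  then show ?case by (simp add: Der_simps A_0)
next
  case (add p q)
  have "Der g (p + q) - lin g (counit (p + q)) =
      (Der g p - lin g (counit p)) + (Der g q - lin g (counit q))"
    by (simp add: Der_simps ring_homD[OF ring_hom_counit] lin_add)
  then show ?case using add A_add by simp
next
  case (mult p q)
  have "Der g (p * q) - lin g (counit (p * q)) =
      counit p * (Der g q - lin g (counit q)) + counit q * (Der g p - lin g (counit p)) +
      (counit p * lin g (counit q) + counit q * lin g (counit p) - lin g (counit p * counit q))"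
    by (simp add: Der_simps ring_homD[OF ring_hom_counit] algebra_simps)
  also have "\<dots> \<in> A"
    using mult counit_in_A lin_mult[OF assms(1)] by (intro A_add A_mult) (auto simp: P0_def)
  finally show ?case .
qed

lemma faces_in:
  assumes "q \<in> P1 A"
  shows "counit q \<in> P0 A" "free_map counit q \<in> P0 A"
  using assms counit_in[OF subalg_free_alg] free_map_in[where g = counit, OF counit_in_A]
  unfolding P1_def P0_def by auto

text \<open>Only the difference of \<open>E\<close> at the two faces is asked to lie in
  \<open>A\<close>. The six terms of the cocycle equation cancel in pairs by the simplicial
  identities \<open>s1\<close>, \<open>s2\<close>, \<open>s3\<close>.\<close>

lemma bd_cocycle:
  assumes "\<And>p q. E (p + q) = E p + E q" "\<And>c p. E (const c * p) = const c * E p"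
    "\<And>p q. E (p * q) = counit p * E q + counit q * E p"
    "\<And>q. q \<in> P1 A \<Longrightarrow> E (counit q) - E (free_map counit q) \<in> A"
  shows "bd A E \<in> cocycles1 A"
proof -
  have cl: "p + q \<in> P1 A" "p * q \<in> P1 A" "const c * p \<in> P1 A" if "p \<in> P1 A" "q \<in> P1 A" for p q c
    using that by (simp_all add: P1_def free_alg_closed free_alg_const)
  have 1: "bd A E \<in> cochains1 A"
    unfolding cochains1_def derivations_def
    using assms(4)
    by (auto simp: bd_def cl ring_homD[OF ring_hom_counit] ring_homD[OF ring_hom_free_map]
        assms(1-3) counit_counit) (simp_all add: algebra_simps)
  have "bd A E (counit w) - bd A E (free_map counit w) + bd A E (free_map (free_map counit) w) = 0"
    if w: "w \<in> P2 A" for w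
  proof -
    have w1: "counit w \<in> P1 A" "free_map counit w \<in> P1 A" "free_map (free_map counit) w \<in> P1 A"
      using w counit_in[OF subalg_free_alg] free_map_in[where g = counit, OF faces_in(1)]
        free_map_in[where g = "free_map counit", OF faces_in(2)]
      unfolding P2_def P1_def P0_def by auto
    have s1: "counit (free_map counit w) = counit (counit w)" by (rule counit_counit)
    have s2: "counit (free_map (free_map counit) w) = free_map counit (counit w)"
      by (rule counit_free_map) (simp_all add: ring_hom_free_map)
    have s3: "free_map counit (free_map (free_map counit) w) = free_map counit (free_map counit w)"
      by (simp add: free_map_comp counit_counit)
    show ?thesis using w1 by (simp add: bd_def s1 s2 s3)
  qed
  then show ?thesis using 1 by (simp add: cocycles1_def)
qed

lemma Dcoc_cocycle:
  assumes "g \<in> Z"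
  shows "Dcoc A g \<in> cocycles1 A"
  unfolding Dcoc_def
proof (rule bd_cocycle)
  fix q assume q: "q \<in> P1 A"
  have "Der g (counit q) - Der g (free_map counit q) =
    (Der g (counit q) - lin g (counit (counit q))) - (Der g (free_map counit q) - lin g (counit (free_map counit q)))"
    by (simp add: counit_counit)
  also have "\<dots> \<in> A" using faces_in[OF q] assms by (intro A_diff Der_mod_A)
  finally show "Der g (counit q) - Der g (free_map counit q) \<in> A" .
qed (simp_all add: Der_simps)

lemma der_cochain0:
  assumes "\<And>a. a \<in> A \<Longrightarrow> e a \<in> A"
  shows "(\<lambda>p. if p \<in> P0 A then der_ext (\<lambda>b. b) e p else 0) \<in> cochains0 A"
proof -
  have cl: "p + q \<in> P0 A" "p * q \<in> P0 A" "const c * p \<in> P0 A" if "p \<in> P0 A" "q \<in> P0 A" for p q c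
    using that by (simp_all add: P0_def free_alg_closed free_alg_const)
  have "der_ext (\<lambda>b. b) e p \<in> A" if "p \<in> P0 A" for p
    using that unfolding P0_def
  proof (induction rule: free_alg_induct)
    case (mult p q)
    then show ?case using counit_in_A[unfolded P0_def]
      by (auto simp: der_ext_mult simp flip: counit_def intro!: A_add A_mult)
  qed (simp_all add: der_ext_add A_0 A_add assms)
  then show ?thesis
    by (auto simp: cochains0_def derivations_def cl der_ext_add der_ext_mult simp flip: counit_def)
qed

lemma bd_cochain0_der:
  "bd A (\<lambda>p. if p \<in> P0 A then der_ext (\<lambda>b. b) e p else 0) = bd A (der_ext (\<lambda>b. b) e)"
  by (auto simp: bd_def fun_eq_iff faces_in)

text \<open>Split off the part \<open>chi s * l s\<close>. It is a derivation on the characters, so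
  its \<open>Der\<close> factors through the counit and has equal values at both faces; the
  remaining part has values in \<open>A\<close> and gives a cochain over \<open>A\<close>.\<close>

lemma Dcoc_in_coboundaries:
  assumes "g \<in> Bd"
  shows "Dcoc A g \<in> coboundaries1 A"
proof -
  obtain l where l: "\<And>s t. s \<in> S \<Longrightarrow> t \<in> S \<Longrightarrow> l (s + t) = l s + l t"
    and gl: "\<And>s. s \<in> S \<Longrightarrow> g s - chi s * l s \<in> A"
    using assms unfolding Bd_def by blast
  let ?h = "\<lambda>s. chi s * l s" and ?e = "\<lambda>s. g s - chi s * l s"
  have lm: "a * lin ?h b + b * lin ?h a = lin ?h (a * b)" if "a \<in> A" "b \<in> A" for a b
    using that(1)
  proof (induction rule: A_induct)
    case (single s c)
    show ?case using that(2)
    proof (induction rule: A_induct)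
      case (single t d)
      have "const c * chi s * (const d * chi t) = const c * (const d * (chi s * chi t))"
        by (simp add: algebra_simps)
      then show ?case using \<open>s \<in> S\<close> \<open>t \<in> S\<close>
        by (simp add: lin_const_mult chi_mult l) (simp add: algebra_simps flip: chi_mult)
    qed (simp_all add: lin_add algebra_simps)
  qed (simp_all add: lin_add algebra_simps)
  have l0: "l 0 = 0" using l[OF zero_S zero_S] by simp
  have D: "Der ?h p = lin ?h (counit p)" if "p \<in> P0 A" for p
    using that unfolding P0_def
  proof (induction rule: free_alg_induct)
    case (const c)
    then show ?case by (simp add: Der_simps lin_const_arg l0)
  next
    case (mult p q)
    then show ?case using lm[of "counit p" "counit q"] counit_in_A[unfolded P0_def]
      by (simp add: Der_simps ring_homD[OF ring_hom_counit])
  qed (simp_all add: Der_simps ring_homD[OF ring_hom_counit] lin_add)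
  have "Dcoc A ?h = 0"
    by (auto simp: Dcoc_def bd_def fun_eq_iff D faces_in counit_counit)
  then have "Dcoc A g = Dcoc A ?e"
    using Dcoc_plus[of A ?e ?h] by simp
  also have "\<dots> = bd A (\<lambda>p. if p \<in> P0 A then der_ext (\<lambda>b. b) (lin ?e) p else 0)"
    by (simp add: bd_cochain0_der Dcoc_def Der_def)
  also have "\<dots> \<in> coboundaries1 A"
    unfolding coboundaries1_bd by (intro imageI der_cochain0 lin_in gl)
  finally show ?thesis .
qed

lemma pvar_in: "a \<in> A \<Longrightarrow> pvar a \<in> P0 A" "p \<in> P0 A \<Longrightarrow> pvar p \<in> P1 A" "q \<in> P1 A \<Longrightarrow> pvar q \<in> P2 A"
  by (simp_all add: P0_def P1_def P2_def free_alg_pvar)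

lemma P_closed:
  "p \<in> P0 A \<Longrightarrow> q \<in> P0 A \<Longrightarrow> p + q \<in> P0 A" "p \<in> P0 A \<Longrightarrow> q \<in> P0 A \<Longrightarrow> p * q \<in> P0 A"
  "p \<in> P0 A \<Longrightarrow> q \<in> P0 A \<Longrightarrow> p - q \<in> P0 A" "p \<in> P0 A \<Longrightarrow> - p \<in> P0 A" "0 \<in> P0 A" "1 \<in> P0 A" "const c \<in> P0 A"
  "x \<in> P1 A \<Longrightarrow> y \<in> P1 A \<Longrightarrow> x + y \<in> P1 A" "x \<in> P1 A \<Longrightarrow> y \<in> P1 A \<Longrightarrow> x * y \<in> P1 A"
  "x \<in> P1 A \<Longrightarrow> y \<in> P1 A \<Longrightarrow> x - y \<in> P1 A" "x \<in> P1 A \<Longrightarrow> - x \<in> P1 A"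
  by (simp_all add: P0_def P1_def free_alg_closed free_alg_01 free_alg_const)

text \<open>\<open>Der g\<close> and the cochain \<open>E\<close> have the same coboundary, so their
  difference \<open>G\<close> vanishes on the kernel of the counit. Hence \<open>G\<close> satisfies
  the Leibniz rule on characters, and division by \<open>chi s\<close> makes it additive.\<close>

lemma coboundary_in_Bd:
  assumes "Dcoc A g \<in> coboundaries1 A"
  shows "g \<in> Bd"
proof -
  obtain E where E: "E \<in> cochains0 A" and DE: "Dcoc A g = bd A E"
    using assms unfolding coboundaries1_bd by blast
  have Eadd: "E (p + q) = E p + E q" if "p \<in> P0 A" "q \<in> P0 A" for p q
    using E that by (simp add: cochains0_def derivations_def)
  have Emult: "E (p * q) = counit p * E q + counit q * E p" if "p \<in> P0 A" "q \<in> P0 A" for p q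
    using E that by (simp add: cochains0_def derivations_def)
  have E0: "E 0 = 0" using Eadd[of 0 0] by (simp add: P_closed)
  define G where "G p = Der g p - E p" for p
  have Gadd: "G (p + q) = G p + G q" if "p \<in> P0 A" "q \<in> P0 A" for p q
    using that by (simp add: G_def Eadd Der_simps)
  have GI: "G i = 0" if i: "i \<in> P0 A" "counit i = 0" for i
  proof -
    \<comment> \<open>The faces of \<open>[i] - [0]\<close> are \<open>i\<close> and 0.\<close>
    have q: "pvar i - pvar 0 \<in> P1 A" using i by (intro P_closed pvar_in)
    have "Der g (counit (pvar i - pvar 0)) - Der g (free_map counit (pvar i - pvar 0)) =
        E (counit (pvar i - pvar 0)) - E (free_map counit (pvar i - pvar 0))"
      using fun_cong[OF DE, of "pvar i - pvar 0"] q by (simp add: Dcoc_def bd_def)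
    moreover have "counit (pvar i - pvar 0) = i" "free_map counit (pvar i - pvar 0) = 0"
      using i by (simp_all add: ring_homD[OF ring_hom_counit] ring_homD[OF ring_hom_free_map])
    ultimately show ?thesis by (simp add: G_def E0 Der_simps)
  qed
  define l where "l s = chi (- s) * G (pvar (chi s))" for s
  have Gl: "G (pvar (chi s)) = chi s * l s" for s
    by (simp add: l_def chi_cancel)
  have "l (s + t) = l s + l t" if s: "s \<in> S" "t \<in> S" for s t
  proof -
    let ?x = "pvar (chi s)" and ?y = "pvar (chi t)" and ?z = "pvar (chi (s + t))"
    have in0: "?x \<in> P0 A" "?y \<in> P0 A" "?z \<in> P0 A" using s by (auto intro!: pvar_in A_single add_S)
    have "G (?x * ?y - ?z) = 0"
      using in0 by (intro GI P_closed) (simp_all add: ring_homD[OF ring_hom_counit] chi_mult)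
    then have "G (?x * ?y) = G ?z"
      using Gadd[of "?x * ?y - ?z" ?z] in0 by (simp add: P_closed)
    moreover have "G (?x * ?y) = chi s * G ?y + chi t * G ?x"
      using in0 by (simp add: G_def Emult Der_simps algebra_simps)
    moreover have "chi s * G ?y + chi t * G ?x = chi (s + t) * (l s + l t)"
      unfolding Gl by (simp add: algebra_simps flip: chi_mult)
    ultimately have "chi (s + t) * l (s + t) = chi (s + t) * (l s + l t)"
      by (simp flip: Gl)
    then show ?thesis by (metis chi_cancel(1))
  qed
  moreover have "g s - chi s * l s \<in> A" if "s \<in> S" for s
  proof -
    have "g s - chi s * l s = E (pvar (chi s))"
      by (simp add: G_def Der_simps flip: Gl)
    also have "\<dots> \<in> A" using E pvar_in(1)[OF A_single[OF that, of 1]] by (simp add: cochains0_def derivations_def)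
    finally show ?thesis .
  qed
  ultimately show ?thesis unfolding Bd_def by blast
qed

lemma Dcoc_coboundary_iff: "Dcoc A g \<in> coboundaries1 A \<longleftrightarrow> g \<in> Bd"
  using Dcoc_in_coboundaries coboundary_in_Bd by blast

end

text \<open>
  The group generated by \<open>S\<close> splits off monomials: \<open>u\<close> is the difference of the weights of
  \<open>Yp u\<close> and \<open>Yn u\<close>, compatibly with addition.  This is where freeness of the lattice enters: it
  makes every cocycle with values in the group algebra a coboundary.
\<close>

locale split_monoid_alg = monoid_alg S for S :: "'k::ab_group_add set" +
  assumes split: "\<exists>Yp Yn \<beta>. \<forall>u. Yp u \<in> P0 (monoid_algebra S) \<and> Yn u \<in> P0 (monoid_algebra S) \<and>
    counit (Yn u) = chi (\<beta> u) \<and> counit (Yp u) = chi (u + \<beta> u) \<and>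
    (\<forall>v. Yp u * Yp v * Yn (u + v) = Yn u * Yn v * Yp (u + v))"
begin

text \<open>The cocycle equation expresses \<open>D\<close> by its values \<open>\<delta> p\<close>
  on variables, and on the kernel I of the counit these give a P0-linear map \<open>\<psi>\<close>.
  The aim is a derivation \<open>G\<close> of \<open>P0\<close> into the group algebra that agrees
  with \<open>\<psi>\<close> on I: then \<open>D\<close> is its coboundary, and \<open>G\<close> is
  \<open>Der g\<close> plus a derivation with values in \<open>A\<close>.\<close>

lemma cocycle_rep:
  assumes D: "D \<in> cocycles1 A"
  obtains g b where "g \<in> Z" "b \<in> coboundaries1 A" "D = Dcoc A g + b"
proof -
  obtain Yp Yn \<beta> where Yin: "\<And>u. Yp u \<in> P0 A" "\<And>u. Yn u \<in> P0 A"
    and Yc: "\<And>u. counit (Yn u) = chi (\<beta> u)" "\<And>u. counit (Yp u) = chi (u + \<beta> u)"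
    and Yadd: "\<And>u v. Yp u * Yp v * Yn (u + v) = Yn u * Yn v * Yp (u + v)"
    using split by blast
  have Din: "D q \<in> A" if "q \<in> P1 A" for q
    using D that by (simp add: cocycles1_def cochains1_def derivations_def)
  have Dout: "D q = 0" if "q \<notin> P1 A" for q
    using D that by (simp add: cocycles1_def cochains1_def derivations_def)
  have Dadd: "D (p + q) = D p + D q" if "p \<in> P1 A" "q \<in> P1 A" for p q
    using D that by (simp add: cocycles1_def cochains1_def derivations_def)
  have Dmult: "D (p * q) = counit (counit p) * D q + counit (counit q) * D p" if "p \<in> P1 A" "q \<in> P1 A" for p q
    using D that by (simp add: cocycles1_def cochains1_def derivations_def)
  have Ddiff: "D (p - q) = D p - D q" if "p \<in> P1 A" "q \<in> P1 A" for p q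
    using Dadd[of "p - q" q] that by (simp add: P_closed)
  define \<delta> where "\<delta> p = D (pvar p)" for p
  define \<psi> where "\<psi> i = \<delta> i - \<delta> 0" for i
  have D\<delta>: "D q = \<delta> (counit q) - \<delta> (free_map counit q)" if "q \<in> P1 A" for q
  proof -
    have "D (counit (pvar q)) - D (free_map counit (pvar q)) + D (free_map (free_map counit) (pvar q)) = 0"
      using D pvar_in(3)[OF that] unfolding cocycles1_def by blast
    then show ?thesis by (simp add: \<delta>_def algebra_simps)
  qed
  note hom = ring_homD[OF ring_hom_counit] ring_homD[OF ring_hom_free_map]
  have \<psi>_in: "\<psi> i \<in> A" if "i \<in> P0 A" for i
    using that unfolding \<psi>_def \<delta>_def by (intro A_diff Din pvar_in P_closed)
  have \<psi>_0: "\<psi> 0 = 0" by (simp add: \<psi>_def)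
  \<comment> \<open>The faces of this element are \<open>i\<close> and 0, so the derivation property
    of \<open>D\<close> on \<open>P1\<close> is passed on to \<open>\<psi>\<close> as
    linearity.\<close>
  define v where "v i = pvar i - pvar 0" for i :: "('k \<Rightarrow>\<^sub>0 complex) pol"
  have v: "v i \<in> P1 A" "counit (v i) = i" "free_map counit (v i) = 0" "D (v i) = \<psi> i"
    if "i \<in> P0 A" "counit i = 0" for i
    unfolding v_def \<psi>_def \<delta>_def
    using that by (simp_all add: pvar_in P_closed hom Ddiff)
  have \<psi>_add: "\<psi> (i + j) = \<psi> i + \<psi> j" if "i \<in> P0 A" "j \<in> P0 A" "counit i = 0" "counit j = 0" for i j
  proof -
    have "D (v i + v j) = \<psi> (i + j)"
      by (subst D\<delta>) (use that in \<open>simp_all add: v P_closed hom \<psi>_def\<close>)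
    then show ?thesis using that by (simp add: Dadd v)
  qed
  have \<psi>_mult: "\<psi> (p * i) = counit p * \<psi> i" if "p \<in> P0 A" "i \<in> P0 A" "counit i = 0" for p i
  proof -
    have "D (pvar p * v i) = \<psi> (p * i)"
      by (subst D\<delta>) (use that in \<open>simp_all add: v pvar_in P_closed hom \<psi>_def\<close>)
    then show ?thesis using that by (simp add: Dmult v pvar_in)
  qed
  have \<psi>_uminus: "\<psi> (- i) = - \<psi> i" if "i \<in> P0 A" "counit i = 0" for i
    using \<psi>_mult[of "- 1" i] that by (simp add: P_closed hom)
  have \<psi>_diff: "\<psi> (i - j) = \<psi> i - \<psi> j" if "i \<in> P0 A" "j \<in> P0 A" "counit i = 0" "counit j = 0" for i j
    using \<psi>_add[of i "- j"] \<psi>_uminus[of j] that by (simp add: P_closed hom)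
  \<comment> \<open>The variable \<open>[counit p]\<close> has the same image as \<open>p\<close>,
    so subtracting it moves the argument into the kernel; \<open>\<delta>\<close> vanishes at
    variables of that form by \<open>D\<delta>\<close>.\<close>
  have \<delta>\<psi>: "\<delta> p = \<psi> (p - pvar (counit p))" if p: "p \<in> P0 A" for p
  proof -
    let ?q = "pvar p - pvar (pvar (counit p))"
    have c: "pvar (counit p) \<in> P0 A" using p by (intro pvar_in counit_in_A)
    have "\<delta> p - \<delta> (pvar (counit p)) = D ?q"
      using p c by (simp add: Ddiff pvar_in \<delta>_def)
    also have "\<dots> = \<psi> (p - pvar (counit p))"
      by (subst D\<delta>) (use p c in \<open>simp_all add: pvar_in P_closed hom \<psi>_def\<close>)
    moreover have "\<delta> p = \<delta> p - \<delta> (pvar (counit p))"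
      using D\<delta>[OF pvar_in(2)[OF p]] unfolding \<delta>_def counit_pvar free_map_pvar .
    ultimately show ?thesis by metis
  qed
  \<comment> \<open>A derivation that kills \<open>Yp s\<close> and \<open>Yn s\<close> maps
    \<open>[chi s] * Yn s - Yp s\<close>, an element of the kernel, to
    \<open>chi (\<beta> s)\<close> times its value at \<open>[chi s]\<close>. Solving for that value
    gives the formula.\<close>
  define g where "g s = chi (- \<beta> s) * \<psi> (pvar (chi s) * Yn s - Yp s)" for s
  have key: "\<psi> (pvar (chi s) * pvar (chi t) - pvar (chi (s + t))) = chi s * g t + chi t * g s - g (s + t)"
    if s: "s \<in> S" "t \<in> S" for s t
  proof -
    let ?x = "pvar (chi s)" and ?y = "pvar (chi t)" and ?z = "pvar (chi (s + t))"
    have xin: "?x \<in> P0 A" "?y \<in> P0 A" "?z \<in> P0 A" using s by (auto intro!: pvar_in A_single add_S)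
    let ?i = "\<lambda>u. pvar (chi u) * Yn u - Yp u"
    have i0: "counit (?i u) = 0" for u by (simp add: hom Yc chi_mult)
    have iin: "?i s \<in> P0 A" "?i t \<in> P0 A" "?i (s + t) \<in> P0 A" using xin Yin by (auto intro!: P_closed)
    have \<psi>i: "\<psi> (?i u) = chi (\<beta> u) * g u" for u
      by (simp add: g_def chi_cancel)
    let ?k = "?x * ?y - ?z" and ?w = "Yn s * Yn t * Yn (s + t)"
    have k: "?k \<in> P0 A" "counit ?k = 0" using xin by (simp_all add: P_closed hom chi_mult)
    \<comment> \<open>Multiplied by \<open>?w\<close>, the relation \<open>?k\<close> becomes a
      combination of the elements \<open>?i\<close>, by the exchange rule \<open>Yadd\<close>. The
      image \<open>chi w\<close> of \<open>?w\<close> is invertible in the group algebra and can be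
      cancelled.\<close>
    have "?w * ?k = (Yn (s + t) * (?y * Yn t)) * ?i s + (Yn (s + t) * Yp s) * ?i t - (Yn s * Yn t) * ?i (s + t)
        + (Yp s * Yp t * Yn (s + t) - Yn s * Yn t * Yp (s + t))"
      by (simp add: algebra_simps)
    also have "Yp s * Yp t * Yn (s + t) - Yn s * Yn t * Yp (s + t) = 0"
      by (simp add: Yadd)
    finally have eq: "?w * ?k = (Yn (s + t) * (?y * Yn t)) * ?i s + (Yn (s + t) * Yp s) * ?i t - (Yn s * Yn t) * ?i (s + t)"
      by simp
    define w where "w = \<beta> s + \<beta> t + \<beta> (s + t)"
    have "chi w * \<psi> ?k = \<psi> (?w * ?k)"
      by (subst \<psi>_mult) (use k Yin in \<open>simp_all add: P_closed hom Yc chi_mult w_def\<close>)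
    also have "\<dots> = \<psi> ((Yn (s + t) * (?y * Yn t)) * ?i s) + \<psi> ((Yn (s + t) * Yp s) * ?i t) - \<psi> ((Yn s * Yn t) * ?i (s + t))"
      unfolding eq
      by (subst \<psi>_diff, (use xin iin i0 Yin in \<open>simp_all add: P_closed hom Yc chi_mult\<close>)[4],
          subst \<psi>_add) (use xin iin i0 Yin in \<open>simp_all add: P_closed hom Yc chi_mult\<close>)
    also have "\<dots> = chi (\<beta> (s + t)) * (chi t * chi (\<beta> t)) * (chi (\<beta> s) * g s)
       + chi (\<beta> (s + t)) * chi (s + \<beta> s) * (chi (\<beta> t) * g t) - chi (\<beta> s) * chi (\<beta> t) * (chi (\<beta> (s + t)) * g (s + t))"
      using xin iin i0 Yin by (simp add: \<psi>_mult \<psi>i P_closed hom Yc)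
    also have "\<dots> = chi w * (chi s * g t + chi t * g s - g (s + t))"
      unfolding w_def by (simp add: algebra_simps flip: chi_mult)
    finally show ?thesis by (metis chi_cancel(1))
  qed
  have gZ: "g \<in> Z"
    unfolding Z_def
  proof (intro CollectI ballI)
    fix s t assume s: "s \<in> S" "t \<in> S"
    show "chi s * g t + chi t * g s - g (s + t) \<in> A"
      unfolding key[OF s, symmetric] using s by (intro \<psi>_in P_closed pvar_in A_single add_S)
  qed
  \<comment> \<open>A linear section of the counit that uses only variables of characters.\<close>
  define \<sigma> where "\<sigma> = lin (\<lambda>s. pvar (chi s :: 'k \<Rightarrow>\<^sub>0 complex))"
  have \<sigma>_in: "\<sigma> a \<in> P0 A" if "a \<in> A" for a
    using that unfolding \<sigma>_def by (induction rule: A_induct)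
      (simp_all add: lin_add lin_const_mult P_closed pvar_in A_single)
  have \<sigma>_counit: "counit (\<sigma> a) = a" if "a \<in> A" for a
    using that unfolding \<sigma>_def by (induction rule: A_induct) (simp_all add: lin_add lin_const_mult hom)
  \<comment> \<open>The elements \<open>[a]\<close> and \<open>\<sigma> a\<close> have the same
    image, but \<open>\<psi>\<close> may distinguish them if \<open>a\<close> is inhomogeneous. The
    correction \<open>\<eta>\<close> records by how much.\<close>
  define \<eta> where "\<eta> a = \<psi> (pvar a - \<sigma> a)" for a
  have \<eta>_in: "\<eta> a \<in> A" if "a \<in> A" for a
    using that unfolding \<eta>_def by (intro \<psi>_in P_closed pvar_in \<sigma>_in)
  have \<eta>_chi: "\<eta> (chi s) = 0" for s by (simp add: \<eta>_def \<sigma>_def \<psi>_0)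
  define G where "G = der_ext (\<lambda>b. b) (\<lambda>a. lin g a + \<eta> a)"
  have G_simps: "G (p + q) = G p + G q" "G (p * q) = counit p * G q + counit q * G p"
    "G (const c) = 0" "G (pvar a) = lin g a + \<eta> a" "G (p - q) = G p - G q" "G 0 = 0" for p q c a
    by (simp_all add: G_def der_ext_add der_ext_mult der_ext_diff counit_def)
  \<comment> \<open>The bilinear form of \<open>key\<close>: it measures how far the section is from
    being multiplicative.\<close>
  have \<psi>\<sigma>: "\<psi> (\<sigma> a * \<sigma> b - \<sigma> (a * b)) = a * lin g b + b * lin g a - lin g (a * b)" if "a \<in> A" "b \<in> A" for a b
    using that(1)
  proof (induction rule: A_induct)
    case zero
    then show ?case by (simp add: \<sigma>_def \<psi>_0)
  next
    case (add a a')
    have "\<sigma> (a + a') * \<sigma> b - \<sigma> ((a + a') * b) = (\<sigma> a * \<sigma> b - \<sigma> (a * b)) + (\<sigma> a' * \<sigma> b - \<sigma> (a' * b))"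
      by (simp add: \<sigma>_def lin_add algebra_simps)
    also have "\<psi> \<dots> = \<psi> (\<sigma> a * \<sigma> b - \<sigma> (a * b)) + \<psi> (\<sigma> a' * \<sigma> b - \<sigma> (a' * b))"
      using add \<open>b \<in> A\<close> by (intro \<psi>_add) (simp_all add: P_closed \<sigma>_in \<sigma>_counit A_mult hom)
    also have "\<dots> = (a * lin g b + b * lin g a - lin g (a * b)) + (a' * lin g b + b * lin g a' - lin g (a' * b))"
      by (simp only: add.IH)
    also have "\<dots> = (a + a') * lin g b + b * lin g (a + a') - lin g ((a + a') * b)"
      by (simp add: lin_add algebra_simps)
    finally show ?case .
  next
    case (single s c)
    show ?case using that(2)
    proof (induction rule: A_induct)
      case zero
      then show ?case by (simp add: \<sigma>_def \<psi>_0)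
    next
      case (add b b')
      let ?a = "const c * chi s"
      have a: "?a \<in> A" using single by (intro A_mult A_const A_single)
      have "\<sigma> ?a * \<sigma> (b + b') - \<sigma> (?a * (b + b')) = (\<sigma> ?a * \<sigma> b - \<sigma> (?a * b)) + (\<sigma> ?a * \<sigma> b' - \<sigma> (?a * b'))"
        by (simp add: \<sigma>_def lin_add algebra_simps)
      also have "\<psi> \<dots> = \<psi> (\<sigma> ?a * \<sigma> b - \<sigma> (?a * b)) + \<psi> (\<sigma> ?a * \<sigma> b' - \<sigma> (?a * b'))"
        using add a by (intro \<psi>_add) (simp_all add: P_closed \<sigma>_in \<sigma>_counit A_mult hom)
      also have "\<dots> = (?a * lin g b + b * lin g ?a - lin g (?a * b)) + (?a * lin g b' + b' * lin g ?a - lin g (?a * b'))"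
        by (simp only: add.IH)
      also have "\<dots> = ?a * lin g (b + b') + (b + b') * lin g ?a - lin g (?a * (b + b'))"
        by (simp add: lin_add algebra_simps)
      finally show ?case .
    next
      case (single t d)
      let ?k = "pvar (chi s) * pvar (chi t) - pvar (chi (s + t))"
      have e: "const c * chi s * (const d * chi t) = const c * (const d * chi (s + t))"
        by (simp add: algebra_simps flip: chi_mult)
      have "\<sigma> (const c * chi s) * \<sigma> (const d * chi t) - \<sigma> (const c * chi s * (const d * chi t)) =
          (const c * const d) * ?k"
        unfolding e by (simp add: \<sigma>_def lin_const_mult algebra_simps)
      also have "\<psi> \<dots> = const c * const d * \<psi> ?k"
        using \<open>s \<in> S\<close> \<open>t \<in> S\<close> by (subst \<psi>_mult) (simp_all add: P_closed pvar_in A_single add_S hom chi_mult)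
      also have "\<dots> = const c * const d * (chi s * g t + chi t * g s - g (s + t))"
        using \<open>s \<in> S\<close> \<open>t \<in> S\<close> by (simp add: key)
      also have "\<dots> = const c * chi s * lin g (const d * chi t) + const d * chi t * lin g (const c * chi s) -
          lin g (const c * chi s * (const d * chi t))"
        unfolding e by (simp add: lin_const_mult) (simp add: algebra_simps)
      finally show ?case .
    qed
  qed
  \<comment> \<open>For \<open>p\<close> in the kernel the right-hand side is
    \<open>\<psi> p\<close>; the general form is the one that passes through sums and
    products.\<close>
  have G: "G p = \<psi> (p - \<sigma> (counit p)) + lin g (counit p)" if "p \<in> P0 A" for p
    using that unfolding P0_def
  proof (induction rule: free_alg_induct)
    case (const c)
    \<comment> \<open>The section sends the constant 1 to the variable \<open>[1]\<close>, so
      constants involve \<open>\<psi> ([1] - 1)\<close>. The relation \<open>key\<close> at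
      \<open>s = t = 0\<close> shows that this is \<open>g 0\<close>.\<close>
    have 1: "pvar 1 \<in> P0 A" using A_single[OF zero_S, of 1] by (simp add: pvar_in)
    have "\<psi> (pvar 1 * (pvar 1 - 1)) = 1 * \<psi> (pvar 1 - 1)"
      using 1 by (subst \<psi>_mult) (simp_all add: P_closed hom)
    moreover have "pvar 1 * (pvar 1 - 1) = pvar (chi 0) * pvar (chi 0) - pvar (chi (0 + 0 :: 'k))"
      by (simp add: algebra_simps)
    ultimately have g0: "\<psi> (pvar 1 - 1) = g 0"
      using key[OF zero_S zero_S] by simp
    have "\<psi> (const c - \<sigma> (const c)) = \<psi> (- const c * (pvar 1 - 1))"
      by (simp add: \<sigma>_def lin_const_arg algebra_simps)
    also have "\<dots> = - const c * g 0"
      using 1 by (subst \<psi>_mult) (simp_all add: P_closed hom g0)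
    finally show ?case by (simp add: G_simps lin_const_arg)
  next
    case (pvar a)
    then show ?case by (simp add: G_simps \<eta>_def)
  next
    case (add p q)
    have "p + q - \<sigma> (counit (p + q)) = (p - \<sigma> (counit p)) + (q - \<sigma> (counit q))"
      by (simp add: hom \<sigma>_def lin_add)
    also have "\<psi> \<dots> = \<psi> (p - \<sigma> (counit p)) + \<psi> (q - \<sigma> (counit q))"
      using add by (intro \<psi>_add) (simp_all add: P_closed \<sigma>_in \<sigma>_counit hom counit_in_A flip: P0_def)
    finally show ?case using add by (simp add: G_simps hom lin_add)
  next
    case (mult p q)
    define a b where ab: "a = counit p" "b = counit q"
    have in0: "p \<in> P0 A" "q \<in> P0 A" using mult by (simp_all add: P0_def)
    then have abin: "a \<in> A" "b \<in> A" by (simp_all add: ab counit_in_A)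
    have "p * q - \<sigma> (counit (p * q)) = q * (p - \<sigma> a) + (\<sigma> a * (q - \<sigma> b) + (\<sigma> a * \<sigma> b - \<sigma> (a * b)))"
      by (simp add: hom ab algebra_simps)
    also have "\<psi> \<dots> = \<psi> (q * (p - \<sigma> a)) + (\<psi> (\<sigma> a * (q - \<sigma> b)) + \<psi> (\<sigma> a * \<sigma> b - \<sigma> (a * b)))"
      using in0 abin by (subst \<psi>_add, (simp_all add: P_closed \<sigma>_in \<sigma>_counit hom A_mult ab[symmetric])[4],
        subst \<psi>_add) (simp_all add: P_closed \<sigma>_in \<sigma>_counit hom A_mult ab[symmetric])
    also have "\<dots> = b * \<psi> (p - \<sigma> a) + (a * \<psi> (q - \<sigma> b) + (a * lin g b + b * lin g a - lin g (a * b)))"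
      using in0 abin by (simp add: \<psi>_mult \<psi>\<sigma> P_closed \<sigma>_in \<sigma>_counit hom ab[symmetric])
    finally show ?case using mult by (simp add: G_simps hom ab[symmetric] algebra_simps)
  qed
  have GI: "G i = \<psi> i" if "i \<in> P0 A" "counit i = 0" for i
    using G[OF that(1)] that(2) by (simp add: \<sigma>_def)
  define E where "E = (\<lambda>p. if p \<in> P0 A then der_ext (\<lambda>b. b) \<eta> p else 0)"
  have "D q = Dcoc A g q + bd A E q" for q
  proof (cases "q \<in> P1 A")
    case False
    then show ?thesis by (simp add: Dout Dcoc_def bd_def)
  next
    case True
    define p r where pr: "p = counit q" "r = free_map counit q"
    have in0: "p \<in> P0 A" "r \<in> P0 A" using faces_in[OF True] by (simp_all add: pr)
    have c: "counit r = counit p" by (simp add: pr counit_counit)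
    have ci: "pvar (counit p) \<in> P0 A" using in0 by (intro pvar_in counit_in_A)
    have "D q = \<psi> (p - pvar (counit p)) - \<psi> (r - pvar (counit p))"
      using D\<delta>[OF True] \<delta>\<psi> in0 c by (simp add: pr)
    also have "\<dots> = \<psi> ((p - pvar (counit p)) - (r - pvar (counit p)))"
      using in0 ci c by (intro \<psi>_diff[symmetric]) (simp_all add: P_closed hom)
    also have "\<dots> = \<psi> (p - r)" by simp
    also have "\<dots> = G (p - r)" using in0 c by (intro GI[symmetric]) (simp_all add: P_closed hom)
    also have "\<dots> = G p - G r" by (simp add: G_simps)
    also have "\<dots> = Dcoc A g q + bd A E q"
      using True in0 by (simp add: Dcoc_def bd_def E_def G_def der_ext_plus Der_def flip: pr)
    finally show ?thesis .
  qed
  then have "D = Dcoc A g + bd A E" by (simp add: fun_eq_iff)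
  moreover have "bd A E \<in> coboundaries1 A"
    unfolding coboundaries1_bd E_def by (intro imageI der_cochain0 \<eta>_in)
  ultimately show ?thesis using gZ that by blast
qed

end

section \<open>The torus action and the graded pieces\<close>

lemma lookup_chi_mult:
  "Poly_Mapping.lookup (chi s * f) k = Poly_Mapping.lookup f (k - s)" for s :: "'k::ab_group_add"
  by (induction f rule: poly_mapping_induct_single)
    (auto simp: distrib_left lookup_add mult_single lookup_single when_def algebra_simps)

lemma torus_act_lin: "torus_act t f = lin (\<lambda>m. const (t m) * chi m) f" for t :: "'k::ab_group_add \<Rightarrow> complex"
  unfolding torus_act_def lin_def by (intro sum.cong) (simp_all add: const_mult_single mult.commute)

lemma torus_act_single: "torus_act t (Poly_Mapping.single s c) = Poly_Mapping.single s (t s * c)"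
  for t :: "'k::ab_group_add \<Rightarrow> complex"
  by (simp add: torus_act_lin lin_single const_mult_single mult.commute)

lemma torus_act_add: "torus_act t (a + b) = torus_act t a + torus_act t b" for t :: "'k::ab_group_add \<Rightarrow> complex"
  by (simp add: torus_act_lin lin_add)

lemma torus_act_0 [simp]: "torus_act t 0 = 0" for t :: "'k::ab_group_add \<Rightarrow> complex"
  by (simp add: torus_act_lin)

lemma lookup_torus_act: "Poly_Mapping.lookup (torus_act t f) k = t k * Poly_Mapping.lookup f k"
  for t :: "'k::ab_group_add \<Rightarrow> complex"
  by (induction f rule: poly_mapping_induct_single)
    (auto simp: torus_act_add torus_act_single lookup_add lookup_single when_def algebra_simps)

lemma torus_act_mult:
  assumes "t \<in> torus"
  shows "torus_act t (a * b) = torus_act t a * torus_act t b"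
proof (induction a rule: poly_mapping_induct_single)
  case (add a s c)
  have "torus_act t (Poly_Mapping.single s c * b) = torus_act t (Poly_Mapping.single s c) * torus_act t b"
    by (induction b rule: poly_mapping_induct_single)
      (use assms in \<open>simp_all add: distrib_left torus_act_add mult_single torus_act_single torus_def mult_ac\<close>)
  then show ?case using add by (simp add: distrib_right torus_act_add)
qed simp

lemma ring_hom_torus_act:
  assumes "t \<in> torus" shows "ring_hom (torus_act t)"
  using assms torus_act_single[of t 0 1]
  by (simp add: ring_hom_def torus_act_add torus_act_mult) (simp add: torus_def)

lemma torus_act_const: "t \<in> torus \<Longrightarrow> torus_act t (const c) = const c"
  unfolding const_def by (simp add: torus_act_single torus_def)

lemma torus_nonzero: "t \<in> torus \<Longrightarrow> t m \<noteq> 0"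
proof
  assume "t \<in> torus" "t m = 0"
  then have "t (m + (- m)) = 0" unfolding torus_def by (simp only: mem_Collect_eq) simp
  then show False using \<open>t \<in> torus\<close> by (simp add: torus_def)
qed

lemma torus_inverse: "t \<in> torus \<Longrightarrow> (\<lambda>m. inverse (t m)) \<in> torus"
  by (simp add: torus_def)

lemma torus_act_inverse:
  assumes "t \<in> torus"
  shows "torus_act t (torus_act (\<lambda>m. inverse (t m)) f) = f" "torus_act (\<lambda>m. inverse (t m)) (torus_act t f) = f"
  by (rule poly_mapping_eqI, simp add: lookup_torus_act torus_nonzero[OF assms])+

text \<open>The action transported from cocycles to functions on S: the character in the argument is
  scaled by the inverse, the value is acted on directly.\<close>

definition tw :: "('k::ab_group_add \<Rightarrow> complex) \<Rightarrow> ('k \<Rightarrow> ('k \<Rightarrow>\<^sub>0 complex)) \<Rightarrow> 'k \<Rightarrow> ('k \<Rightarrow>\<^sub>0 complex)" where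
  "tw t g = (\<lambda>s. const (inverse (t s)) * torus_act t (g s))"

lemma torus_act_cochain_bd:
  assumes t: "t \<in> torus" and q: "free_map (free_map (torus_act (\<lambda>m. inverse (t m)))) q \<in> P1 A \<longleftrightarrow> q \<in> P1 A"
  shows "torus_act_cochain t (bd A E) q = bd A (\<lambda>p. torus_act t (E (free_map (torus_act (\<lambda>m. inverse (t m))) p))) q"
proof -
  let ?\<tau> = "torus_act (\<lambda>m. inverse (t m))"
  have hom: "ring_hom ?\<tau>" by (intro ring_hom_torus_act torus_inverse t)
  have 1: "counit (free_map (free_map ?\<tau>) q) = free_map ?\<tau> (counit q)"
    by (rule counit_free_map) (simp_all add: ring_hom_free_map)
  have 2: "free_map counit (free_map (free_map ?\<tau>) q) = free_map ?\<tau> (free_map counit q)"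
    using counit_free_map[OF hom] t by (simp add: free_map_comp torus_act_const torus_inverse)
  show ?thesis
    using q by (simp add: torus_act_cochain_def bd_def 1 2 ring_homD[OF ring_hom_torus_act[OF t]])
qed

section \<open>The torus action on cocycles and coboundaries\<close>

context monoid_alg
begin

lemma torus_act_in: "a \<in> A \<Longrightarrow> torus_act t a \<in> A"
  unfolding torus_act_lin by (intro lin_in A_mult A_const A_single)

lemma free_map_torus_in:
  "p \<in> P0 A \<Longrightarrow> free_map (torus_act t) p \<in> P0 A" "q \<in> P1 A \<Longrightarrow> free_map (free_map (torus_act t)) q \<in> P1 A"
  unfolding P1_def P0_def by (auto intro!: free_map_in torus_act_in)

lemma free_map_torus_iff:
  assumes "t \<in> torus"
  shows "free_map (free_map (torus_act (\<lambda>m. inverse (t m)))) q \<in> P1 A \<longleftrightarrow> q \<in> P1 A"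
proof -
  have "free_map (free_map (torus_act t)) (free_map (free_map (torus_act (\<lambda>m. inverse (t m)))) q) = q"
    by (simp add: free_map_comp torus_act_inverse[OF assms] free_map_ident)
  then show ?thesis using free_map_torus_in(2) by metis
qed

lemma torus_act_Dcoc:
  assumes t: "t \<in> torus"
  shows "torus_act_cochain t (Dcoc A g) = Dcoc A (tw t g)"
proof -
  let ?\<tau> = "torus_act (\<lambda>m. inverse (t m))"
  note hom = ring_homD[OF ring_hom_torus_act[OF t]] ring_homD[OF ring_hom_free_map]
  have l: "torus_act t (lin g (?\<tau> a)) = lin (tw t g) a" for a
    by (induction a rule: poly_mapping_induct_single)
      (simp_all add: torus_act_add lin_add torus_act_single lin_single hom torus_act_const[OF t] tw_def
        ring_homD[OF ring_hom_const] mult_ac)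
  have c: "counit (free_map ?\<tau> p) = ?\<tau> (counit p)" for p
    by (rule counit_free_map) (simp_all add: torus_inverse t ring_hom_torus_act torus_act_const)
  have "torus_act t (Der g (free_map ?\<tau> p)) = Der (tw t g) p" for p
    by (induction p rule: pol_induct)
      (simp_all add: Der_simps hom l c torus_act_inverse[OF t])
  then show ?thesis
    by (intro ext) (simp add: Dcoc_def torus_act_cochain_bd[OF t free_map_torus_iff[OF t]])
qed

lemma torus_act_coboundary:
  assumes t: "t \<in> torus" and b: "b \<in> coboundaries1 A"
  shows "torus_act_cochain t b \<in> coboundaries1 A"
proof -
  let ?\<tau> = "torus_act (\<lambda>m. inverse (t m))"
  note hom = ring_homD[OF ring_hom_torus_act[OF t]] ring_homD[OF ring_hom_free_map]
  obtain E where E: "E \<in> cochains0 A" and bE: "b = bd A E"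
    using b unfolding coboundaries1_bd by blast
  define E' where "E' = (\<lambda>p. torus_act t (E (free_map ?\<tau> p)))"
  have c: "counit (free_map ?\<tau> p) = ?\<tau> (counit p)" for p
    by (rule counit_free_map) (simp_all add: torus_inverse t ring_hom_torus_act torus_act_const)
  have cl: "p + q \<in> P0 A" "p * q \<in> P0 A" "const c * p \<in> P0 A" if "p \<in> P0 A" "q \<in> P0 A" for p q c
    using that by (simp_all add: P_closed)
  have "(\<lambda>p. if p \<in> P0 A then E' p else 0) \<in> cochains0 A"
    using E unfolding cochains0_def derivations_def E'_def
    by (auto simp: cl hom c torus_act_inverse[OF t] free_map_torus_in torus_act_in torus_act_const[OF t])
  moreover have "torus_act_cochain t b = bd A (\<lambda>p. if p \<in> P0 A then E' p else 0)"
    unfolding bE E'_def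
    by (intro ext, subst torus_act_cochain_bd[OF t free_map_torus_iff[OF t]]) (simp add: bd_def faces_in)
  ultimately show ?thesis unfolding coboundaries1_bd by blast
qed

lemma torus_act_cochain_inverse:
  "t \<in> torus \<Longrightarrow> torus_act_cochain t (torus_act_cochain (\<lambda>m. inverse (t m)) D) = D"
  by (simp add: torus_act_cochain_def fun_eq_iff free_map_comp torus_act_inverse free_map_ident)

lemma coboundaries_add: "b \<in> coboundaries1 A \<Longrightarrow> b' \<in> coboundaries1 A \<Longrightarrow> b + b' \<in> coboundaries1 A"
proof -
  assume "b \<in> coboundaries1 A" "b' \<in> coboundaries1 A"
  then obtain E E' where E: "E \<in> cochains0 A" "b = bd A E" "E' \<in> cochains0 A" "b' = bd A E'"
    unfolding coboundaries1_bd by blast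
  have "b + b' = bd A (E + E')" using E by (simp add: bd_def fun_eq_iff)
  moreover have "E + E' \<in> cochains0 A"
    using E by (auto simp: cochains0_def derivations_def A_add algebra_simps)
  ultimately show ?thesis unfolding coboundaries1_bd by blast
qed

lemma coboundaries_scale: "b \<in> coboundaries1 A \<Longrightarrow> cochain_scale c b \<in> coboundaries1 A"
proof -
  assume "b \<in> coboundaries1 A"
  then obtain E where E: "E \<in> cochains0 A" "b = bd A E"
    unfolding coboundaries1_bd by blast
  have "cochain_scale c b = bd A (\<lambda>p. const c * E p)"
    using E by (simp add: bd_def fun_eq_iff cochain_scale_def algebra_simps)
  moreover have "(\<lambda>p. const c * E p) \<in> cochains0 A"
    using E by (auto simp: cochains0_def derivations_def A_mult A_const algebra_simps)
  ultimately show ?thesis unfolding coboundaries1_bd by blast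
qed

lemma coboundaries_0: "0 \<in> coboundaries1 A"
proof -
  have "(0 :: 'k cochain1) = bd A (\<lambda>p. 0)" by (simp add: bd_def fun_eq_iff)
  moreover have "(\<lambda>p. 0) \<in> cochains0 A" by (auto simp: cochains0_def derivations_def A_0)
  ultimately show ?thesis unfolding coboundaries1_bd by blast
qed

lemma coboundaries_uminus: "b \<in> coboundaries1 A \<Longrightarrow> - b \<in> coboundaries1 A"
  using coboundaries_scale[of b "- 1"]
  by (simp add: cochain_scale_def fun_Compl_def ring_homD[OF ring_hom_const] const_1)

lemma coboundaries_sum: "(\<And>i. i \<in> I \<Longrightarrow> b i \<in> coboundaries1 A) \<Longrightarrow> (\<Sum>i\<in>I. b i) \<in> coboundaries1 A"
  by (induction I rule: infinite_finite_induct) (simp_all add: coboundaries_0 coboundaries_add)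

section \<open>T1 in terms of functions on the monoid\<close>

definition cls :: "('k \<Rightarrow> ('k \<Rightarrow>\<^sub>0 complex)) \<Rightarrow> 'k cochain1 set" where
  "cls g = {Dcoc A g + b | b. b \<in> coboundaries1 A}"

lemma coset_eq_iff:
  "{D + b | b. b \<in> coboundaries1 A} = {D' + b | b. b \<in> coboundaries1 A} \<longleftrightarrow> D - D' \<in> coboundaries1 A"
proof
  assume "{D + b | b. b \<in> coboundaries1 A} = {D' + b | b. b \<in> coboundaries1 A}"
  moreover have "D \<in> {D + b | b. b \<in> coboundaries1 A}"
    using coboundaries_0 by (intro CollectI exI[of _ 0]) simp
  ultimately obtain b where "D = D' + b" "b \<in> coboundaries1 A" by auto
  then show "D - D' \<in> coboundaries1 A" by simp
next
  assume d: "D - D' \<in> coboundaries1 A"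
  have "D + b = D' + ((D - D') + b)" "D' + b = D + (- (D - D') + b)" for b by simp_all
  then show "{D + b | b. b \<in> coboundaries1 A} = {D' + b | b. b \<in> coboundaries1 A}"
    using coboundaries_add[OF d] coboundaries_add[OF coboundaries_uminus[OF d]] by blast
qed

lemma Dcoc_diff: "Dcoc A (\<lambda>s. g s - h s) = Dcoc A g - Dcoc A h"
  using Dcoc_plus[of A "\<lambda>s. g s - h s" h] by simp

lemma cls_eq_iff: "cls g = cls h \<longleftrightarrow> (\<lambda>s. g s - h s) \<in> Bd"
  unfolding cls_def coset_eq_iff by (simp add: Dcoc_coboundary_iff flip: Dcoc_diff)

lemma T1_zero_cls: "T1_zero A = cls (\<lambda>s. 0)"
  by (simp add: T1_zero_def cls_def Dcoc_zero)

lemma T1_add_cls: "T1_add (cls g) (cls h) = cls (\<lambda>s. g s + h s)"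
proof (intro equalityI subsetI)
  fix D assume "D \<in> T1_add (cls g) (cls h)"
  then obtain b b' where "b \<in> coboundaries1 A" "b' \<in> coboundaries1 A" "D = (Dcoc A g + b) + (Dcoc A h + b')"
    unfolding T1_add_def cls_def by blast
  then have "D = Dcoc A (\<lambda>s. g s + h s) + (b + b')" "b + b' \<in> coboundaries1 A"
    by (simp_all add: Dcoc_plus coboundaries_add algebra_simps)
  then show "D \<in> cls (\<lambda>s. g s + h s)" unfolding cls_def by blast
next
  fix D assume "D \<in> cls (\<lambda>s. g s + h s)"
  then obtain b where b: "b \<in> coboundaries1 A" "D = (Dcoc A g + 0) + (Dcoc A h + b)"
    unfolding cls_def by (auto simp: Dcoc_plus add.assoc)
  then show "D \<in> T1_add (cls g) (cls h)"
    unfolding T1_add_def cls_def using coboundaries_0 by blast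
qed

lemma cochain_scale_add: "cochain_scale c (D + D') = cochain_scale c D + cochain_scale c D'"
  by (simp add: cochain_scale_def fun_eq_iff distrib_left)

lemma T1_scale_cls: "T1_scale A c (cls g) = cls (\<lambda>s. const c * g s)"
proof (intro equalityI subsetI)
  fix D assume "D \<in> T1_scale A c (cls g)"
  then obtain b b' where "b \<in> coboundaries1 A" "b' \<in> coboundaries1 A" "D = cochain_scale c (Dcoc A g + b) + b'"
    unfolding T1_scale_def cls_def by blast
  then have "D = Dcoc A (\<lambda>s. const c * g s) + (cochain_scale c b + b')" "cochain_scale c b + b' \<in> coboundaries1 A"
    by (simp_all add: Dcoc_const cochain_scale_add coboundaries_add coboundaries_scale add.assoc)
  then show "D \<in> cls (\<lambda>s. const c * g s)" unfolding cls_def by blast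
next
  fix D assume "D \<in> cls (\<lambda>s. const c * g s)"
  then obtain b where b: "b \<in> coboundaries1 A" "D = cochain_scale c (Dcoc A g + 0) + b"
    unfolding cls_def by (auto simp: Dcoc_const)
  then show "D \<in> T1_scale A c (cls g)"
    unfolding T1_scale_def cls_def using coboundaries_0 by blast
qed

lemma Dcoc_sum: "Dcoc A (\<lambda>s. \<Sum>i\<in>I. g i s) = (\<Sum>i\<in>I. Dcoc A (g i))"
  by (induction I rule: infinite_finite_induct) (simp_all add: Dcoc_zero Dcoc_plus)

lemma T1_sum_cls:
  assumes "\<And>i. i \<in> I \<Longrightarrow> X i = cls (g i)"
  shows "T1_sum A X I = cls (\<lambda>s. \<Sum>i\<in>I. g i s)"
proof (intro equalityI subsetI)
  fix D assume "D \<in> T1_sum A X I"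
  then obtain x b where x: "\<And>i. i \<in> I \<Longrightarrow> x i \<in> X i" and b: "b \<in> coboundaries1 A" and D: "D = (\<Sum>i\<in>I. x i) + b"
    unfolding T1_sum_def by blast
  have x': "x i - Dcoc A (g i) \<in> coboundaries1 A" if "i \<in> I" for i
    using x[OF that] assms[OF that] by (auto simp: cls_def)
  have "D = Dcoc A (\<lambda>s. \<Sum>i\<in>I. g i s) + ((\<Sum>i\<in>I. x i - Dcoc A (g i)) + b)"
    by (simp add: D Dcoc_sum sum_subtractf)
  moreover have "(\<Sum>i\<in>I. x i - Dcoc A (g i)) + b \<in> coboundaries1 A"
    by (intro coboundaries_add coboundaries_sum x' b)
  ultimately show "D \<in> cls (\<lambda>s. \<Sum>i\<in>I. g i s)" unfolding cls_def by blast
next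
  fix D assume "D \<in> cls (\<lambda>s. \<Sum>i\<in>I. g i s)"
  then obtain b where b: "b \<in> coboundaries1 A" "D = (\<Sum>i\<in>I. Dcoc A (g i)) + b"
    unfolding cls_def by (auto simp: Dcoc_sum)
  moreover have "Dcoc A (g i) \<in> X i" if "i \<in> I" for i
    using assms[OF that] coboundaries_0 unfolding cls_def by (auto intro!: exI[of _ 0])
  ultimately show "D \<in> T1_sum A X I"
    unfolding T1_sum_def by blast
qed

lemma torus_act_cls:
  assumes t: "t \<in> torus"
  shows "torus_act_cochain t ` cls g = cls (tw t g)"
proof -
  have add: "torus_act_cochain t (D + D') = torus_act_cochain t D + torus_act_cochain t D'" for D D' :: "'k cochain1"
    by (simp add: torus_act_cochain_def fun_eq_iff torus_act_add)
  show ?thesis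
  proof (intro equalityI subsetI)
    fix D assume "D \<in> torus_act_cochain t ` cls g"
    then show "D \<in> cls (tw t g)"
      unfolding cls_def using torus_act_coboundary[OF t] by (auto simp: add torus_act_Dcoc[OF t])
  next
    fix D assume "D \<in> cls (tw t g)"
    then obtain b where b: "b \<in> coboundaries1 A" "D = Dcoc A (tw t g) + b" unfolding cls_def by blast
    let ?b = "torus_act_cochain (\<lambda>m. inverse (t m)) b"
    have "D = torus_act_cochain t (Dcoc A g + ?b)"
      by (simp add: b(2) add torus_act_Dcoc[OF t] torus_act_cochain_inverse[OF t])
    moreover have "?b \<in> coboundaries1 A" by (intro torus_act_coboundary torus_inverse t b)
    ultimately show "D \<in> torus_act_cochain t ` cls g" unfolding cls_def by blast
  qed
qed

section \<open>Homogeneous components\<close>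

definition comp :: "'k \<Rightarrow> ('k \<Rightarrow> ('k \<Rightarrow>\<^sub>0 complex)) \<Rightarrow> 'k \<Rightarrow> complex" where
  "comp R g s = Poly_Mapping.lookup (g s) (s - R)"

definition homog :: "'k \<Rightarrow> ('k \<Rightarrow> complex) \<Rightarrow> 'k \<Rightarrow> ('k \<Rightarrow>\<^sub>0 complex)" where
  "homog R \<gamma> s = Poly_Mapping.single (s - R) (\<gamma> s)"

text \<open>The term of the Leibniz defect at \<open>chi (s + t - R)\<close> is no element of
  \<open>A\<close> exactly if \<open>s + t - R\<close> is outside S, and then its coefficient has to
  vanish.\<close>

definition locadd :: "'k \<Rightarrow> ('k \<Rightarrow> complex) \<Rightarrow> bool" where
  "locadd R \<gamma> \<longleftrightarrow> (\<forall>s\<in>S. \<forall>t\<in>S. s + t - R \<notin> S \<longrightarrow> \<gamma> (s + t) = \<gamma> s + \<gamma> t)"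

text \<open>Where \<open>s - R\<close> lies in S, the value is a coefficient of an element of
  \<open>A\<close>; agreement with \<open>l\<close> is therefore asked for only elsewhere.\<close>

definition triv :: "'k \<Rightarrow> ('k \<Rightarrow> complex) \<Rightarrow> bool" where
  "triv R \<gamma> \<longleftrightarrow> (\<exists>l. (\<forall>s\<in>S. \<forall>t\<in>S. l (s + t) = l s + l t) \<and> (\<forall>s\<in>S. s - R \<notin> S \<longrightarrow> \<gamma> s = l s))"

lemma comp_homog: "comp R (homog R' \<gamma>) = (if R = R' then \<gamma> else (\<lambda>s. 0))"
  by (auto simp: comp_def homog_def fun_eq_iff lookup_single when_def)

lemma in_A_iff: "a \<in> A \<longleftrightarrow> (\<forall>k. k \<notin> S \<longrightarrow> Poly_Mapping.lookup a k = 0)"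
  by (auto simp: monoid_algebra_def in_keys_iff)

text \<open>The coefficient of \<open>chi k\<close> in the Leibniz defect of \<open>s\<close> and
  \<open>t\<close> belongs to \<open>R = s + t - k\<close>, and for fixed \<open>s\<close>,
  \<open>t\<close> this substitution is a bijection.\<close>

lemma Z_iff: "g \<in> Z \<longleftrightarrow> (\<forall>R. locadd R (comp R g))"
proof -
  have "g \<in> Z \<longleftrightarrow> (\<forall>s\<in>S. \<forall>t\<in>S. \<forall>k. k \<notin> S \<longrightarrow>
      Poly_Mapping.lookup (g t) (k - s) + Poly_Mapping.lookup (g s) (k - t) = Poly_Mapping.lookup (g (s + t)) k)"
    by (simp add: Z_def in_A_iff lookup_add lookup_minus lookup_chi_mult)
  also have "\<dots> \<longleftrightarrow> (\<forall>s\<in>S. \<forall>t\<in>S. \<forall>R. s + t - R \<notin> S \<longrightarrow> comp R g t + comp R g s = comp R g (s + t))"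
  proof -
    have "(\<forall>k. k \<notin> S \<longrightarrow> Poly_Mapping.lookup (g t) (k - s) + Poly_Mapping.lookup (g s) (k - t) = Poly_Mapping.lookup (g (s + t)) k)
      \<longleftrightarrow> (\<forall>R. s + t - R \<notin> S \<longrightarrow> comp R g t + comp R g s = comp R g (s + t))" (is "(\<forall>k. ?P k) \<longleftrightarrow> (\<forall>R. ?Q R)") for s t
    proof -
      have "?Q R \<longleftrightarrow> ?P (s + t - R)" for R by (simp add: comp_def algebra_simps)
      moreover have "?P k \<longleftrightarrow> ?Q (s + t - k)" for k by (simp add: comp_def algebra_simps)
      ultimately show ?thesis by blast
    qed
    then show ?thesis by simp
  qed
  also have "\<dots> \<longleftrightarrow> (\<forall>R. locadd R (comp R g))"
    unfolding locadd_def by (metis add.commute)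
  finally show ?thesis .
qed

lemma locadd_lin:
  assumes "locadd R \<gamma>" "locadd R \<gamma>'"
  shows "locadd R (\<lambda>s. a * \<gamma> s + b * \<gamma>' s)"
  using assms by (simp add: locadd_def algebra_simps)

lemma locadd_scale: "locadd R \<gamma> \<Longrightarrow> locadd R (\<lambda>s. a * \<gamma> s)"
  using locadd_lin[of R \<gamma> \<gamma> a 0] by simp

lemma locadd_0: "locadd R (\<lambda>s. 0)"
  by (simp add: locadd_def)

lemma triv_lin:
  assumes "triv R \<gamma>" "triv R \<gamma>'"
  shows "triv R (\<lambda>s. a * \<gamma> s + b * \<gamma>' s)"
proof -
  obtain l l' where "\<forall>s\<in>S. \<forall>t\<in>S. l (s + t) = l s + l t" "\<forall>s\<in>S. s - R \<notin> S \<longrightarrow> \<gamma> s = l s"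
    "\<forall>s\<in>S. \<forall>t\<in>S. l' (s + t) = l' s + l' t" "\<forall>s\<in>S. s - R \<notin> S \<longrightarrow> \<gamma>' s = l' s"
    using assms unfolding triv_def by blast
  then show ?thesis unfolding triv_def
    by (intro exI[of _ "\<lambda>s. a * l s + b * l' s"]) (simp add: algebra_simps)
qed

lemma triv_0: "triv R (\<lambda>s. 0)"
  unfolding triv_def by (intro exI[of _ "\<lambda>s. 0"]) simp

lemma triv_add: "triv R \<gamma> \<Longrightarrow> triv R \<gamma>' \<Longrightarrow> triv R (\<lambda>s. \<gamma> s + \<gamma>' s)"
  using triv_lin[of R \<gamma> \<gamma>' 1 1] by simp

lemma triv_diff: "triv R \<gamma> \<Longrightarrow> triv R \<gamma>' \<Longrightarrow> triv R (\<lambda>s. \<gamma> s - \<gamma>' s)"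
  using triv_lin[of R \<gamma> \<gamma>' 1 "- 1"] by simp

lemma triv_scale: "triv R \<gamma> \<Longrightarrow> triv R (\<lambda>s. a * \<gamma> s)"
  using triv_lin[of R \<gamma> \<gamma> a 0] by simp

lemma triv_scale_iff: "a \<noteq> 0 \<Longrightarrow> triv R (\<lambda>s. a * \<gamma> s) \<longleftrightarrow> triv R \<gamma>"
  using triv_scale[of R \<gamma> a] triv_scale[of R "\<lambda>s. a * \<gamma> s" "inverse a"] by (auto simp: mult.assoc[symmetric])

lemma triv_sum: "(\<And>i. i \<in> I \<Longrightarrow> triv R (\<gamma> i)) \<Longrightarrow> triv R (\<lambda>s. \<Sum>i\<in>I. \<gamma> i s)"
  by (induction I rule: infinite_finite_induct) (simp_all add: triv_0 triv_add)

lemma comp_simps: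
  "comp R (\<lambda>s. g s + h s) = (\<lambda>s. comp R g s + comp R h s)"
  "comp R (\<lambda>s. g s - h s) = (\<lambda>s. comp R g s - comp R h s)"
  "comp R (\<lambda>s. const c * g s) = (\<lambda>s. c * comp R g s)"
  "comp R (\<lambda>s. 0) = (\<lambda>s. 0)"
  "comp R (\<lambda>s. \<Sum>i\<in>I. f i s) = (\<lambda>s. \<Sum>i\<in>I. comp R (f i) s)"
  by (simp_all add: comp_def fun_eq_iff lookup_add lookup_minus lookup_const_mult lookup_sum)

lemma comp_tw:
  assumes t: "t \<in> torus"
  shows "comp R (tw t g) = (\<lambda>s. t (- R) * comp R g s)"
proof
  fix s
  have "t (s + - R) = t s * t (- R)"
    using t unfolding torus_def by blast
  then have "t (s - R) = t s * t (- R)" by simp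
  then show "comp R (tw t g) s = t (- R) * comp R g s"
    using torus_nonzero[OF t, of s] by (simp add: comp_def tw_def lookup_const_mult lookup_torus_act)
qed

lemma Z_add: "g \<in> Z \<Longrightarrow> h \<in> Z \<Longrightarrow> (\<lambda>s. g s + h s) \<in> Z"
  using locadd_lin[where a = 1 and b = 1] by (simp add: Z_iff comp_simps)

lemma Z_diff: "g \<in> Z \<Longrightarrow> h \<in> Z \<Longrightarrow> (\<lambda>s. g s - h s) \<in> Z"
  using locadd_lin[where a = 1 and b = "- 1"] by (simp add: Z_iff comp_simps)

lemma Z_const: "g \<in> Z \<Longrightarrow> (\<lambda>s. const c * g s) \<in> Z"
  by (simp add: Z_iff comp_simps locadd_scale)

lemma Z_0: "(\<lambda>s. 0) \<in> Z"
  by (simp add: Z_iff comp_simps locadd_0)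

lemma Z_sum: "(\<And>i. i \<in> I \<Longrightarrow> f i \<in> Z) \<Longrightarrow> (\<lambda>s. \<Sum>i\<in>I. f i s) \<in> Z"
  by (induction I rule: infinite_finite_induct) (simp_all add: Z_0 Z_add)

lemma Z_homog: "locadd R \<gamma> \<Longrightarrow> homog R \<gamma> \<in> Z"
  by (simp add: Z_iff comp_homog locadd_0)

lemma Z_tw: "t \<in> torus \<Longrightarrow> g \<in> Z \<Longrightarrow> tw t g \<in> Z"
  by (simp add: Z_iff comp_tw locadd_scale)

lemma Bd_triv: "g \<in> Bd \<Longrightarrow> triv R (comp R g)"
proof -
  assume "g \<in> Bd"
  then obtain l where l: "\<forall>s\<in>S. \<forall>t\<in>S. l (s + t) = l s + l t" "\<forall>s\<in>S. g s - chi s * l s \<in> A"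
    unfolding Bd_def by blast
  show ?thesis
    unfolding triv_def
  proof (intro exI conjI ballI impI)
    show "Poly_Mapping.lookup (l (s + t)) (- R) = Poly_Mapping.lookup (l s) (- R) + Poly_Mapping.lookup (l t) (- R)"
      if "s \<in> S" "t \<in> S" for s t using l(1) that by (simp add: lookup_add)
    show "comp R g s = Poly_Mapping.lookup (l s) (- R)" if "s \<in> S" "s - R \<notin> S" for s
    proof -
      have "Poly_Mapping.lookup (g s - chi s * l s) (s - R) = 0" using l(2) that by (simp add: in_A_iff)
      then show ?thesis by (simp add: comp_def lookup_minus lookup_chi_mult)
    qed
  qed
qed

end

text \<open>
  The finite test set \<open>H\<close> bounds the degrees in which a cocycle can have a nonzero class: a cocycle
  has nonzero values on \<open>H\<close> in finitely many degrees only.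
\<close>

locale graded_alg = split_monoid_alg S for S :: "'k::ab_group_add set" +
  assumes test_set: "\<exists>H. finite H \<and> H \<subseteq> S \<and> (\<forall>R \<gamma>. monoid_alg.locadd S R \<gamma> \<longrightarrow> (\<forall>h\<in>H. \<gamma> h = 0) \<longrightarrow>
      (\<forall>s\<in>S. s - R \<notin> S \<longrightarrow> \<gamma> s = 0))"
    and separating: "a \<noteq> b \<Longrightarrow> \<exists>t\<in>torus. t a \<noteq> t (b :: 'k)"
begin

lemma finite_support:
  assumes "g \<in> Z"
  obtains T where "finite T" "\<And>R s. R \<notin> T \<Longrightarrow> s \<in> S \<Longrightarrow> s - R \<notin> S \<Longrightarrow> comp R g s = 0"
proof -
  obtain H where H: "finite H" "H \<subseteq> S"
    "\<And>R \<gamma>. locadd R \<gamma> \<Longrightarrow> \<forall>h\<in>H. \<gamma> h = 0 \<Longrightarrow> \<forall>s\<in>S. s - R \<notin> S \<longrightarrow> \<gamma> s = 0"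
    using test_set by blast
  \<comment> \<open>\<open>comp R g h\<close> reads off the coefficient of
    \<open>chi (h - R)\<close>, so it is nonzero only if \<open>R = h - k\<close> for some
    \<open>k\<close> in the support of \<open>g h\<close>.\<close>
  let ?T = "\<Union>h\<in>H. (\<lambda>k. h - k) ` Poly_Mapping.keys (g h)"
  have "comp R g h = 0" if "R \<notin> ?T" "h \<in> H" for R h
  proof (rule ccontr)
    assume "comp R g h \<noteq> 0"
    then have "h - R \<in> Poly_Mapping.keys (g h)" by (simp add: comp_def in_keys_iff)
    then have "R \<in> ?T" using that(2) by (intro UN_I[of h] image_eqI[of _ _ "h - R"]) auto
    then show False using that by blast
  qed
  then have T: "comp R g s = 0" if "R \<notin> ?T" "s \<in> S" "s - R \<notin> S" for R s
    using H(3)[of R "comp R g"] assms that by (simp add: Z_iff)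
  have "finite ?T" using H(1) by simp
  then show ?thesis using T by (rule that)
qed

text \<open>For the converse of \<open>Bd_triv\<close>, the additive functions of the single degrees
  must be collected in one Laurent polynomial \<open>l s\<close>, so all but finitely many are
  chosen zero. Finite support permits this choice.\<close>

lemma Bd_iff:
  assumes "g \<in> Z"
  shows "g \<in> Bd \<longleftrightarrow> (\<forall>R. triv R (comp R g))"
proof
  assume tr: "\<forall>R. triv R (comp R g)"
  obtain T where T: "finite T" "\<And>R s. R \<notin> T \<Longrightarrow> s \<in> S \<Longrightarrow> s - R \<notin> S \<Longrightarrow> comp R g s = 0"
    using finite_support[OF assms] by blast
  obtain L where L: "\<And>R s t. s \<in> S \<Longrightarrow> t \<in> S \<Longrightarrow> L R (s + t) = L R s + L R t"
    "\<And>R s. s \<in> S \<Longrightarrow> s - R \<notin> S \<Longrightarrow> comp R g s = L R s"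
    using tr unfolding triv_def by metis
  define l where "l s = (\<Sum>R\<in>T. Poly_Mapping.single (- R) (L R s))" for s
  show "g \<in> Bd"
    unfolding Bd_def
  proof (intro CollectI exI conjI ballI)
    show "l (s + t) = l s + l t" if "s \<in> S" "t \<in> S" for s t
      using that by (simp add: l_def L single_add sum.distrib)
    show "g s - chi s * l s \<in> A" if s: "s \<in> S" for s
      unfolding in_A_iff
    proof (intro allI impI)
      fix k assume k: "k \<notin> S"
      define R where "R = s - k"
      have kR: "k = s - R" by (simp add: R_def)
      have "Poly_Mapping.lookup (l s) (- R) = (if R \<in> T then L R s else 0)"
        by (simp add: l_def lookup_sum lookup_single when_def sum.delta' T(1))
      also have "\<dots> = comp R g s" using L(2)[OF s, of R] T(2)[of R s] s k by (simp add: kR)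
      finally show "Poly_Mapping.lookup (g s - chi s * l s) k = 0"
        by (simp add: lookup_minus lookup_chi_mult kR comp_def)
    qed
  qed
qed (simp add: Bd_triv)

lemma cls_eq_triv: "g \<in> Z \<Longrightarrow> h \<in> Z \<Longrightarrow> cls g = cls h \<longleftrightarrow> (\<forall>R. triv R (\<lambda>s. comp R g s - comp R h s))"
  by (simp add: cls_eq_iff Bd_iff Z_diff comp_simps)

lemma T1_cls: "T1 A = cls ` Z"
proof (intro equalityI subsetI)
  fix X assume "X \<in> T1 A"
  then obtain D where D: "D \<in> cocycles1 A" "X = {D + b | b. b \<in> coboundaries1 A}"
    unfolding T1_def by blast
  obtain g b where g: "g \<in> Z" "b \<in> coboundaries1 A" "D = Dcoc A g + b"
    using cocycle_rep[OF D(1)] by blast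
  have "X = cls g" unfolding D(2) cls_def coset_eq_iff using g by simp
  then show "X \<in> cls ` Z" using g by blast
next
  fix X assume "X \<in> cls ` Z"
  then show "X \<in> T1 A" unfolding T1_def cls_def using Dcoc_cocycle by blast
qed

text \<open>The weight condition says that \<open>t (- R) - t (- r)\<close> times the component is
  trivial for all \<open>t\<close> and \<open>R\<close>. For \<open>R \<noteq> r\<close> a
  separating \<open>t\<close> makes the factor nonzero. The other components are trivial rather than
  zero, because a class determines its representative only modulo \<open>Bd\<close>.\<close>

lemma T1_deg_cls: "T1_deg A (- r) = {cls g | g. g \<in> Z \<and> (\<forall>R. R \<noteq> r \<longrightarrow> triv R (comp R g))}"
proof -
  have "cls g \<in> T1_deg A (- r) \<longleftrightarrow> (\<forall>R. R \<noteq> r \<longrightarrow> triv R (comp R g))" if g: "g \<in> Z" for g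
  proof -
    have "cls g \<in> T1_deg A (- r) \<longleftrightarrow> (\<forall>t\<in>torus. \<forall>R. triv R (\<lambda>s. (t (- R) - t (- r)) * comp R g s))"
      using g by (simp add: T1_deg_def T1_cls torus_act_cls T1_scale_cls cls_eq_triv Z_tw Z_const comp_tw comp_simps
          left_diff_distrib)
    also have "\<dots> \<longleftrightarrow> (\<forall>R. R \<noteq> r \<longrightarrow> triv R (comp R g))"
    proof safe
      fix R assume tr: "\<forall>t\<in>torus. \<forall>R. triv R (\<lambda>s. (t (- R) - t (- r)) * comp R g s)" and "R \<noteq> r"
      then obtain t where "t \<in> torus" "t (- R) \<noteq> t (- r)" using separating[of "- R" "- r"] by auto
      then show "triv R (comp R g)" using tr triv_scale_iff[of "t (- R) - t (- r)" R "comp R g"] by simp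
    next
      fix t R assume "\<forall>R. R \<noteq> r \<longrightarrow> triv R (comp R g)"
      then show "triv R (\<lambda>s. (t (- R) - t (- r)) * comp R g s)"
        by (cases "R = r") (simp_all add: triv_0 triv_scale)
    qed
    finally show ?thesis .
  qed
  moreover have "T1_deg A (- r) \<subseteq> cls ` Z" unfolding T1_deg_def T1_cls by blast
  ultimately show ?thesis by blast
qed

lemma T1_deg_nonzero_iff:
  "T1_deg A (- r) \<noteq> {T1_zero A} \<longleftrightarrow> (\<exists>\<gamma>. locadd r \<gamma> \<and> \<not> triv r \<gamma>)"
proof -
  have z: "T1_zero A \<in> T1_deg A (- r)"
    unfolding T1_deg_cls T1_zero_cls using Z_0 by (auto simp: comp_simps triv_0)
  have "(\<exists>g\<in>Z. (\<forall>R. R \<noteq> r \<longrightarrow> triv R (comp R g)) \<and> \<not> triv r (comp r g)) \<longleftrightarrow> (\<exists>\<gamma>. locadd r \<gamma> \<and> \<not> triv r \<gamma>)"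
  proof safe
    fix g assume "g \<in> Z" "\<not> triv r (comp r g)"
    then show "\<exists>\<gamma>. locadd r \<gamma> \<and> \<not> triv r \<gamma>" by (auto simp: Z_iff)
  next
    fix \<gamma> assume "locadd r \<gamma>" "\<not> triv r \<gamma>"
    then show "\<exists>g\<in>Z. (\<forall>R. R \<noteq> r \<longrightarrow> triv R (comp R g)) \<and> \<not> triv r (comp r g)"
      by (intro bexI[of _ "homog r \<gamma>"] Z_homog) (auto simp: comp_homog triv_0)
  qed
  moreover have "T1_deg A (- r) \<noteq> {T1_zero A} \<longleftrightarrow>
      (\<exists>g\<in>Z. (\<forall>R. R \<noteq> r \<longrightarrow> triv R (comp R g)) \<and> \<not> triv r (comp r g))"
  proof -
    have "T1_deg A (- r) \<noteq> {T1_zero A} \<longleftrightarrow> (\<exists>X\<in>T1_deg A (- r). X \<noteq> T1_zero A)" using z by blast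
    also have "\<dots> \<longleftrightarrow> (\<exists>g\<in>Z. (\<forall>R. R \<noteq> r \<longrightarrow> triv R (comp R g)) \<and> cls g \<noteq> T1_zero A)"
      unfolding T1_deg_cls by blast
    also have "\<dots> \<longleftrightarrow> (\<exists>g\<in>Z. (\<forall>R. R \<noteq> r \<longrightarrow> triv R (comp R g)) \<and> \<not> triv r (comp r g))"
      by (intro bex_cong conj_cong refl) (auto simp: T1_zero_cls cls_eq_triv Z_0 comp_simps)
    finally show ?thesis .
  qed
  ultimately show ?thesis by blast
qed

lemma T1_part_iso_complexI:
  assumes \<gamma>: "locadd r \<gamma>" "\<not> triv r \<gamma>"
    and span: "\<And>\<gamma>'. locadd r \<gamma>' \<Longrightarrow> \<exists>\<alpha>. triv r (\<lambda>s. \<gamma>' s - \<alpha> * \<gamma> s)"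
  shows "T1_part_iso_complex A (T1_deg A (- r))"
proof -
  define h where "h a = cls (\<lambda>s. const a * homog r \<gamma> s)" for a
  have Zh: "(\<lambda>s. const a * homog r \<gamma> s) \<in> Z" for a by (intro Z_const Z_homog \<gamma>)
  have c: "comp R (\<lambda>s. const a * homog r \<gamma> s) = (if R = r then (\<lambda>s. a * \<gamma> s) else (\<lambda>s. 0))" for a R
    by (simp add: comp_simps comp_homog)
  have inj: "inj h"
  proof (rule injI)
    fix a b assume "h a = h b"
    then have "triv r (\<lambda>s. (a - b) * \<gamma> s)"
      using cls_eq_triv[OF Zh Zh] c by (auto simp: h_def left_diff_distrib dest: spec[of _ r])
    then show "a = b" using triv_scale_iff[of "a - b" r \<gamma>] \<gamma>(2) by auto
  qed
  have "range h = T1_deg A (- r)"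
  proof (intro equalityI subsetI)
    fix X assume "X \<in> range h"
    then obtain a where "X = h a" by blast
    then show "X \<in> T1_deg A (- r)"
      unfolding T1_deg_cls h_def using Zh[of a] c[of _ a] triv_0 by auto
  next
    fix X assume "X \<in> T1_deg A (- r)"
    then obtain g where g: "g \<in> Z" "X = cls g" "\<And>R. R \<noteq> r \<Longrightarrow> triv R (comp R g)"
      unfolding T1_deg_cls by blast
    obtain \<alpha> where \<alpha>: "triv r (\<lambda>s. comp r g s - \<alpha> * \<gamma> s)"
      using span[of "comp r g"] g(1) by (auto simp: Z_iff)
    have "X = h \<alpha>"
      unfolding g(2) h_def cls_eq_triv[OF g(1) Zh] c using g(3) \<alpha> by auto
    then show "X \<in> range h" by blast
  qed
  moreover have "h (a + b) = T1_add (h a) (h b)" for a b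
    by (simp add: h_def T1_add_cls ring_homD[OF ring_hom_const] distrib_right)
  moreover have "h (a * b) = T1_scale A a (h b)" for a b
    by (simp add: h_def T1_scale_cls ring_homD[OF ring_hom_const] mult.assoc)
  ultimately show ?thesis unfolding T1_part_iso_complex_def bij_betw_def using inj by blast
qed

text \<open>The summand at \<open>i\<close> is the homogeneous part of a representative in degree
  \<open>- \<rho> i\<close>. Degrees that are not attained carry trivial parts only, and injectivity
  of \<open>\<rho>\<close> puts different summands in different degrees.\<close>

lemma T1_direct_sumI:
  assumes inj: "inj_on \<rho> I"
    and W: "\<And>i. i \<in> I \<Longrightarrow> W i = T1_deg A (- \<rho> i)"
    and all: "\<And>R \<gamma>. locadd R \<gamma> \<Longrightarrow> \<not> triv R \<gamma> \<Longrightarrow> R \<in> \<rho> ` I"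
  shows "T1_direct_sum A I W"
  unfolding T1_direct_sum_def
proof (intro conjI ballI)
  show "W i \<subseteq> T1 A" if "i \<in> I" for i
    using W[OF that] by (auto simp: T1_deg_def)
  fix X assume "X \<in> T1 A"
  then obtain g where g: "g \<in> Z" "X = cls g" unfolding T1_cls by blast
  define f where "f i = homog (\<rho> i) (comp (\<rho> i) g)" for i
  have fZ: "f i \<in> Z" for i using g(1) unfolding f_def by (intro Z_homog) (simp add: Z_iff)
  have fc: "comp R (f i) = (if R = \<rho> i then comp R g else (\<lambda>s. 0))" for R i
    by (simp add: f_def comp_homog)
  define c where "c i = (if i \<in> I then cls (f i) else T1_zero A)" for i
  define J where "J = {i. c i \<noteq> T1_zero A}"
  have z: "cls h = T1_zero A \<longleftrightarrow> (\<forall>R. triv R (comp R h))" if "h \<in> Z" for h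
    using that by (simp add: T1_zero_cls cls_eq_triv Z_0 comp_simps)
  have J: "i \<in> J \<longleftrightarrow> i \<in> I \<and> \<not> triv (\<rho> i) (comp (\<rho> i) g)" for i
    by (auto simp: J_def c_def z fZ fc triv_0)
  show "\<exists>!c. (\<forall>i\<in>I. c i \<in> W i) \<and> (\<forall>i. i \<notin> I \<longrightarrow> c i = T1_zero A) \<and>
        finite {i. c i \<noteq> T1_zero A} \<and> X = T1_sum A c {i. c i \<noteq> T1_zero A}"
  proof (rule ex1I[of _ c])
    obtain T where T: "finite T" "\<And>R s. R \<notin> T \<Longrightarrow> s \<in> S \<Longrightarrow> s - R \<notin> S \<Longrightarrow> comp R g s = 0"
      using finite_support[OF g(1)] by blast
    have "triv R (comp R g)" if "R \<notin> T" for R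
      unfolding triv_def by (intro exI[of _ "\<lambda>s. 0"]) (simp add: T(2) that)
    \<comment> \<open>Only degrees given by the finite set \<open>T\<close> can carry a nontrivial
      part, and \<open>\<rho>\<close> is injective.\<close>
    then have "\<rho> ` J \<subseteq> T" using J by auto
    moreover have "inj_on \<rho> J" using inj J by (auto simp: inj_on_def)
    ultimately have fin: "finite J" using T(1) by (metis finite_imageD finite_subset)
    have "T1_sum A c J = cls (\<lambda>s. \<Sum>i\<in>J. f i s)"
      by (rule T1_sum_cls) (use J in \<open>simp add: c_def\<close>)
    also have "\<dots> = cls g"
    proof (subst cls_eq_triv)
      show "(\<lambda>s. \<Sum>i\<in>J. f i s) \<in> Z" by (intro Z_sum fZ)
      show "\<forall>R. triv R (\<lambda>s. comp R (\<lambda>s. \<Sum>i\<in>J. f i s) s - comp R g s)"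
      proof
        fix R
        show "triv R (\<lambda>s. comp R (\<lambda>s. \<Sum>i\<in>J. f i s) s - comp R g s)"
        proof (cases "R \<in> \<rho> ` J")
          case True
          then obtain i where i: "i \<in> J" "R = \<rho> i" by blast
          have "(\<Sum>j\<in>J. comp R (f j) s) = (\<Sum>j\<in>J. if j = i then comp R g s else 0)" for s
            using i inj J by (intro sum.cong) (auto simp: fc inj_on_def)
          then show ?thesis using i fin by (simp add: comp_simps triv_0)
        next
          case False
          then have "comp R (f j) = (\<lambda>s. 0)" if "j \<in> J" for j using that by (auto simp: fc)
          moreover have "triv R (comp R g)"
          proof (rule ccontr)
            assume "\<not> triv R (comp R g)"
            then show False using all[of R "comp R g"] g(1) J False by (auto simp: Z_iff)
          qed
          ultimately show ?thesis using triv_scale[of R "comp R g" "- 1"] by (simp add: comp_simps)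
        qed
      qed
    qed (rule g(1))
    finally show "(\<forall>i\<in>I. c i \<in> W i) \<and> (\<forall>i. i \<notin> I \<longrightarrow> c i = T1_zero A) \<and>
        finite {i. c i \<noteq> T1_zero A} \<and> X = T1_sum A c {i. c i \<noteq> T1_zero A}"
      unfolding J_def[symmetric] using fin fZ fc
      by (auto simp: c_def g(2) W T1_deg_cls triv_0 intro!: exI[of _ "f _"])
  next
    fix c' assume c': "(\<forall>i\<in>I. c' i \<in> W i) \<and> (\<forall>i. i \<notin> I \<longrightarrow> c' i = T1_zero A) \<and>
        finite {i. c' i \<noteq> T1_zero A} \<and> X = T1_sum A c' {i. c' i \<noteq> T1_zero A}"
    define J' where "J' = {i. c' i \<noteq> T1_zero A}"
    have "\<exists>h. h \<in> Z \<and> c' i = cls h \<and> (\<forall>R. R \<noteq> \<rho> i \<longrightarrow> triv R (comp R h))" if "i \<in> I" for i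
    proof -
      have "c' i \<in> T1_deg A (- \<rho> i)" using c' that W by auto
      then show ?thesis unfolding T1_deg_cls by blast
    qed
    then obtain h where h: "\<And>i. i \<in> I \<Longrightarrow> h i \<in> Z" "\<And>i. i \<in> I \<Longrightarrow> c' i = cls (h i)"
      "\<And>i R. i \<in> I \<Longrightarrow> R \<noteq> \<rho> i \<Longrightarrow> triv R (comp R (h i))"
      by metis
    have J'I: "J' \<subseteq> I" using c' by (auto simp: J'_def)
    have "X = T1_sum A c' J'" using c' by (simp add: J'_def)
    also have "\<dots> = cls (\<lambda>s. \<Sum>i\<in>J'. h i s)" by (rule T1_sum_cls) (use h(2) J'I in auto)
    finally have eq: "triv R (\<lambda>s. comp R g s - (\<Sum>i\<in>J'. comp R (h i) s))" for R
      unfolding g(2) using h(1) J'I g(1) by (subst (asm) cls_eq_triv) (auto intro!: Z_sum simp: comp_simps)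
    have fin: "finite J'" using c' by (simp add: J'_def)
    show "c' = c"
    proof
      fix i
      show "c' i = c i"
      proof (cases "i \<in> I")
        case False
        then show ?thesis using c' by (simp add: c_def)
      next
        case True
        \<comment> \<open>In degree \<open>- \<rho> i\<close> all classes of the second
          decomposition except the one at \<open>i\<close> are trivial, so the component of
          \<open>g\<close> there must come from \<open>h i\<close>.\<close>
        have rest: "triv (\<rho> i) (\<lambda>s. \<Sum>j\<in>J' - {i}. comp (\<rho> i) (h j) s)"
          using J'I True inj by (intro triv_sum h(3)) (auto simp: inj_on_def)
        have "triv (\<rho> i) (\<lambda>s. comp (\<rho> i) (h i) s - comp (\<rho> i) g s)"
        proof (cases "i \<in> J'")
          case True
          have e: "comp (\<rho> i) (h i) s - comp (\<rho> i) g s = - 1 * (comp (\<rho> i) g s - (\<Sum>j\<in>J'. comp (\<rho> i) (h j) s))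
             + (- 1) * (\<Sum>j\<in>J' - {i}. comp (\<rho> i) (h j) s)" for s
            using sum.remove[OF fin True, of "\<lambda>j. comp (\<rho> i) (h j) s"] by simp
          show ?thesis unfolding e by (rule triv_lin[OF eq rest])
        next
          case False
          then have "J' - {i} = J'" by simp
          then have "triv (\<rho> i) (\<lambda>s. (comp (\<rho> i) g s - (\<Sum>j\<in>J'. comp (\<rho> i) (h j) s)) + (\<Sum>j\<in>J'. comp (\<rho> i) (h j) s))"
            using triv_add[OF eq rest] by simp
          moreover have "triv (\<rho> i) (comp (\<rho> i) (h i))"
            using False h[OF \<open>i \<in> I\<close>] z[of "h i"] by (simp add: J'_def)
          ultimately show ?thesis using triv_diff by simp
        qed
        then have "cls (h i) = cls (f i)"
          unfolding cls_eq_triv[OF h(1)[OF True] fZ]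
          using h(3)[OF True] by (auto simp: fc)
        then show ?thesis using True h(2) by (simp add: c_def)
      qed
    qed
  qed
qed

end

section \<open>Locally additive functions on the lattice points of a cone\<close>

definition pr :: "'n::finite mlat \<Rightarrow> int ^ 'n \<Rightarrow> int" where
  "pr s w = (\<Sum>i\<in>UNIV. fst s $ i * w $ i) + snd s"

lemma pr_simps [simp]:
  "pr (s + t) w = pr s w + pr t w" "pr (s - t) w = pr s w - pr t w" "pr (- s) w = - pr s w"
  "pr 0 w = 0" "pr (mlat_scale k s) w = k * pr s w" "pr R_star w = 1"
  by (simp_all add: pr_def mlat_scale_def R_star_def sum.distrib sum_subtractf sum_negf algebra_simps sum_distrib_left)

lemma mlat_scale_simps:
  "mlat_scale (j + k) s = mlat_scale j s + mlat_scale k s" "mlat_scale 1 s = s" "mlat_scale 0 s = 0"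
  "mlat_scale k (s + t) = mlat_scale k s + mlat_scale k t" "mlat_scale k (mlat_scale j s) = mlat_scale (k * j) s"
  "mlat_scale (- k) s = - mlat_scale k s" "mlat_scale k (s - t) = mlat_scale k s - mlat_scale k t"
  by (simp_all add: mlat_scale_def prod_eq_iff vec_eq_iff algebra_simps)

lemma mlat_scale_nat: "mlat_scale (int (Suc n)) s = s + mlat_scale (int n) s"
  using mlat_scale_simps(1)[of 1 "int n" s] by (simp add: mlat_scale_simps(2))

definition lat_cone :: "(int ^ 'n::finite) set \<Rightarrow> 'n mlat set" where
  "lat_cone W = {s. \<forall>w\<in>W. 0 \<le> pr s w}"

text \<open>The first part exposes the pair by an integral functional; the second says that
  \<open>b - a\<close> is primitive, since the linear part of \<open>e\<close> takes the value 1 on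
  it.\<close>

definition edge :: "(int ^ 'n::finite) set \<Rightarrow> int ^ 'n \<Rightarrow> int ^ 'n \<Rightarrow> bool" where
  "edge W a b \<longleftrightarrow> (\<exists>\<sigma>. pr \<sigma> a = 0 \<and> pr \<sigma> b = 0 \<and> (\<forall>w\<in>W - {a, b}. 0 < pr \<sigma> w)) \<and> (\<exists>e. pr e a = 0 \<and> pr e b = 1)"

definition addit :: "('n::finite mlat \<Rightarrow> complex) \<Rightarrow> bool" where
  "addit l \<longleftrightarrow> (\<forall>a b. l (a + b) = l a + l b)"

lemma additD:
  assumes "addit l"
  shows "l (a + b) = l a + l b" "l 0 = 0" "l (- a) = - l a" "l (a - b) = l a - l b" "l (mlat_scale k a) = of_int k * l a"
proof -
  show add: "l (a + b) = l a + l b" for a b using assms unfolding addit_def by blast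
  show 0: "l 0 = 0" using add[of 0 0] by simp
  show m: "l (- a) = - l a" for a using add[of a "- a"] 0 by (simp add: eq_neg_iff_add_eq_0 add.commute)
  show "l (a - b) = l a - l b" using add[of a "- b"] m by simp
  have n: "l (mlat_scale (int n) a) = of_nat n * l a" for n
    by (induction n) (simp_all add: mlat_scale_nat mlat_scale_simps(3) 0 add algebra_simps del: of_nat_Suc, simp add: algebra_simps)
  show "l (mlat_scale k a) = of_int k * l a"
    by (cases k rule: int_cases2) (simp_all add: n m mlat_scale_simps)
qed

lemma edge_sym: "edge W a b \<Longrightarrow> edge W b a"
proof -
  assume "edge W a b"
  then obtain \<sigma> e where "pr \<sigma> a = 0" "pr \<sigma> b = 0" "\<forall>w\<in>W - {a, b}. 0 < pr \<sigma> w" "pr e a = 0" "pr e b = 1"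
    unfolding edge_def by blast
  then show "edge W b a" unfolding edge_def
    by (intro conjI exI[of _ \<sigma>] exI[of _ "R_star - e"]) auto
qed

locale lattice_cone =
  fixes W :: "(int ^ 'n::finite) set"
  assumes fin: "finite W"
    and vertex: "w \<in> W \<Longrightarrow> \<exists>\<sigma>. pr \<sigma> w = 0 \<and> (\<forall>w'\<in>W - {w}. 0 < pr \<sigma> w')"
begin

abbreviation S :: "'n mlat set" where "S \<equiv> lat_cone W"

sublocale monoid_alg S
  by unfold_locales (auto simp: lat_cone_def)

lemma R_star_S: "R_star \<in> S"
  by (simp add: lat_cone_def)

lemma scale_S: "s \<in> S \<Longrightarrow> 0 \<le> k \<Longrightarrow> mlat_scale k s \<in> S"
  by (simp add: lat_cone_def)

lemma diff_notin_iff: "s - R \<notin> S \<longleftrightarrow> (\<exists>w\<in>W. pr s w < pr R w)"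
  by (auto simp: lat_cone_def not_le)

text \<open>Membership in S can be forced by adding a multiple of a functional that is positive off
  \<open>E\<close>. When \<open>\<sigma>\<close> vanishes on \<open>E\<close>, the values there,
  which decide in which pieces an element lies, are unchanged.\<close>

lemma absorb:
  assumes "\<And>w. w \<in> E \<Longrightarrow> 0 \<le> pr u w" "\<And>w. w \<in> E \<Longrightarrow> 0 \<le> pr \<sigma> w" "\<And>w. w \<in> W - E \<Longrightarrow> 0 < pr \<sigma> w"
  obtains N :: nat where "u + mlat_scale (int N) \<sigma> \<in> S"
proof -
  define N where "N = nat (\<Sum>w\<in>W. \<bar>pr u w\<bar>)"
  have N: "\<bar>pr u w\<bar> \<le> int N" if "w \<in> W" for w
    using member_le_sum[OF that, of "\<lambda>w. \<bar>pr u w\<bar>"] fin by (simp add: N_def sum_nonneg)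
  have "0 \<le> pr u w + int N * pr \<sigma> w" if w: "w \<in> W" for w
  proof (cases "w \<in> E")
    case True then show ?thesis using assms by simp
  next
    case False
    then have "int N * 1 \<le> int N * pr \<sigma> w" using assms(3)[of w] w by (intro mult_left_mono) auto
    then show ?thesis using N[OF w] by simp
  qed
  then show ?thesis using that[of N] by (simp add: lat_cone_def)
qed

lemma locaddD:
  "locadd R \<gamma> \<Longrightarrow> w \<in> W \<Longrightarrow> x \<in> S \<Longrightarrow> y \<in> S \<Longrightarrow> pr (x + y) w < pr R w \<Longrightarrow> \<gamma> (x + y) = \<gamma> x + \<gamma> y"
  unfolding locadd_def diff_notin_iff by blast

text \<open>Values at \<open>w\<close> are nonnegative on S, so the bound on the full sum is
  inherited by all partial sums.\<close>

lemma locadd_scale_add: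
  assumes "locadd R \<gamma>" "w \<in> W" "x \<in> S" "y \<in> S" "pr (mlat_scale (int n) x + y) w < pr R w"
  shows "\<gamma> (mlat_scale (int n) x + y) = of_nat n * \<gamma> x + \<gamma> y"
  using assms(5)
proof (induction n)
  case 0
  then show ?case by (simp add: mlat_scale_simps)
next
  case (Suc n)
  have x0: "0 \<le> pr x w" using assms by (auto simp: lat_cone_def)
  have "\<gamma> (mlat_scale (int (Suc n)) x + y) = \<gamma> (x + (mlat_scale (int n) x + y))"
    by (simp only: mlat_scale_nat add.assoc)
  also have "\<dots> = \<gamma> x + \<gamma> (mlat_scale (int n) x + y)"
    using Suc.prems assms by (intro locaddD[OF assms(1,2)] add_S scale_S) (auto simp: algebra_simps)
  also have "\<gamma> (mlat_scale (int n) x + y) = of_nat n * \<gamma> x + \<gamma> y"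
    using Suc.prems x0 by (intro Suc.IH) (simp add: algebra_simps)
  finally show ?case by (simp add: algebra_simps)
qed

text \<open>A functional that vanishes at \<open>w\<close> enters S after adding multiples of
  \<open>\<sigma>\<close>, which cost nothing at \<open>w\<close>; this determines the linear
  function on such functionals. \<open>R_star\<close> has value 1 at \<open>w\<close> and supplies
  the missing direction. Positivity of \<open>R\<close> at \<open>w\<close> puts
  \<open>\<sigma>\<close> and the shifted functionals into the piece.\<close>

lemma vertex_linear:
  assumes \<gamma>: "locadd R \<gamma>" and w: "w \<in> W" and R: "1 \<le> pr R w"
  obtains l where "addit l" "\<And>s. s \<in> S \<Longrightarrow> pr s w < pr R w \<Longrightarrow> \<gamma> s = l s"
proof -
  obtain \<sigma> where \<sigma>: "pr \<sigma> w = 0" "\<And>w'. w' \<in> W - {w} \<Longrightarrow> 0 < pr \<sigma> w'"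
    using vertex[OF w] by blast
  have \<sigma>S: "\<sigma> \<in> S" using \<sigma> by (force simp: lat_cone_def)
  have "\<exists>N::nat. u + mlat_scale (int N) \<sigma> \<in> S" if "pr u w = 0" for u
    using absorb[of "{w}" u \<sigma>] \<sigma> that by auto
  then obtain N :: "'n mlat \<Rightarrow> nat" where N: "\<And>u. pr u w = 0 \<Longrightarrow> u + mlat_scale (int (N u)) \<sigma> \<in> S"
    by metis
  \<comment> \<open>The value that a linear extension must have at \<open>u\<close>; by the next
    claim any other sufficient multiple of \<open>\<sigma>\<close> gives the same.\<close>
  define \<mu> where "\<mu> u = \<gamma> (u + mlat_scale (int (N u)) \<sigma>) - of_nat (N u) * \<gamma> \<sigma>" for u
  have \<mu>: "\<gamma> (u + mlat_scale (int m) \<sigma>) = of_nat m * \<gamma> \<sigma> + \<mu> u"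
    if u: "pr u w = 0" and m: "u + mlat_scale (int m) \<sigma> \<in> S" for u m
  proof -
    have "of_nat (N u) * \<gamma> \<sigma> + \<gamma> (u + mlat_scale (int m) \<sigma>) = \<gamma> (mlat_scale (int (N u)) \<sigma> + (u + mlat_scale (int m) \<sigma>))"
      using \<sigma> u m R by (intro locadd_scale_add[OF \<gamma> w \<sigma>S, symmetric]) auto
    also have "mlat_scale (int (N u)) \<sigma> + (u + mlat_scale (int m) \<sigma>) = mlat_scale (int m) \<sigma> + (u + mlat_scale (int (N u)) \<sigma>)"
      by (simp add: algebra_simps)
    also have "\<gamma> \<dots> = of_nat m * \<gamma> \<sigma> + \<gamma> (u + mlat_scale (int (N u)) \<sigma>)"
      using \<sigma> u N[OF u] R by (intro locadd_scale_add[OF \<gamma> w \<sigma>S]) auto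
    finally show ?thesis by (simp add: \<mu>_def algebra_simps)
  qed
  have \<mu>add: "\<mu> (u + v) = \<mu> u + \<mu> v" if u: "pr u w = 0" and v: "pr v w = 0" for u v
  proof -
    have e: "(u + v) + mlat_scale (int (N u + N v)) \<sigma> = (u + mlat_scale (int (N u)) \<sigma>) + (v + mlat_scale (int (N v)) \<sigma>)"
      by (simp add: mlat_scale_simps algebra_simps)
    have "of_nat (N u + N v) * \<gamma> \<sigma> + \<mu> (u + v) = \<gamma> ((u + v) + mlat_scale (int (N u + N v)) \<sigma>)"
      using u v by (intro \<mu>[symmetric]) (simp, unfold e, intro add_S N)
    also have "\<dots> = \<gamma> (u + mlat_scale (int (N u)) \<sigma>) + \<gamma> (v + mlat_scale (int (N v)) \<sigma>)"
      unfolding e using u v \<sigma> R by (intro locaddD[OF \<gamma> w] N) auto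
    also have "\<dots> = of_nat (N u) * \<gamma> \<sigma> + \<mu> u + (of_nat (N v) * \<gamma> \<sigma> + \<mu> v)"
      using \<mu>[OF u N[OF u]] \<mu>[OF v N[OF v]] by simp
    finally show ?thesis by (simp add: algebra_simps)
  qed
  define h where "h u = u - mlat_scale (pr u w) R_star" for u
  have h0: "pr (h u) w = 0" for u by (simp add: h_def)
  have hadd: "h (u + v) = h u + h v" for u v
    by (simp add: h_def mlat_scale_simps algebra_simps)
  define l where "l u = of_int (pr u w) * \<gamma> R_star + \<mu> (h u)" for u
  have "addit l"
    unfolding addit_def by (simp add: l_def hadd \<mu>add h0 algebra_simps)
  moreover have "\<gamma> s = l s" if s: "s \<in> S" "pr s w < pr R w" for s
  proof -
    have s0: "0 \<le> pr s w" using s w by (auto simp: lat_cone_def)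
    define m where "m = N (h s)"
    have hS: "h s + mlat_scale (int m) \<sigma> \<in> S" unfolding m_def by (rule N) (rule h0)
    have "of_nat m * \<gamma> \<sigma> + \<gamma> s = \<gamma> (mlat_scale (int m) \<sigma> + s)"
      using s \<sigma> by (intro locadd_scale_add[OF \<gamma> w \<sigma>S, symmetric]) auto
    also have "mlat_scale (int m) \<sigma> + s = mlat_scale (int (nat (pr s w))) R_star + (h s + mlat_scale (int m) \<sigma>)"
      using s0 by (simp add: h_def algebra_simps)
    also have "\<gamma> \<dots> = of_nat (nat (pr s w)) * \<gamma> R_star + \<gamma> (h s + mlat_scale (int m) \<sigma>)"
      using hS s s0 \<sigma> h0[of s] by (intro locadd_scale_add[OF \<gamma> w R_star_S]) auto
    also have "\<dots> = of_nat (nat (pr s w)) * \<gamma> R_star + (of_nat m * \<gamma> \<sigma> + \<mu> (h s))"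
      using \<mu>[OF h0 hS] by simp
    also have "of_nat (nat (pr s w)) = (of_int (pr s w) :: complex)"
      using s0 by simp
    finally show ?thesis by (simp add: l_def)
  qed
  ultimately show ?thesis by (rule that)
qed

text \<open>Together with \<open>R_star\<close> these functionals form a lattice basis adapted to
  \<open>w\<close>.\<close>

definition vert_basis :: "int ^ 'n \<Rightarrow> 'n \<Rightarrow> 'n mlat" where
  "vert_basis w i = (axis i 1, - (w $ i))"

lemma pr_vert_basis: "pr (vert_basis w i) w = 0"
  by (simp add: pr_def vert_basis_def axis_def if_distrib[of "\<lambda>x. x * _"] cong: if_cong)

lemma mlat_expand: "u = (\<Sum>i\<in>UNIV. mlat_scale (fst u $ i) (vert_basis w i)) + mlat_scale (pr u w) R_star"
  by (simp add: prod_eq_iff vec_eq_iff fst_sum snd_sum mlat_scale_def vert_basis_def R_star_def pr_def axis_def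
      if_distrib[of "\<lambda>x. _ * x"] sum_negf cong: if_cong)

lemma addit_sum: "addit l \<Longrightarrow> l (\<Sum>i\<in>I. f i) = (\<Sum>i\<in>I. l (f i))"
  by (induction I rule: infinite_finite_induct) (simp_all add: additD)

text \<open>One set serves for all \<open>R\<close> and \<open>\<gamma>\<close>. Its members other
  than \<open>R_star\<close> vanish at \<open>w\<close>, so every nonempty piece at \<open>w\<close>
  contains them, and with \<open>R_star\<close> they generate the lattice.\<close>

lemma vertex_test_set:
  assumes w: "w \<in> W"
  obtains H where "finite H" "H \<subseteq> S" "\<And>R \<gamma> s. locadd R \<gamma> \<Longrightarrow> \<forall>h\<in>H. \<gamma> h = 0 \<Longrightarrow> s \<in> S \<Longrightarrow> pr s w < pr R w \<Longrightarrow> \<gamma> s = 0"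
proof -
  obtain \<sigma> where \<sigma>: "pr \<sigma> w = 0" "\<And>w'. w' \<in> W - {w} \<Longrightarrow> 0 < pr \<sigma> w'"
    using vertex[OF w] by blast
  have \<sigma>S: "\<sigma> \<in> S" using \<sigma> by (force simp: lat_cone_def)
  have "\<exists>N::nat. vert_basis w i + mlat_scale (int N) \<sigma> \<in> S" for i
    using absorb[of "{w}" "vert_basis w i" \<sigma>] \<sigma> pr_vert_basis[of w i] by auto
  then obtain N :: "'n \<Rightarrow> nat" where N: "\<And>i. vert_basis w i + mlat_scale (int (N i)) \<sigma> \<in> S" by metis
  let ?b = "\<lambda>i. vert_basis w i + mlat_scale (int (N i)) \<sigma>"
  show ?thesis
  proof (rule that[of "insert R_star (insert \<sigma> (range ?b))"])
    show "insert R_star (insert \<sigma> (range ?b)) \<subseteq> S" using N \<sigma>S R_star_S by auto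
    fix R \<gamma> s assume \<gamma>: "locadd R \<gamma>" and 0: "\<forall>h\<in>insert R_star (insert \<sigma> (range ?b)). \<gamma> h = 0"
      and s: "s \<in> S" "pr s w < pr R w"
    have s0: "0 \<le> pr s w" using s w by (auto simp: lat_cone_def)
    obtain l where l: "addit l" "\<And>s. s \<in> S \<Longrightarrow> pr s w < pr R w \<Longrightarrow> \<gamma> s = l s"
      using vertex_linear[OF \<gamma> w] s s0 by auto
    have R1: "0 < pr R w" using s s0 by simp
    have "l \<sigma> = 0" using l(2)[OF \<sigma>S] 0 \<sigma> R1 by simp
    moreover have "l (?b i) = 0" for i using l(2)[OF N] 0 \<sigma> pr_vert_basis[of w i] R1 by simp
    ultimately have b: "l (vert_basis w i) = 0" for i by (simp add: additD[OF l(1)])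
    \<comment> \<open>If \<open>s\<close> has a positive value at \<open>w\<close>, then
      \<open>R\<close> is at least two there and \<open>R_star\<close> belongs to the piece;
      otherwise the factor is zero.\<close>
    have r: "of_int (pr s w) * l R_star = 0"
      using l(2)[OF R_star_S] 0 s s0 by (cases "pr s w = 0") auto
    have "\<gamma> s = l s" using l(2) s by simp
    also have "\<dots> = 0"
      by (subst mlat_expand[of s w]) (simp add: additD[OF l(1)] addit_sum[OF l(1)] b r)
    finally show "\<gamma> s = 0" .
  qed simp
qed

lemma test_set_ex:
  "\<exists>H. finite H \<and> H \<subseteq> S \<and> (\<forall>R \<gamma>. locadd R \<gamma> \<longrightarrow> (\<forall>h\<in>H. \<gamma> h = 0) \<longrightarrow> (\<forall>s\<in>S. s - R \<notin> S \<longrightarrow> \<gamma> s = 0))"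
proof -
  have "\<exists>H. finite H \<and> H \<subseteq> S \<and> (\<forall>R \<gamma> s. locadd R \<gamma> \<longrightarrow> (\<forall>h\<in>H. \<gamma> h = 0) \<longrightarrow> s \<in> S \<longrightarrow> pr s w < pr R w \<longrightarrow> \<gamma> s = 0)"
    if "w \<in> W" for w
    using vertex_test_set[OF that] by metis
  then obtain H where H: "\<And>w. w \<in> W \<Longrightarrow> finite (H w)" "\<And>w. w \<in> W \<Longrightarrow> H w \<subseteq> S"
    "\<And>w R \<gamma> s. w \<in> W \<Longrightarrow> locadd R \<gamma> \<Longrightarrow> \<forall>h\<in>H w. \<gamma> h = 0 \<Longrightarrow> s \<in> S \<Longrightarrow> pr s w < pr R w \<Longrightarrow> \<gamma> s = 0"
    by metis
  show ?thesis
  proof (intro exI[of _ "\<Union>w\<in>W. H w"] conjI allI impI ballI)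
    fix R \<gamma> s assume \<gamma>: "locadd R \<gamma>" "\<forall>h\<in>\<Union>w\<in>W. H w. \<gamma> h = 0" and s: "s \<in> S" "s - R \<notin> S"
    obtain w where w: "w \<in> W" "pr s w < pr R w" using s(2) unfolding diff_notin_iff by blast
    show "\<gamma> s = 0" by (rule H(3)[OF w(1) \<gamma>(1) _ s(1) w(2)]) (use \<gamma>(2) w(1) in blast)
  qed (use H(1,2) fin in auto)
qed

text \<open>Shifting \<open>u\<close> along the functional of the edge moves it into S without
  changing its end values, so the result lies in both pieces. The functional itself vanishes at both
  ends and lies in both pieces as well.\<close>

lemma edge_agree:
  assumes e: "edge W a b" and ab: "a \<in> W" "b \<in> W"
    and la: "addit la" "\<And>s. s \<in> S \<Longrightarrow> pr s a < pr R a \<Longrightarrow> \<gamma> s = la s"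
    and lb: "addit lb" "\<And>s. s \<in> S \<Longrightarrow> pr s b < pr R b \<Longrightarrow> \<gamma> s = lb s"
    and u: "0 \<le> pr u a" "pr u a < pr R a" "0 \<le> pr u b" "pr u b < pr R b"
  shows "la u = lb u"
proof -
  obtain \<sigma> where \<sigma>: "pr \<sigma> a = 0" "pr \<sigma> b = 0" "\<forall>w\<in>W - {a, b}. 0 < pr \<sigma> w"
    using e unfolding edge_def by blast
  have \<sigma>S: "\<sigma> \<in> S" using \<sigma> by (force simp: lat_cone_def)
  obtain N :: nat where N: "u + mlat_scale (int N) \<sigma> \<in> S"
    by (rule absorb[of "{a, b}" u \<sigma>]) (use \<sigma> u in auto)
  have "la \<sigma> = lb \<sigma>" using la(2)[OF \<sigma>S] lb(2)[OF \<sigma>S] u \<sigma> by simp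
  moreover have "la (u + mlat_scale (int N) \<sigma>) = lb (u + mlat_scale (int N) \<sigma>)"
    using la(2)[OF N] lb(2)[OF N] u \<sigma> by simp
  ultimately show ?thesis by (simp add: additD[OF la(1)] additD[OF lb(1)])
qed

text \<open>\<open>R_star - e\<close> and \<open>e\<close> have the values (1,0) and (0,1) at
  \<open>a\<close> and \<open>b\<close>; subtracting the right multiples leaves a functional that
  vanishes at both.\<close>

lemma edge_decomp:
  assumes e: "pr e a = 0" "pr e b = 1"
    and l: "addit l" "\<And>u. pr u a = 0 \<Longrightarrow> pr u b = 0 \<Longrightarrow> l u = 0"
  shows "l u = l (R_star - e) * of_int (pr u a) + l e * of_int (pr u b)"
proof -
  have "l (u - mlat_scale (pr u a) (R_star - e) - mlat_scale (pr u b) e) = 0"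
    using e by (intro l(2)) (simp_all add: algebra_simps)
  then show ?thesis by (simp add: additD[OF l(1)] algebra_simps)
qed

lemma addit_diff: "addit l \<Longrightarrow> addit l' \<Longrightarrow> addit (\<lambda>u. l u - l' u)"
  by (simp add: addit_def)

lemma addit_minus_pr: "addit l \<Longrightarrow> addit (\<lambda>u. l u - p * of_int (pr u w))"
  by (simp add: addit_def algebra_simps)

lemma trivI: "addit l \<Longrightarrow> (\<And>s w. s \<in> S \<Longrightarrow> w \<in> W \<Longrightarrow> pr s w < pr R w \<Longrightarrow> \<gamma> s = l s) \<Longrightarrow> triv R \<gamma>"
  unfolding triv_def diff_notin_iff addit_def by blast

text \<open>
  The case of a non-lattice vertex: all vertices of value at least two are joined by edges along
  which the linear functions agree, and a vertex of value one is joined to such a vertex.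
\<close>

lemma triv_if_ge_2:
  assumes simplex: "\<And>r i k. i \<in> W \<Longrightarrow> k \<in> W \<Longrightarrow> pr r i < pr r k \<Longrightarrow> \<exists>j\<in>W. edge W i j \<and> pr r i < pr r j"
    and \<gamma>: "locadd R \<gamma>" and big: "w0 \<in> W" "2 \<le> pr R w0"
  shows "triv R \<gamma>"
proof -
  obtain k where k: "k \<in> W" "\<And>w. w \<in> W \<Longrightarrow> pr R w \<le> pr R k"
    using Max_in[of "pr R ` W"] Max_ge[of "pr R ` W"] fin big by (metis (no_types, lifting) empty_iff finite_imageI image_iff image_is_empty)
  have k2: "2 \<le> pr R k" using k(2)[OF big(1)] big(2) by simp
  have "\<exists>l. addit l \<and> (\<forall>s\<in>S. pr s w < pr R w \<longrightarrow> \<gamma> s = l s)" if "w \<in> W" "1 \<le> pr R w" for w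
    using vertex_linear[OF \<gamma> that] by metis
  then obtain L where L: "\<And>w. w \<in> W \<Longrightarrow> 1 \<le> pr R w \<Longrightarrow> addit (L w)"
    "\<And>w s. w \<in> W \<Longrightarrow> 1 \<le> pr R w \<Longrightarrow> s \<in> S \<Longrightarrow> pr s w < pr R w \<Longrightarrow> \<gamma> s = L w s"
    by metis
  \<comment> \<open>Of the generators with end values (0,0), (0,1), (1,0), the first two are
    admissible because \<open>R\<close> is at least one at \<open>i\<close> and two at
    \<open>j\<close>; the last one requires \<open>R\<close> to be at least two at \<open>i\<close>.
    If \<open>R\<close> is one at \<open>i\<close>, agreement on functionals vanishing at
    \<open>i\<close> suffices, as the piece at \<open>i\<close> has no others.\<close>
  have step: "L i u = L j u" if e: "edge W i j" and ij: "i \<in> W" "j \<in> W" "1 \<le> pr R i" "2 \<le> pr R j"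
    and c: "pr u i = 0 \<or> 2 \<le> pr R i" for i j u
  proof -
    have j1: "1 \<le> pr R j" using ij by simp
    note agree = edge_agree[OF e ij(1,2) L(1)[OF ij(1,3)] L(2)[OF ij(1,3)] L(1)[OF ij(2) j1] L(2)[OF ij(2) j1]]
    have v: "L i u - L j u = 0" if "pr u i = 0" "pr u j = 0" for u
    proof -
      have "L i u = L j u" by (rule agree) (use that ij in auto)
      then show ?thesis by simp
    qed
    obtain x where x: "pr x i = 0" "pr x j = 1" using e unfolding edge_def by blast
    have q: "L i x = L j x" by (rule agree) (use x ij in auto)
    have p: "L i (R_star - x) = L j (R_star - x)" if "2 \<le> pr R i"
      by (rule agree) (use x ij that in auto)
    show ?thesis
      using edge_decomp[OF x addit_diff[OF L(1)[OF ij(1,3)] L(1)[OF ij(2) j1]] v, of u] p q c by auto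
  qed
  obtain \<sigma> where \<sigma>: "pr \<sigma> k = 0" "\<And>w'. w' \<in> W - {k} \<Longrightarrow> 0 < pr \<sigma> w'"
    using vertex[OF k(1)] by blast
  have \<sigma>0: "0 \<le> pr \<sigma> w" if "w \<in> W" for w using \<sigma> that by (cases "w = k") (auto intro: less_imp_le)
  \<comment> \<open>\<open>N\<close> exceeds every value of \<open>\<sigma>\<close>, so
    \<open>r = N R - \<sigma>\<close> compares vertices by \<open>R\<close> first and breaks ties by
    \<open>\<sigma>\<close>. Its only maximum is \<open>k\<close>, and an ascent for
    \<open>r\<close> cannot stop at another maximum of \<open>R\<close>.\<close>
  define N where "N = (\<Sum>w\<in>W. pr \<sigma> w) + 1"
  have N: "pr \<sigma> w < N" if "w \<in> W" for w
    using member_le_sum[OF that, of "pr \<sigma>"] \<sigma>0 fin by (simp add: N_def)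
  define r where "r = mlat_scale N R - \<sigma>"
  have all: "L j = L k" if "j \<in> W" "2 \<le> pr R j" for j
    using that
  proof (induction "nat (pr r k - pr r j)" arbitrary: j rule: less_induct)
    case less
    show ?case
    proof (cases "j = k")
      case False
      have N0: "0 < N" using N[OF k(1)] \<sigma> by simp
      have "N * pr R j \<le> N * pr R k" using k(2)[OF less.prems(1)] N0 by (intro mult_left_mono) auto
      then have lt: "pr r j < pr r k" using \<sigma>(2)[of j] False less.prems \<sigma>(1) by (simp add: r_def)
      obtain j' where j': "j' \<in> W" "edge W j j'" "pr r j < pr r j'"
        using simplex[OF less.prems(1) k(1) lt] by blast
      \<comment> \<open>A drop of \<open>R\<close> by one would cost \<open>N\<close>, more than
        \<open>\<sigma>\<close> can compensate; so the ascent never leaves the vertices of value at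
        least two.\<close>
      have "pr R j \<le> pr R j'"
      proof (rule ccontr)
        assume "\<not> ?thesis"
        then have "N * pr R j' \<le> N * (pr R j - 1)" using N0 by (intro mult_left_mono) auto
        then show False using j'(3) N[OF less.prems(1)] \<sigma>0[OF j'(1)] by (simp add: r_def algebra_simps)
      qed
      then have "L j' = L k" using less.prems j' lt by (intro less.hyps) auto
      moreover have "L j = L j'"
        using step[OF j'(2) less.prems(1) j'(1)] less.prems \<open>pr R j \<le> pr R j'\<close> by (intro ext) auto
      ultimately show ?thesis by simp
    qed simp
  qed
  show ?thesis
  proof (rule trivI)
    show "addit (L k)" using L(1)[OF k(1)] k2 by simp
    fix s w assume s: "s \<in> S" "w \<in> W" "pr s w < pr R w"
    have s0: "0 \<le> pr s w" using s by (auto simp: lat_cone_def)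
    have \<gamma>s: "\<gamma> s = L w s" using L(2)[of w s] s s0 by simp
    show "\<gamma> s = L k s"
    proof (cases "2 \<le> pr R w")
      case True
      then show ?thesis using \<gamma>s all s by simp
    next
      \<comment> \<open>At value one the piece consists of elements vanishing at \<open>w\<close>,
        and one edge along which \<open>R\<close> increases leads to a vertex of value at least
        two.\<close>
      case False
      then have w1: "pr R w = 1" "pr s w = 0" using s s0 by auto
      obtain j where j: "j \<in> W" "edge W w j" "pr R w < pr R j"
        using simplex[OF s(2) k(1)] w1 k2 by (metis less_le_trans one_less_numeral_iff semiring_norm(76))
      then show ?thesis using step[OF j(2) s(2) j(1)] w1 \<gamma>s all[OF j(1)] by simp
    qed
  qed
qed

section \<open>Degrees with all vertex values at most one\<close>

context
  fixes R E
  assumes R: "\<And>w. w \<in> W \<Longrightarrow> pr R w \<le> 1" and E: "E = {w \<in> W. pr R w = 1}"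
begin

text \<open>A piece is nonempty only at a vertex of value one, and there it consists of the elements
  vanishing at that vertex.\<close>

lemma triv_E_I:
  "addit l \<Longrightarrow> (\<And>s w. s \<in> S \<Longrightarrow> w \<in> E \<Longrightarrow> pr s w = 0 \<Longrightarrow> \<gamma> s = l s) \<Longrightarrow> triv R \<gamma>"
proof (rule trivI)
  fix s w assume *: "\<And>s w. s \<in> S \<Longrightarrow> w \<in> E \<Longrightarrow> pr s w = 0 \<Longrightarrow> \<gamma> s = l s" "s \<in> S" "w \<in> W" "pr s w < pr R w"
  then have "0 \<le> pr s w" by (auto simp: lat_cone_def)
  then have "pr s w = 0" "w \<in> E" using * R[of w] by (auto simp: E)
  then show "\<gamma> s = l s" using * by blast
qed

lemma E_linear:
  assumes "locadd R \<gamma>" "w \<in> E"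
  obtains l where "addit l" "\<And>s. s \<in> S \<Longrightarrow> pr s w < pr R w \<Longrightarrow> \<gamma> s = l s"
  using vertex_linear[OF assms(1), of w] assms(2) by (auto simp: E)

text \<open>The difference of the two linear functions vanishes on functionals that vanish at both
  ends, hence it is a combination of the two end evaluations.\<close>

lemma E_edge:
  assumes e: "edge W a b" and ab: "a \<in> E" "b \<in> E"
    and la: "addit la" "\<And>s. s \<in> S \<Longrightarrow> pr s a < pr R a \<Longrightarrow> \<gamma> s = la s"
    and lb: "addit lb" "\<And>s. s \<in> S \<Longrightarrow> pr s b < pr R b \<Longrightarrow> \<gamma> s = lb s"
  obtains p q where "\<And>u. lb u = la u + p * of_int (pr u a) + q * of_int (pr u b)"
proof -
  have in_W: "a \<in> W" "b \<in> W" and 1: "pr R a = 1" "pr R b = 1" using ab by (auto simp: E)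
  have v: "lb u - la u = 0" if "pr u a = 0" "pr u b = 0" for u
  proof -
    have "la u = lb u" by (rule edge_agree[where R = R and \<gamma> = \<gamma>, OF e in_W la lb]) (use that 1 in auto)
    then show ?thesis by simp
  qed
  obtain x where x: "pr x a = 0" "pr x b = 1" using e unfolding edge_def by blast
  have "lb u = la u + (lb (R_star - x) - la (R_star - x)) * of_int (pr u a) + (lb x - la x) * of_int (pr u b)" for u
    using edge_decomp[OF x addit_diff[OF lb(1) la(1)] v, of u] by (simp add: algebra_simps)
  then show ?thesis by (rule that)
qed

text \<open>Of the two end evaluations by which the functions differ, the one at \<open>a\<close>
  vanishes on the piece at \<open>a\<close> and can be added to \<open>la\<close>; the one at
  \<open>b\<close> vanishes on the piece at \<open>b\<close>.\<close>

lemma E_edge_common: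
  assumes e: "edge W a b" and ab: "a \<in> E" "b \<in> E" and \<gamma>: "locadd R \<gamma>"
  obtains l where "addit l" "\<And>s w. s \<in> S \<Longrightarrow> w \<in> {a, b} \<Longrightarrow> pr s w < pr R w \<Longrightarrow> \<gamma> s = l s"
proof -
  have 1: "pr R a = 1" "pr R b = 1" using ab by (auto simp: E)
  obtain la where la: "addit la" "\<And>s. s \<in> S \<Longrightarrow> pr s a < pr R a \<Longrightarrow> \<gamma> s = la s"
    using E_linear[OF \<gamma> ab(1)] by blast
  obtain lb where lb: "addit lb" "\<And>s. s \<in> S \<Longrightarrow> pr s b < pr R b \<Longrightarrow> \<gamma> s = lb s"
    using E_linear[OF \<gamma> ab(2)] by blast
  obtain p q where pq: "\<And>u. lb u = la u + p * of_int (pr u a) + q * of_int (pr u b)"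
    using E_edge[OF e ab la lb] by blast
  have in_W: "a \<in> W" "b \<in> W" using ab by (auto simp: E)
  show ?thesis
  proof (rule that[of "\<lambda>u. la u - (- p) * of_int (pr u a)"])
    show "addit (\<lambda>u. la u - (- p) * of_int (pr u a))" by (rule addit_minus_pr[OF la(1)])
    fix s w assume s: "s \<in> S" "w \<in> {a, b}" "pr s w < pr R w"
    have "0 \<le> pr s a" "0 \<le> pr s b" using s in_W by (auto simp: lat_cone_def)
    then have "w = a \<and> pr s a = 0 \<or> w = b \<and> pr s b = 0" using s 1 by auto
    then show "\<gamma> s = la s - (- p) * of_int (pr s a)"
      using la(2)[of s] lb(2)[of s] s pq[of s] by auto
  qed
qed

lemma triv_empty: "E = {} \<Longrightarrow> triv R \<gamma>"
  by (rule triv_E_I[of "\<lambda>s. 0"]) (auto simp: addit_def)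

lemma triv_vertex:
  assumes "locadd R \<gamma>" "E = {a}" shows "triv R \<gamma>"
proof -
  obtain l where "addit l" "\<And>s. s \<in> S \<Longrightarrow> pr s a < pr R a \<Longrightarrow> \<gamma> s = l s"
    using E_linear[of \<gamma> a] assms by blast
  moreover have "pr R a = 1" using assms(2) E by auto
  ultimately show ?thesis using assms(2) by (intro triv_E_I[of l]) simp_all
qed

lemma triv_edge:
  assumes "locadd R \<gamma>" "E = {a, b}" "edge W a b" shows "triv R \<gamma>"
proof -
  obtain l where l: "addit l" "\<And>s w. s \<in> S \<Longrightarrow> w \<in> {a, b} \<Longrightarrow> pr s w < pr R w \<Longrightarrow> \<gamma> s = l s"
    using E_edge_common[OF assms(3), of \<gamma>] assms by blast
  have 1: "pr R a = 1" "pr R b = 1" using assms(2) E by auto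
  show ?thesis
  proof (rule triv_E_I[OF l(1)])
    fix s w assume "s \<in> S" "w \<in> E" "pr s w = 0"
    then show "\<gamma> s = l s" using l(2)[of s w] assms(2) 1 by auto
  qed
qed

text \<open>One linear function serves at \<open>a\<close> and \<open>b\<close>. The function at
  \<open>c\<close> differs from it by evaluations at \<open>a\<close> and \<open>c\<close>, but also
  by evaluations at \<open>b\<close> and \<open>c\<close>. Among the three vertices \<open>x\<close>
  is nonzero at \<open>a\<close> only, which kills the coefficient at \<open>a\<close>; the
  evaluation at \<open>c\<close> vanishes on the piece there.\<close>

lemma triv_triangle:
  assumes \<gamma>: "locadd R \<gamma>" and abc: "E = {a, b, c}" and e: "edge W a b" "edge W a c" "edge W b c"
    and x: "pr x a \<noteq> 0" "pr x b = 0" "pr x c = 0"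
  shows "triv R \<gamma>"
proof -
  have 1: "pr R a = 1" "pr R b = 1" "pr R c = 1" using abc E by auto
  obtain l where l: "addit l" "\<And>s w. s \<in> S \<Longrightarrow> w \<in> {a, b} \<Longrightarrow> pr s w < pr R w \<Longrightarrow> \<gamma> s = l s"
    using E_edge_common[OF e(1), of \<gamma>] assms by blast
  have la: "\<And>s. s \<in> S \<Longrightarrow> pr s a < pr R a \<Longrightarrow> \<gamma> s = l s" and lb: "\<And>s. s \<in> S \<Longrightarrow> pr s b < pr R b \<Longrightarrow> \<gamma> s = l s"
    using l(2) by blast+
  obtain lc where lc: "addit lc" "\<And>s. s \<in> S \<Longrightarrow> pr s c < pr R c \<Longrightarrow> \<gamma> s = lc s"
    using E_linear[OF \<gamma>, of c] abc by blast
  obtain p q where pq: "\<And>u. lc u = l u + p * of_int (pr u a) + q * of_int (pr u c)"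
    using E_edge[OF e(2) _ _ l(1) la lc] abc by blast
  obtain p' q' where pq': "\<And>u. lc u = l u + p' * of_int (pr u b) + q' * of_int (pr u c)"
    using E_edge[OF e(3) _ _ l(1) lb lc] abc by blast
  have "p = 0" using pq[of x] pq'[of x] x by simp
  then have lc0: "lc u = l u" if "pr u c = 0" for u using pq[of u] that by simp
  show ?thesis
  proof (rule triv_E_I[OF l(1)])
    fix s w assume "s \<in> S" "w \<in> E" "pr s w = 0"
    then show "\<gamma> s = l s" using l(2)[of s w] lc(2)[of s] lc0[of s] abc 1 by auto
  qed
qed

text \<open>With one linear function at \<open>a\<close> and \<open>b\<close>, the functions at
  \<open>c\<close> and \<open>d\<close> exceed it by \<open>p\<close> times the evaluation at
  \<open>b\<close> and \<open>p'\<close> times the one at \<open>a\<close>, up to terms that vanish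
  on the pieces. Comparison along \<open>cd\<close> gives \<open>p = p'\<close>. By the
  parallelogram relation the minimum is the evaluation at \<open>b\<close> on the piece at
  \<open>c\<close>, the one at \<open>a\<close> on the piece at \<open>d\<close>, and 0 on the other
  two.\<close>

lemma square_span:
  assumes \<gamma>: "locadd R \<gamma>" and abcd: "E = {a, b, c, d}"
    and e: "edge W a b" "edge W b c" "edge W c d" "edge W a d"
    and par: "\<And>u. pr u a + pr u c = pr u b + pr u d"
    and x: "pr x a \<noteq> 0" "pr x c = 0" "pr x d = 0"
  shows "\<exists>p. triv R (\<lambda>s. \<gamma> s - p * of_int (min (pr s a) (pr s b)))"
proof -
  have 1: "pr R a = 1" "pr R b = 1" "pr R c = 1" "pr R d = 1" using abcd E by auto
  obtain l where l: "addit l" "\<And>s w. s \<in> S \<Longrightarrow> w \<in> {a, b} \<Longrightarrow> pr s w < pr R w \<Longrightarrow> \<gamma> s = l s"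
    using E_edge_common[OF e(1), of \<gamma>] assms by blast
  have la: "\<And>s. s \<in> S \<Longrightarrow> pr s a < pr R a \<Longrightarrow> \<gamma> s = l s" and lb: "\<And>s. s \<in> S \<Longrightarrow> pr s b < pr R b \<Longrightarrow> \<gamma> s = l s"
    using l(2) by blast+
  obtain lc where lc: "addit lc" "\<And>s. s \<in> S \<Longrightarrow> pr s c < pr R c \<Longrightarrow> \<gamma> s = lc s"
    using E_linear[OF \<gamma>, of c] abcd by blast
  obtain ld where ld: "addit ld" "\<And>s. s \<in> S \<Longrightarrow> pr s d < pr R d \<Longrightarrow> \<gamma> s = ld s"
    using E_linear[OF \<gamma>, of d] abcd by blast
  obtain p q where pq: "\<And>u. lc u = l u + p * of_int (pr u b) + q * of_int (pr u c)"
    using E_edge[OF e(2) _ _ l(1) lb lc] abcd by blast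
  obtain p' q' where pq': "\<And>u. ld u = l u + p' * of_int (pr u a) + q' * of_int (pr u d)"
    using E_edge[OF e(4) _ _ l(1) la ld] abcd by blast
  obtain p2 q2 where pq2: "\<And>u. ld u = lc u + p2 * of_int (pr u c) + q2 * of_int (pr u d)"
    using E_edge[OF e(3) _ _ lc ld] abcd by blast
  have p: "p' = p" using pq[of x] pq'[of x] pq2[of x] par[of x] x by simp
  show ?thesis
  proof (intro exI triv_E_I[OF l(1)])
    fix s w assume s: "s \<in> S" "w \<in> E" "pr s w = 0"
    have pos: "0 \<le> pr s a" "0 \<le> pr s b" "0 \<le> pr s c" "0 \<le> pr s d" using s abcd E by (auto simp: lat_cone_def)
    consider "w = a \<or> w = b" | "w = c" | "w = d" using s abcd by blast
    then show "\<gamma> s - p * of_int (min (pr s a) (pr s b)) = l s"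
    proof cases
      case 1
      then show ?thesis using l(2)[of s w] s pos \<open>pr R a = 1\<close> \<open>pr R b = 1\<close> by (auto simp: min_def)
    next
      case 2
      then show ?thesis using lc(2)[of s] s pos \<open>pr R c = 1\<close> pq[of s] par[of s] by (auto simp: min_def)
    next
      case 3
      then show ?thesis using ld(2)[of s] s pos \<open>pr R d = 1\<close> pq'[of s] par[of s] p by (auto simp: min_def)
    qed
  qed
qed

text \<open>If a sum vanishes at a vertex, so do both summands, and on the elements vanishing at one
  of the four vertices the minimum is linear.\<close>

lemma square_locadd:
  assumes abcd: "E = {a, b, c, d}" and par: "\<And>u. pr u a + pr u c = pr u b + pr u d"
  shows "locadd R (\<lambda>s. of_int (min (pr s a) (pr s b)))"
  unfolding locadd_def diff_notin_iff
proof (intro ballI impI)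
  fix s t assume s: "s \<in> S" "t \<in> S" and "\<exists>w\<in>W. pr (s + t) w < pr R w"
  then obtain w where w: "w \<in> W" "pr (s + t) w < pr R w" by blast
  have pos: "0 \<le> pr s v \<and> 0 \<le> pr t v" if "v \<in> W" for v using s that by (auto simp: lat_cone_def)
  have "pr R w = 1" "pr s w = 0" "pr t w = 0" using w pos[of w] R[of w] by auto
  then have "w \<in> {a, b, c, d}" using w abcd E by auto
  moreover have "a \<in> W" "b \<in> W" "c \<in> W" "d \<in> W" using abcd E by auto
  ultimately show "of_int (min (pr (s + t) a) (pr (s + t) b)) = (of_int (min (pr s a) (pr s b)) + of_int (min (pr t a) (pr t b)) :: complex)"
    using pos[of a] pos[of b] pos[of c] pos[of d] par[of s] par[of t] \<open>pr s w = 0\<close> \<open>pr t w = 0\<close>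
    by (auto simp: min_def simp flip: of_int_add)
qed

text \<open>\<open>P\<close> vanishes on the side \<open>ad\<close>, \<open>Q\<close> on the side
  \<open>ab\<close>. Each of them has a complement to \<open>x\<close> times \<open>R_star\<close>,
  so the two pairs have the same sum, and all four vanish at a vertex of \<open>E\<close>, where an
  additive \<open>l\<close> would have to agree with the minimum. But the minima are 0 and 0 for the
  first pair, 0 and \<open>x\<close> for the second.\<close>

lemma square_not_triv:
  assumes abcd: "E = {a, b, c, d}"
    and P: "pr P a = 0" "pr P b = x" "pr P c = x" "pr P d = 0"
    and Q: "pr Q a = 0" "pr Q b = 0" "pr Q c = x" "pr Q d = x" and x: "0 < x"
  shows "\<not> triv R (\<lambda>s. of_int (min (pr s a) (pr s b)))"
proof
  assume "triv R (\<lambda>s. of_int (min (pr s a) (pr s b)))"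
  then obtain l where l: "\<And>s t. s \<in> S \<Longrightarrow> t \<in> S \<Longrightarrow> l (s + t) = l s + (l t :: complex)"
    "\<And>s w. s \<in> S \<Longrightarrow> w \<in> W \<Longrightarrow> pr s w < pr R w \<Longrightarrow> of_int (min (pr s a) (pr s b)) = l s"
    unfolding triv_def diff_notin_iff by blast
  \<comment> \<open>On the vertices this functional vanishes exactly at \<open>E\<close> and is
    positive elsewhere, so its multiples bring the four functionals into S without changing their
    values on \<open>E\<close>.\<close>
  define u where "u = R_star - R"
  have u: "pr u w = 0" if "w \<in> E" for w using that by (simp add: u_def E)
  have u1: "0 < pr u w" if "w \<in> W - E" for w using that R[of w] by (auto simp: u_def E)
  have in_E: "a \<in> E" "b \<in> E" "c \<in> E" "d \<in> E" using abcd by auto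
  have absorb': "\<exists>N::nat. y + mlat_scale (int N) u \<in> S" if "\<And>w. w \<in> E \<Longrightarrow> 0 \<le> pr y w" for y
    using absorb[of E y u] that u u1 by (metis order_refl)
  let ?P' = "mlat_scale x R_star - P" and ?Q' = "mlat_scale x R_star - Q"
  obtain N1 N2 N3 N4 :: nat where N: "P + mlat_scale (int N1) u \<in> S" "?P' + mlat_scale (int N2) u \<in> S"
    "Q + mlat_scale (int N3) u \<in> S" "?Q' + mlat_scale (int N4) u \<in> S"
  proof -
    have "0 \<le> pr P w" "0 \<le> pr ?P' w" "0 \<le> pr Q w" "0 \<le> pr ?Q' w" if "w \<in> E" for w
      using that P Q x abcd by auto
    then show ?thesis using absorb' that by meson
  qed
  define N where "N = N1 + N2 + N3 + N4"
  have uS: "u \<in> S" using u u1 by (force simp: lat_cone_def)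
  have up: "y + mlat_scale (int N) u \<in> S" if "y + mlat_scale (int m) u \<in> S" "m \<le> N" for y m
  proof -
    have "int N = int m + int (N - m)" using that by simp
    then have "y + mlat_scale (int N) u = (y + mlat_scale (int m) u) + mlat_scale (int (N - m)) u"
      by (simp only: mlat_scale_simps add.assoc)
    then show ?thesis using that uS by (metis add_S scale_S of_nat_0_le_iff)
  qed
  have NS: "P + mlat_scale (int N) u \<in> S" "?P' + mlat_scale (int N) u \<in> S"
    "Q + mlat_scale (int N) u \<in> S" "?Q' + mlat_scale (int N) u \<in> S"
    by (rule up[OF N(1)] up[OF N(2)] up[OF N(3)] up[OF N(4)], simp add: N_def)+
  have val: "l s = of_int (min (pr s a) (pr s b))" if "s \<in> S" "w \<in> E" "pr s w = 0" for s w
    using l(2)[of s w] that by (simp add: E)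
  have "l (P + mlat_scale (int N) u) = 0" using val[OF NS(1) in_E(1)] P x u in_E by simp
  moreover have "l (?P' + mlat_scale (int N) u) = 0" using val[OF NS(2) in_E(2)] P x u in_E by simp
  moreover have "l (Q + mlat_scale (int N) u) = 0" using val[OF NS(3) in_E(1)] Q x u in_E by simp
  moreover have "l (?Q' + mlat_scale (int N) u) = of_int x" using val[OF NS(4) in_E(3)] Q x u in_E by simp
  moreover have "(P + mlat_scale (int N) u) + (?P' + mlat_scale (int N) u) = (Q + mlat_scale (int N) u) + (?Q' + mlat_scale (int N) u)"
    by (simp add: algebra_simps)
  ultimately have "of_int x = (0 :: complex)" using l(1)[OF NS(1,2)] l(1)[OF NS(3,4)] by simp
  then show False using x by simp
qed

end

end

section \<open>The lattice splits and the torus separates degrees\<close>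

text \<open>Integral powers of 2 in a single coordinate define a torus element, and they are
  injective in the exponent.\<close>

lemma torus_separates:
  fixes a b :: "'n::finite mlat"
  assumes "a \<noteq> b"
  shows "\<exists>t\<in>torus. t a \<noteq> t b"
proof -
  have inj: "m = n" if "(2::complex) powi m = 2 powi n" for m n
  proof -
    have "complex_of_real (2 powi m) = complex_of_real (2 powi n)" using that by (simp add: of_real_power_int)
    then have "(2::real) powi m = 2 powi n" by (simp only: of_real_eq_iff)
    then show ?thesis using power_int_strict_increasing[of m n "2::real"] power_int_strict_increasing[of n m "2::real"]
      by (cases m n rule: linorder_cases) auto
  qed
  show ?thesis
  proof (cases "snd a = snd b")
    case False
    have "(\<lambda>u :: 'n mlat. (2::complex) powi snd u) \<in> torus"
      by (simp add: torus_def power_int_add)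
    then show ?thesis by (rule bexI[rotated]) (use False inj[of "snd a" "snd b"] in auto)
  next
    case True
    then obtain i where i: "fst a $ i \<noteq> fst b $ i" using assms by (auto simp: prod_eq_iff vec_eq_iff)
    have "(\<lambda>u :: 'n mlat. (2::complex) powi (fst u $ i)) \<in> torus"
      by (simp add: torus_def power_int_add)
    then show ?thesis by (rule bexI[rotated]) (use i inj[of "fst a $ i" "fst b $ i"] in auto)
  qed
qed

lemma chi_power: "chi s ^ n = chi (mlat_scale (int n) s)"
  by (induction n) (simp_all add: mlat_scale_simps(3) mlat_scale_nat chi_mult del: of_nat_Suc)

lemma chi_prod: "finite I \<Longrightarrow> (\<Prod>i\<in>I. chi (f i)) = chi (\<Sum>i\<in>I. f i :: 'k::ab_group_add)"
  by (induction I rule: finite_induct) (simp_all add: chi_mult)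

lemma power_nat_exchange:
  "x ^ nat a * x ^ nat b * x ^ nat (- (a + b)) = x ^ nat (- a) * x ^ nat (- b) * (x::'a::comm_monoid_mult) ^ nat (a + b)"
proof -
  have "nat a + nat b + nat (- (a + b)) = nat (- a) + nat (- b) + nat (a + b)" by linarith
  then show ?thesis by (metis power_add)
qed

text \<open>A lattice basis inside S is obtained by lifting the unit vectors far enough in the last
  coordinate and adding \<open>R_star\<close>. The two monomials of \<open>u\<close> collect the
  positive and the negative coordinates in this basis.\<close>

lemma lattice_split:
  fixes W :: "(int ^ 'n::finite) set"
  assumes "finite W"
  shows "\<exists>Yp Yn \<beta>. \<forall>u. Yp u \<in> P0 (monoid_algebra (lat_cone W)) \<and> Yn u \<in> P0 (monoid_algebra (lat_cone W)) \<and>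
    counit (Yn u) = chi (\<beta> u) \<and> counit (Yp u) = chi (u + \<beta> u) \<and>
    (\<forall>v. Yp u * Yp v * Yn (u + v) = Yn u * Yn v * Yp (u + v))"
proof -
  \<comment> \<open>Bounds the absolute value of every coordinate of every point of
    \<open>W\<close>, so that \<open>(axis i 1, K)\<close> is nonnegative on
    \<open>W\<close>.\<close>
  define K where "K = (\<Sum>w\<in>W. \<Sum>i\<in>UNIV. \<bar>w $ i\<bar>)"
  define b :: "'n \<Rightarrow> 'n mlat" where "b i = (axis i 1, K)" for i
  have bS: "b i \<in> lat_cone W" for i
    unfolding lat_cone_def
  proof (intro CollectI ballI)
    fix w assume w: "w \<in> W"
    have "\<bar>w $ i\<bar> \<le> (\<Sum>i\<in>UNIV. \<bar>w $ i\<bar>)" by (rule member_le_sum) auto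
    also have "\<dots> \<le> K" unfolding K_def using w assms by (intro member_le_sum) (auto simp: sum_nonneg)
    finally show "0 \<le> pr (b i) w"
      by (simp add: b_def pr_def axis_def if_distrib[of "\<lambda>x. x * _"] cong: if_cong)
  qed
  have RS: "R_star \<in> lat_cone W" by (simp add: lat_cone_def)
  define c where "c u = snd u - K * (\<Sum>i\<in>UNIV. fst u $ i)" for u :: "'n mlat"
  have cadd: "c (u + v) = c u + c v" for u v
    by (simp add: c_def sum.distrib algebra_simps)
  have expand: "u = (\<Sum>i\<in>UNIV. mlat_scale (fst u $ i) (b i)) + mlat_scale (c u) R_star" for u
    by (simp add: prod_eq_iff vec_eq_iff fst_sum snd_sum mlat_scale_def b_def R_star_def c_def axis_def
      if_distrib[of "\<lambda>x. _ * x"] sum_distrib_left mult.commute cong: if_cong)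
  define Y where "Y n k = (\<Prod>i\<in>UNIV. pvar (chi (b i)) ^ n i) * pvar (chi R_star) ^ k" for n :: "'n \<Rightarrow> nat" and k :: nat
  define Yp where "Yp u = Y (\<lambda>i. nat (fst u $ i)) (nat (c u))" for u
  define Yn where "Yn u = Y (\<lambda>i. nat (- (fst u $ i))) (nat (- c u))" for u
  define wt where "wt n k = (\<Sum>i\<in>UNIV. mlat_scale (int (n i)) (b i)) + mlat_scale (int k) R_star" for n :: "'n \<Rightarrow> nat" and k :: nat
  have Yin: "Y n k \<in> P0 (monoid_algebra (lat_cone W))" for n k
    unfolding Y_def P0_def using bS RS
    by (intro free_alg_closed free_alg_prod free_alg_power free_alg_pvar) (auto simp: monoid_algebra_def)
  have Yc: "counit (Y n k) = chi (wt n k)" for n k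
    by (simp add: Y_def wt_def ring_homD[OF ring_hom_counit] ring_hom_prod[OF ring_hom_counit] chi_power chi_prod chi_mult)
  have wt: "wt (\<lambda>i. nat (fst u $ i)) (nat (c u)) = u + wt (\<lambda>i. nat (- (fst u $ i))) (nat (- c u))" for u
  proof -
    have n: "mlat_scale (int (nat z)) s = mlat_scale z s + mlat_scale (int (nat (- z))) s" for z and s :: "'n mlat"
      by (simp flip: mlat_scale_simps(1))
    have "wt (\<lambda>i. nat (fst u $ i)) (nat (c u)) = ((\<Sum>i\<in>UNIV. mlat_scale (fst u $ i) (b i)) + mlat_scale (c u) R_star)
        + wt (\<lambda>i. nat (- (fst u $ i))) (nat (- c u))"
      unfolding wt_def n[of "c u"] n[of "fst u $ _"] sum.distrib by (simp add: algebra_simps)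
    then show ?thesis by (simp flip: expand)
  qed
  have YY: "Yp u * Yp v * Yn (u + v) = Yn u * Yn v * Yp (u + v)" for u v
  proof -
    have "Yp u * Yp v * Yn (u + v) =
      (\<Prod>i\<in>UNIV. pvar (chi (b i)) ^ nat (fst u $ i) * pvar (chi (b i)) ^ nat (fst v $ i) * pvar (chi (b i)) ^ nat (- (fst u $ i + fst v $ i)))
      * (pvar (chi R_star) ^ nat (c u) * pvar (chi R_star) ^ nat (c v) * pvar (chi R_star) ^ nat (- (c u + c v)))"
      by (simp add: Yp_def Yn_def Y_def prod.distrib cadd mult_ac)
    also have "\<dots> = (\<Prod>i\<in>UNIV. pvar (chi (b i)) ^ nat (- (fst u $ i)) * pvar (chi (b i)) ^ nat (- (fst v $ i)) * pvar (chi (b i)) ^ nat (fst u $ i + fst v $ i))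
      * (pvar (chi R_star) ^ nat (- c u) * pvar (chi R_star) ^ nat (- c v) * pvar (chi R_star) ^ nat (c u + c v))"
      by (simp only: power_nat_exchange)
    also have "\<dots> = Yn u * Yn v * Yp (u + v)"
      by (simp add: Yp_def Yn_def Y_def prod.distrib cadd mult_ac)
    finally show ?thesis .
  qed
  show ?thesis
    by (rule exI[of _ Yp], rule exI[of _ Yn], rule exI[of _ "\<lambda>u. wt (\<lambda>i. nat (- (fst u $ i))) (nat (- c u))"])
      (use YY in \<open>simp add: Yp_def Yn_def Yin Yc wt\<close>)
qed

context lattice_cone
begin

sublocale graded_alg S
  by unfold_locales (rule lattice_split[OF fin] test_set_ex torus_separates, assumption?)+

end

section \<open>Exposed subsets of a finite point set\<close>

text \<open>Faces of the hull are handled through the points of \<open>V\<close> on them. The case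
  \<open>E = V\<close> is included, by the zero functional.\<close>

definition exposed :: "'a::real_inner set \<Rightarrow> 'a set \<Rightarrow> bool" where
  "exposed V E \<longleftrightarrow> E \<subseteq> V \<and> (\<exists>a \<beta>. \<forall>v\<in>V. \<beta> \<le> a \<bullet> v \<and> (a \<bullet> v = \<beta> \<longleftrightarrow> v \<in> E))"

text \<open>If \<open>a\<close> exposes \<open>E\<close> in \<open>V\<close> and \<open>a'\<close> exposes \<open>E'\<close> in \<open>E\<close>, then \<open>N a + a'\<close> exposes \<open>E'\<close> in \<open>V\<close> for large \<open>N\<close>.\<close>

lemma exposed_trans:
  assumes "finite V" "exposed V E" "exposed E E'"
  shows "exposed V E'"
proof -
  obtain a \<beta> where a: "E \<subseteq> V" "\<And>v. v \<in> V \<Longrightarrow> \<beta> \<le> a \<bullet> v" "\<And>v. v \<in> V \<Longrightarrow> a \<bullet> v = \<beta> \<longleftrightarrow> v \<in> E"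
    using assms(2) unfolding exposed_def by blast
  obtain a' \<beta>' where a': "E' \<subseteq> E" "\<And>v. v \<in> E \<Longrightarrow> \<beta>' \<le> a' \<bullet> v" "\<And>v. v \<in> E \<Longrightarrow> a' \<bullet> v = \<beta>' \<longleftrightarrow> v \<in> E'"
    using assms(3) unfolding exposed_def by blast
  define q where "q v = (\<bar>a' \<bullet> v - \<beta>'\<bar> + 1) / (a \<bullet> v - \<beta>)" for v
  define N where "N = (\<Sum>v\<in>V. q v)"
  have q0: "0 \<le> q v" if "v \<in> V" for v using a(2)[OF that] by (simp add: q_def)
  have N: "(N *\<^sub>R a + a') \<bullet> v > N * \<beta> + \<beta>'" if v: "v \<in> V" "v \<notin> E" for v
  proof -
    have pos: "0 < a \<bullet> v - \<beta>" using a(2,3)[OF v(1)] v(2) by (simp add: less_le)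
    have "q v \<le> N" unfolding N_def using v(1) q0 assms(1) by (intro member_le_sum) auto
    then have "\<bar>a' \<bullet> v - \<beta>'\<bar> + 1 \<le> N * (a \<bullet> v - \<beta>)" using pos by (simp add: q_def pos_divide_le_eq)
    then show ?thesis by (simp add: inner_add_left algebra_simps)
  qed
  have on_E: "(N *\<^sub>R a + a') \<bullet> v = N * \<beta> + a' \<bullet> v" if "v \<in> E" for v
    using a(1,3) that by (auto simp: inner_add_left)
  show ?thesis
    unfolding exposed_def
  proof (intro conjI exI ballI)
    show "E' \<subseteq> V" using a a' by blast
    fix v assume "v \<in> V"
    show "N * \<beta> + \<beta>' \<le> (N *\<^sub>R a + a') \<bullet> v" using N[OF \<open>v \<in> V\<close>] on_E a'(2) by (cases "v \<in> E") (auto intro: less_imp_le)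
    show "(N *\<^sub>R a + a') \<bullet> v = N * \<beta> + \<beta>' \<longleftrightarrow> v \<in> E'"
      using N[OF \<open>v \<in> V\<close>] on_E[of v] a'(1) a'(3)[of v] by (cases "v \<in> E") auto
  qed
qed

text \<open>On \<open>V\<close> the functional \<open>M s - d\<close> is minimal at
  \<open>i\<close>, and takes the same value exactly at the points where the bound on the slope is
  attained.\<close>

lemma exposed_ratio:
  assumes "finite V" "i \<in> V" and s: "\<And>w. w \<in> V - {i} \<Longrightarrow> 0 < s \<bullet> (w - i)"
    and M: "\<And>w. w \<in> V - {i} \<Longrightarrow> d \<bullet> (w - i) \<le> M * (s \<bullet> (w - i))"
  shows "exposed V (insert i {w \<in> V - {i}. d \<bullet> (w - i) = M * (s \<bullet> (w - i))})"
  unfolding exposed_def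
proof (intro conjI exI ballI)
  fix v assume v: "v \<in> V"
  show "(M *\<^sub>R s - d) \<bullet> i \<le> (M *\<^sub>R s - d) \<bullet> v"
    using M[of v] v by (cases "v = i") (auto simp: algebra_simps inner_diff_left inner_diff_right)
  show "(M *\<^sub>R s - d) \<bullet> v = (M *\<^sub>R s - d) \<bullet> i \<longleftrightarrow> v \<in> insert i {w \<in> V - {i}. d \<bullet> (w - i) = M * (s \<bullet> (w - i))}"
    using v by (auto simp: algebra_simps inner_diff_left inner_diff_right)
qed (use assms(2) in auto)

lemma exposed_max_ratio:
  assumes "finite V" "i \<in> V" "V \<noteq> {i}" and s: "\<And>w. w \<in> V - {i} \<Longrightarrow> 0 < s \<bullet> (w - i)"
  obtains M where "\<And>w. w \<in> V - {i} \<Longrightarrow> d \<bullet> (w - i) \<le> M * (s \<bullet> (w - i))"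
    "\<exists>w\<in>V - {i}. d \<bullet> (w - i) = M * (s \<bullet> (w - i))"
    "exposed V (insert i {w \<in> V - {i}. d \<bullet> (w - i) = M * (s \<bullet> (w - i))})"
proof -
  define q where "q w = d \<bullet> (w - i) / (s \<bullet> (w - i))" for w
  define M where "M = Max (q ` (V - {i}))"
  have ne: "V - {i} \<noteq> {}" using assms by auto
  have q: "d \<bullet> (w - i) = q w * (s \<bullet> (w - i))" if "w \<in> V - {i}" for w
    using s[OF that] by (simp add: q_def)
  have le: "q w \<le> M" if "w \<in> V - {i}" for w
    unfolding M_def using that assms(1) by (intro Max_ge) auto
  have "M \<in> q ` (V - {i})" unfolding M_def using ne assms(1) by (intro Max_in) auto
  then have ex: "\<exists>w\<in>V - {i}. d \<bullet> (w - i) = M * (s \<bullet> (w - i))" using q by auto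
  have bound: "d \<bullet> (w - i) \<le> M * (s \<bullet> (w - i))" if "w \<in> V - {i}" for w
    unfolding q[OF that] using le[OF that] s[OF that] by (intro mult_right_mono) auto
  show ?thesis by (rule that[OF bound ex exposed_ratio[OF assms(1,2) s bound]])
qed

lemma exposed_not_between:
  assumes "exposed V {j}" "i \<in> V" "k \<in> V" "i \<noteq> j" "k \<noteq> j" "0 \<le> t" "t \<le> 1" "j = (1 - t) *\<^sub>R i + t *\<^sub>R k"
  shows False
proof -
  obtain a \<beta> where a: "\<And>v. v \<in> V \<Longrightarrow> \<beta> \<le> a \<bullet> v" "\<And>v. v \<in> V \<Longrightarrow> a \<bullet> v = \<beta> \<longleftrightarrow> v \<in> {j}" "j \<in> V"
    using assms(1) unfolding exposed_def by blast
  have i: "0 < a \<bullet> i - \<beta>" using a(1)[OF assms(2)] a(2)[OF assms(2)] assms(4) by auto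
  have k: "0 < a \<bullet> k - \<beta>" using a(1)[OF assms(3)] a(2)[OF assms(3)] assms(5) by auto
  have "a \<bullet> j = (1 - t) * (a \<bullet> i) + t * (a \<bullet> k)"
    by (subst assms(8)) (simp add: inner_add_right)
  moreover have "a \<bullet> j = \<beta>" using a by auto
  ultimately have "(1 - t) * (a \<bullet> i - \<beta>) + t * (a \<bullet> k - \<beta>) = 0" by (simp add: algebra_simps)
  moreover have "0 < (1 - t) * (a \<bullet> i - \<beta>) + t * (a \<bullet> k - \<beta>)"
  proof (cases "t = 0")
    case False
    then show ?thesis using i k assms(6,7) by (intro add_nonneg_pos mult_nonneg_nonneg mult_pos_pos) auto
  qed (use i in simp)
  ultimately show False by simp
qed

text \<open>
  A vertex that does not maximise \<open>c\<close> lies on an edge along which \<open>c\<close> increases: the other vertices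
  of largest slope \<open>c / s\<close> span a face with the vertex, where \<open>s\<close> exposes it, and a smallest such
  face is an edge.
\<close>

lemma simplex_step:
  fixes V :: "'a::real_inner set"
  assumes fin: "finite V" and ex: "\<And>v. v \<in> V \<Longrightarrow> exposed V {v}"
    and ik: "i \<in> V" "k \<in> V" "c \<bullet> i < c \<bullet> k"
  obtains j where "j \<in> V" "j \<noteq> i" "exposed V {i, j}" "c \<bullet> i < c \<bullet> j"
proof -
  obtain s \<sigma> where s\<sigma>: "\<And>v. v \<in> V \<Longrightarrow> \<sigma> \<le> s \<bullet> v" "\<And>v. v \<in> V \<Longrightarrow> s \<bullet> v = \<sigma> \<longleftrightarrow> v \<in> {i}"
    using ex[OF ik(1)] unfolding exposed_def by blast
  have s: "0 < s \<bullet> (w - i)" if "w \<in> V - {i}" for w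
    using s\<sigma>(1)[of w] s\<sigma>(2)[of w] s\<sigma>(2)[of i] that ik(1) by (auto simp: inner_diff_right)
  have "V \<noteq> {i}" using ik by auto
  then obtain M where M: "\<And>w. w \<in> V - {i} \<Longrightarrow> c \<bullet> (w - i) \<le> M * (s \<bullet> (w - i))"
    "\<exists>w\<in>V - {i}. c \<bullet> (w - i) = M * (s \<bullet> (w - i))"
    "exposed V (insert i {w \<in> V - {i}. c \<bullet> (w - i) = M * (s \<bullet> (w - i))})"
    using exposed_max_ratio[OF fin ik(1) _ s, of c] by blast
  define E0 where "E0 = insert i {w \<in> V - {i}. c \<bullet> (w - i) = M * (s \<bullet> (w - i))}"
  have ki: "k \<in> V - {i}" using ik by auto
  have "0 < M * (s \<bullet> (k - i))" using M(1)[OF ki] ik(3) by (simp add: inner_diff_right)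
  then have M0: "0 < M" using s[OF ki] by (simp add: zero_less_mult_iff)
  have up: "c \<bullet> i < c \<bullet> j" if "j \<in> E0 - {i}" for j
  proof -
    have "c \<bullet> (j - i) = M * (s \<bullet> (j - i))" "j \<in> V - {i}" using that by (auto simp: E0_def)
    then have "0 < c \<bullet> (j - i)" using M0 s by simp
    then show ?thesis by (simp add: inner_diff_right)
  qed
  define good where "good E \<longleftrightarrow> exposed V E \<and> i \<in> E \<and> E \<subseteq> E0 \<and> E \<noteq> {i}" for E
  have "good E0" unfolding good_def using M(2,3) by (auto simp: E0_def)
  then obtain E where E: "good E" "\<And>E'. good E' \<Longrightarrow> card E \<le> card E'"
    using ex_has_least_nat[of good E0 card] by blast
  have EV: "E \<subseteq> V" "exposed V E" "i \<in> E" "E \<noteq> {i}" "E \<subseteq> E0" using E(1) by (auto simp: good_def exposed_def)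
  have finE: "finite E" using EV(1) fin finite_subset by blast
  obtain j where j: "j \<in> E - {i}" using EV by blast
  have "E = {i, j}"
  proof (rule ccontr)
    assume "E \<noteq> {i, j}"
    then obtain l where l: "l \<in> E - {i, j}" using j EV by blast
    have jV: "j \<in> V" and lV: "l \<in> V" using j l EV by auto
    define x y where "x = s \<bullet> (j - i)" and "y = s \<bullet> (l - i)"
    have xy: "0 < x" "0 < y" using s[of j] s[of l] j l EV by (auto simp: x_def y_def)
    \<comment> \<open>The slopes of \<open>d\<close> at \<open>j\<close> and \<open>l\<close> differ
      by \<open>d \<bullet> d\<close>. Unless \<open>d = 0\<close>, the points of \<open>E\<close>
      of largest slope with respect to \<open>d\<close> therefore form a smaller face with
      \<open>i\<close>.\<close>
    define d where "d = (1 / x) *\<^sub>R (j - i) - (1 / y) *\<^sub>R (l - i)"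
    show False
    proof (cases "d = 0")
      case False
      have "s \<bullet> (w - i) > 0" if "w \<in> E - {i}" for w using s that EV by blast
      then obtain M' where M': "\<And>w. w \<in> E - {i} \<Longrightarrow> d \<bullet> (w - i) \<le> M' * (s \<bullet> (w - i))"
        "\<exists>w\<in>E - {i}. d \<bullet> (w - i) = M' * (s \<bullet> (w - i))"
        "exposed E (insert i {w \<in> E - {i}. d \<bullet> (w - i) = M' * (s \<bullet> (w - i))})"
        using exposed_max_ratio[OF finE EV(3,4), of s d] by blast
      define E' where "E' = insert i {w \<in> E - {i}. d \<bullet> (w - i) = M' * (s \<bullet> (w - i))}"
      have "good E'" unfolding good_def
        using exposed_trans[OF fin EV(2) M'(3)] M'(2) EV by (auto simp: E'_def)
      then have "card E \<le> card E'" by (rule E(2))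
      moreover have "E' \<subseteq> E" using EV by (auto simp: E'_def)
      ultimately have "E' = E" using finE by (simp add: card_seteq)
      then have "d \<bullet> (j - i) = M' * x" "d \<bullet> (l - i) = M' * y" using j l by (auto simp: E'_def x_def y_def)
      then have "d \<bullet> d = 0" using xy by (subst (2) d_def) (simp add: inner_diff_right)
      then show False using False by simp
    next
      \<comment> \<open>Now \<open>j\<close> and \<open>l\<close> lie on one ray from
        \<open>i\<close>, and the nearer of them lies between two points of
        \<open>V\<close>.\<close>
      case True
      then have e: "(1 / x) *\<^sub>R (j - i) = (1 / y) *\<^sub>R (l - i)" by (simp add: d_def)
      show False
      proof (cases "x \<le> y")
        case True
        have "j - i = (x / y) *\<^sub>R (l - i)" using arg_cong[OF e, of "\<lambda>z. x *\<^sub>R z"] xy by simp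
        then have "j = (1 - x / y) *\<^sub>R i + (x / y) *\<^sub>R l" by (simp add: algebra_simps)
        then show False
          by (rule exposed_not_between[OF ex[OF jV] ik(1) lV, rotated 4]) (use j l True xy in auto)
      next
        case False
        have "l - i = (y / x) *\<^sub>R (j - i)" using arg_cong[OF e, of "\<lambda>z. y *\<^sub>R z"] xy by simp
        then have "l = (1 - y / x) *\<^sub>R i + (y / x) *\<^sub>R j" by (simp add: algebra_simps)
        then show False
          by (rule exposed_not_between[OF ex[OF lV] ik(1) jV, rotated 4]) (use j l False xy in auto)
      qed
    qed
  qed
  then show ?thesis using that[of j] j EV up by auto
qed

section \<open>Integral functionals\<close>

definition rv :: "int ^ 'n \<Rightarrow> real ^ 'n::finite" where
  "rv z = (\<chi> i. of_int (z $ i))"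

lemma rv_simps: "rv (a + b) = rv a + rv b" "rv (a - b) = rv a - rv b" "rv (- a) = - rv a" "rv 0 = 0"
  "rv (k *s a) = of_int k *\<^sub>R rv a" "rv z $ i = of_int (z $ i)"
  by (simp_all add: rv_def vec_eq_iff)

lemma rv_inject [simp]: "rv a = rv b \<longleftrightarrow> a = b"
  by (simp add: rv_def vec_eq_iff)

lemma inj_rv: "inj rv"
  by (simp add: inj_def)

lemma lattice_points_rv: "lattice_points = range rv"
proof (intro equalityI subsetI)
  fix x :: "real ^ 'n" assume "x \<in> lattice_points"
  then have "x = rv (\<chi> i. \<lfloor>x $ i\<rfloor>)"
    by (auto simp: lattice_points_def rv_def vec_eq_iff elim: Ints_cases)
  then show "x \<in> range rv" by blast
qed (auto simp: lattice_points_def rv_simps)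

lemma real_of_mlat_inner: "real_of_mlat s \<bullet> (v, 1) = rv (fst s) \<bullet> v + of_int (snd s)"
  by (simp add: real_of_mlat_def rv_def)

lemma phi_alt: "phi s v = rv (fst s) \<bullet> v + of_int (snd s)"
  by (simp add: phi_def real_of_mlat_inner)

lemma phi_rv: "phi s (rv w) = of_int (pr s w)"
  by (simp add: phi_alt pr_def rv_def inner_vec_def)

definition idot :: "int ^ 'n::finite \<Rightarrow> int ^ 'n \<Rightarrow> int" where
  "idot a b = (\<Sum>i\<in>UNIV. a $ i * b $ i)"

lemma rv_inner: "rv a \<bullet> rv b = of_int (idot a b)"
  by (simp add: idot_def rv_def inner_vec_def)

lemma pr_idot: "pr (m, b) w = idot m w + b"
  by (simp add: pr_def idot_def)

lemma idot_simps: "idot (a + b) c = idot a c + idot b c" "idot (a - b) c = idot a c - idot b c"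
  "idot a (b + c) = idot a b + idot a c" "idot a (b - c) = idot a b - idot a c" "idot (k *s a) b = k * idot a b"
  "idot a (k *s b) = k * idot a b" "idot (- a) b = - idot a b" "idot a (- b) = - idot a b"
  by (simp_all add: idot_def sum.distrib sum_subtractf sum_negf sum_distrib_left algebra_simps)

lemma idot_commute: "idot a b = idot b a"
  by (simp add: idot_def mult.commute)

lemma floor_approx:
  "(\<lambda>N. (1 / real N) *\<^sub>R rv (\<chi> i. \<lfloor>real N * x $ i\<rfloor>)) \<longlonglongrightarrow> (x :: real ^ 'n::finite)"
proof (rule vec_tendstoI)
  fix i
  have "(\<lambda>N. of_int \<lfloor>real N * (x $ i)\<rfloor> / real N) \<longlonglongrightarrow> x $ i" by real_asymp
  then show "(\<lambda>N. ((1 / real N) *\<^sub>R rv (\<chi> i. \<lfloor>real N * x $ i\<rfloor>)) $ i) \<longlonglongrightarrow> x $ i"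
    by (simp add: rv_simps)
qed

text \<open>
  Rounding a large multiple of \<open>x0\<close> and projecting by an integral map \<open>\<pi>\<close> onto the functionals that
  are constant on \<open>E\<close> makes an exposing functional integral.
\<close>

lemma integral_exposure:
  fixes \<pi> :: "real ^ 'n::finite \<Rightarrow> real ^ 'n"
  assumes fin: "finite W" and lin: "linear \<pi>" and int: "\<And>z. \<pi> (rv z) = rv (\<pi>' z)"
    and E: "\<And>x w. w \<in> E \<Longrightarrow> \<pi> x \<bullet> (rv w - rv w0) = 0"
    and pos: "\<And>w. w \<in> W - E \<Longrightarrow> 0 < \<pi> x0 \<bullet> (rv w - rv w0)"
  obtains \<sigma> where "\<And>w. w \<in> E \<Longrightarrow> pr \<sigma> w = 0" "\<And>w. w \<in> W - E \<Longrightarrow> 0 < pr \<sigma> w"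
proof -
  define z where "z N = (\<chi> i. \<lfloor>real N * x0 $ i\<rfloor>)" for N
  have "\<forall>\<^sub>F N in sequentially. 0 < \<pi> ((1 / real N) *\<^sub>R rv (z N)) \<bullet> (rv w - rv w0)" if "w \<in> W - E" for w
  proof -
    have "(\<lambda>N. \<pi> ((1 / real N) *\<^sub>R rv (z N)) \<bullet> (rv w - rv w0)) \<longlonglongrightarrow> \<pi> x0 \<bullet> (rv w - rv w0)"
      unfolding z_def
      by (intro tendsto_inner tendsto_const bounded_linear.tendsto[OF lin[unfolded linear_conv_bounded_linear]] floor_approx)
    then show ?thesis using pos[OF that] by (rule order_tendstoD)
  qed
  then have "\<forall>\<^sub>F N in sequentially. \<forall>w\<in>W - E. 0 < \<pi> ((1 / real N) *\<^sub>R rv (z N)) \<bullet> (rv w - rv w0)"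
    using fin by (intro eventually_ball_finite) auto
  then obtain N0 where N0: "\<And>N w. N0 \<le> N \<Longrightarrow> w \<in> W - E \<Longrightarrow> 0 < \<pi> ((1 / real N) *\<^sub>R rv (z N)) \<bullet> (rv w - rv w0)"
    unfolding eventually_sequentially by blast
  define N where "N = Suc N0"
  define \<sigma> where "\<sigma> = (\<pi>' (z N), - idot (\<pi>' (z N)) w0)"
  have pr: "of_int (pr \<sigma> w) = \<pi> (rv (z N)) \<bullet> (rv w - rv w0)" for w
    by (simp add: \<sigma>_def pr_idot int rv_inner inner_diff_right)
  show ?thesis
  proof (rule that)
    fix w assume "w \<in> E"
    then have "real_of_int (pr \<sigma> w) = 0" unfolding pr by (rule E)
    then show "pr \<sigma> w = 0" by simp
  next
    fix w assume "w \<in> W - E"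
    then have "0 < \<pi> ((1 / real N) *\<^sub>R rv (z N)) \<bullet> (rv w - rv w0)" by (intro N0) (simp add: N_def)
    also have "\<dots> = (1 / real N) * of_int (pr \<sigma> w)" unfolding pr by (simp add: linear_scale[OF lin])
    finally show "0 < pr \<sigma> w" by (simp add: zero_less_divide_iff N_def)
  qed
qed

lemma vertex_exposure:
  assumes "finite W" "exposed (rv ` W) {rv w0}"
  obtains \<sigma> where "pr \<sigma> w0 = 0" "\<And>w. w \<in> W - {w0} \<Longrightarrow> 0 < pr \<sigma> w"
proof -
  obtain a \<beta> where "\<forall>w\<in>W. \<beta> \<le> a \<bullet> rv w \<and> (a \<bullet> rv w = \<beta> \<longleftrightarrow> w = w0)" and w0: "w0 \<in> W"
    using assms(2) unfolding exposed_def by auto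
  then have a: "\<And>w. w \<in> W \<Longrightarrow> \<beta> \<le> a \<bullet> rv w" "\<And>w. w \<in> W \<Longrightarrow> a \<bullet> rv w = \<beta> \<longleftrightarrow> w = w0" "w0 \<in> W"
    by auto
  have "0 < a \<bullet> (rv w - rv w0)" if "w \<in> W - {w0}" for w
    using a(1,2)[of w] a(2)[of w0] a(3) that by (auto simp: inner_diff_right)
  then obtain \<sigma> where "\<And>w. w \<in> {w0} \<Longrightarrow> pr \<sigma> w = 0" "\<And>w. w \<in> W - {w0} \<Longrightarrow> 0 < pr \<sigma> w"
    using integral_exposure[OF assms(1), of "\<lambda>x. x" "\<lambda>z. z" "{w0}" w0 a] by (auto simp: linear_id[unfolded id_def])
  then show ?thesis using that by blast
qed

lemma edge_exposure:
  assumes "finite W" "exposed (rv ` W) {rv i, rv j}" "i \<noteq> j"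
  obtains \<sigma> where "pr \<sigma> i = 0" "pr \<sigma> j = 0" "\<And>w. w \<in> W - {i, j} \<Longrightarrow> 0 < pr \<sigma> w"
proof -
  obtain a \<beta> where "\<forall>w\<in>W. \<beta> \<le> a \<bullet> rv w \<and> (a \<bullet> rv w = \<beta> \<longleftrightarrow> w = i \<or> w = j)" and "i \<in> W" "j \<in> W"
    using assms(2) unfolding exposed_def by auto
  then have a: "\<And>w. w \<in> W \<Longrightarrow> \<beta> \<le> a \<bullet> rv w" "\<And>w. w \<in> W \<Longrightarrow> a \<bullet> rv w = \<beta> \<longleftrightarrow> w = i \<or> w = j" "i \<in> W" "j \<in> W"
    by auto
  define d where "d = j - i"
  have d0: "0 < idot d d"
  proof -
    have "0 < rv d \<bullet> rv d" using assms(3) rv_inject[of d 0] by (simp add: d_def rv_simps)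
    then show ?thesis unfolding rv_inner by simp
  qed
  let ?\<pi> = "\<lambda>x. of_int (idot d d) *\<^sub>R x - (x \<bullet> rv d) *\<^sub>R rv d"
  let ?\<pi>' = "\<lambda>z. idot d d *s z - idot z d *s d"
  have ad: "a \<bullet> rv d = 0" using a(2)[of i] a(2)[of j] a(3,4) by (simp add: d_def rv_simps inner_diff_right)
  have lin: "linear ?\<pi>"
    by (intro linearI) (simp_all add: algebra_simps inner_add_left)
  have int: "?\<pi> (rv z) = rv (?\<pi>' z)" for z by (simp add: rv_simps rv_inner)
  have E: "?\<pi> x \<bullet> (rv w - rv i) = 0" if "w \<in> {i, j}" for x w
    using that by (auto simp: inner_diff_left d_def rv_inner[symmetric] rv_simps)
  have pos: "0 < ?\<pi> a \<bullet> (rv w - rv i)" if "w \<in> W - {i, j}" for w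
    using a(1,2)[of w] a(2)[of i] a(3) that d0 by (auto simp: inner_diff_right ad simp flip: right_diff_distrib)
  obtain \<sigma> where "\<And>w. w \<in> {i, j} \<Longrightarrow> pr \<sigma> w = 0" "\<And>w. w \<in> W - {i, j} \<Longrightarrow> 0 < pr \<sigma> w"
    using integral_exposure[OF assms(1) lin int E pos] by blast
  then show ?thesis using that by blast
qed

text \<open>Bezout: the least positive value of \<open>idot _ d\<close> divides every coordinate of \<open>d\<close>.\<close>

lemma primitive_bezout:
  fixes d :: "int ^ 'n::finite"
  assumes "d \<noteq> 0" and prim: "\<And>k z. d = k *s z \<Longrightarrow> k = 1 \<or> k = - 1"
  obtains m where "idot m d = 1"
proof -
  let ?P = "\<lambda>n::nat. 0 < n \<and> (\<exists>m. idot m d = int n)"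
  have "0 < rv d \<bullet> rv d" using assms(1) rv_inject[of d 0] by (simp add: rv_simps)
  then have "?P (nat (idot d d))" unfolding rv_inner by auto
  then have P: "?P (LEAST n. ?P n)" by (rule LeastI)
  define g where "g = (LEAST n. ?P n)"
  obtain m where m: "0 < g" "idot m d = int g" using P unfolding g_def by blast
  have dvd: "int g dvd d $ i" for i
  proof -
    define r where "r = d $ i mod int g"
    have "idot (axis i 1 - (d $ i div int g) *s m) d = r"
      using m by (simp add: idot_simps r_def minus_div_mult_eq_mod) (simp add: idot_def axis_def if_distrib[of "\<lambda>x. x * _"] minus_div_mult_eq_mod cong: if_cong)
    moreover have "0 \<le> r" "r < int g" using m by (simp_all add: r_def)
    ultimately have "?P (nat r)" if "0 < r" using that by auto
    then have "r = 0" using \<open>0 \<le> r\<close> \<open>r < int g\<close> not_less_Least[of "nat r" ?P] by (fold g_def) (force simp: g_def)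
    then show ?thesis by (simp add: r_def dvd_eq_mod_eq_0)
  qed
  then have "d = int g *s (\<chi> i. d $ i div int g)" by (simp add: vec_eq_iff)
  then have "int g = 1 \<or> int g = - 1" by (rule prim)
  then show ?thesis using that[of m] m by auto
qed

section \<open>Empty lattice polytopes\<close>

locale empty_lattice_polytope =
  fixes P :: "(real ^ 'n::finite) set"
  assumes lattice: "lattice_polytope P" and full: "full_dimensional P" and empty: "empty_polytope P"
begin

text \<open>All lattice points of \<open>P\<close>. By emptiness they are exactly the vertices, so
  every lattice point constructed inside \<open>P\<close> is extreme; the contradictions below rest
  on this.\<close>

definition W :: "(int ^ 'n) set" where
  "W = {w. rv w \<in> P}"

lemma vertices_W: "vertices P = rv ` W"
proof -
  have "vertices P = P \<inter> range rv" using empty by (simp add: empty_polytope_def lattice_points_rv)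
  then show ?thesis by (auto simp: W_def)
qed

lemma polytope_P: "polytope P"
  using lattice by (simp add: lattice_polytope_def)

lemma convex_P: "convex P"
  by (rule polytope_imp_convex[OF polytope_P])

lemma finite_W: "finite W"
proof -
  have "finite (vertices P)"
    unfolding vertices_def by (intro finite_polyhedron_extreme_points polytope_imp_polyhedron polytope_P)
  then show ?thesis unfolding vertices_W using inj_rv finite_imageD inj_on_subset by blast
qed

lemma P_hull: "P = convex hull (rv ` W)"
  using Krein_Milman_Minkowski[OF polytope_imp_compact[OF polytope_P] convex_P]
  by (simp flip: vertices_W add: vertices_def)

lemma extreme_W: "w \<in> W \<Longrightarrow> rv w extreme_point_of P"
  using vertices_W by (auto simp: vertices_def)

lemma exposed_vertex: "v \<in> rv ` W \<Longrightarrow> exposed (rv ` W) {v}"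
proof -
  assume v: "v \<in> rv ` W"
  then have "{v} face_of P" using extreme_W by (auto simp: face_of_singleton)
  then have "{v} exposed_face_of P"
    by (simp add: exposed_face_of_polyhedron polytope_imp_polyhedron polytope_P)
  then obtain a b where ab: "P \<subseteq> {x. a \<bullet> x \<le> b}" "{v} = P \<inter> {x. a \<bullet> x = b}"
    unfolding exposed_face_of_def by blast
  have "rv w \<in> P" if "w \<in> W" for w using that by (simp add: W_def)
  then show ?thesis
    unfolding exposed_def using ab v
    by (intro conjI exI[of _ "- a"] exI[of _ "- b"]) auto
qed

lemma vertex_W:
  assumes "w \<in> W"
  shows "\<exists>\<sigma>. pr \<sigma> w = 0 \<and> (\<forall>w'\<in>W - {w}. 0 < pr \<sigma> w')"
  using vertex_exposure[OF finite_W exposed_vertex[of "rv w"]] assms by (metis imageI)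

sublocale lattice_cone W
  by unfold_locales (rule finite_W vertex_W, assumption?)+

lemma S_monoid_P: "S_monoid P = lat_cone W"
proof -
  have "s \<in> S_monoid P \<longleftrightarrow> (\<forall>v\<in>vertices P. 0 \<le> phi s v)" for s
  proof
    assume "s \<in> S_monoid P"
    then show "\<forall>v\<in>vertices P. 0 \<le> phi s v"
      unfolding S_monoid_def dual_cone_def sigma_cone_def phi_def
      by (auto intro: hull_inc)
  next
    assume a: "\<forall>v\<in>vertices P. 0 \<le> phi s v"
    have "sigma_cone P \<subseteq> {x. 0 \<le> real_of_mlat s \<bullet> x}"
      unfolding sigma_cone_def
    proof (rule hull_minimal)
      show "(\<lambda>v. (v, 1)) ` vertices P \<subseteq> {x. 0 \<le> real_of_mlat s \<bullet> x}" using a by (auto simp: phi_def)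
      show "convex_cone {x. 0 \<le> real_of_mlat s \<bullet> x}"
        by (rule convex_cone_halfspace_ge)
    qed
    then show "s \<in> S_monoid P" unfolding S_monoid_def dual_cone_def by auto
  qed
  then show ?thesis unfolding vertices_W by (auto simp: lat_cone_def phi_rv)
qed

lemma coord_ring_P: "coord_ring P = A"
  by (simp add: coord_ring_def S_monoid_P)

lemma phi_le:
  assumes "\<And>w. w \<in> W \<Longrightarrow> pr r w \<le> k" "v \<in> P"
  shows "phi r v \<le> of_int k"
proof -
  have "P \<subseteq> {v. rv (fst r) \<bullet> v \<le> of_int k - of_int (snd r)}"
  proof (subst P_hull, rule hull_minimal)
    have "rv (fst r) \<bullet> rv w \<le> of_int k - of_int (snd r)" if "w \<in> W" for w
      using assms(1)[OF that] phi_rv[of r w] by (simp add: phi_alt)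
    then show "rv ` W \<subseteq> {v. rv (fst r) \<bullet> v \<le> of_int k - of_int (snd r)}" by auto
  qed (rule convex_halfspace_le)
  then show ?thesis using assms(2) by (auto simp: phi_alt)
qed

lemma vanish_W_imp_0:
  assumes "\<And>w. w \<in> W \<Longrightarrow> pr u w = 0"
  shows "u = 0"
proof -
  have W0: "W \<noteq> {}"
  proof
    assume "W = {}"
    then have "P = {}" using P_hull by simp
    then show False using full by (simp add: full_dimensional_def)
  qed
  have "fst u = 0"
  proof (rule ccontr)
    assume "fst u \<noteq> 0"
    then have n: "rv (fst u) \<noteq> 0" using rv_inject[of "fst u" 0] by (simp add: rv_simps)
    have "rv (fst u) \<bullet> rv w = - of_int (snd u)" if "w \<in> W" for w
      using assms[OF that] phi_rv[of u w] by (simp add: phi_alt)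
    then have "rv ` W \<subseteq> {x. rv (fst u) \<bullet> x = - of_int (snd u)}" by auto
    then have "P \<subseteq> {x. rv (fst u) \<bullet> x = - of_int (snd u)}"
      by (subst P_hull, intro hull_minimal convex_hyperplane)
    then have "aff_dim P \<le> aff_dim {x. rv (fst u) \<bullet> x = - of_int (snd u)}" by (rule aff_dim_subset)
    then show False using full n by (simp add: full_dimensional_def)
  qed
  moreover obtain w where "w \<in> W" using W0 by blast
  ultimately show ?thesis using assms[of w] by (simp add: pr_def prod_eq_iff)
qed

text \<open>If |k| were at least two, the point at the fraction 1/|k| of the way from
  \<open>i\<close> to \<open>j\<close> would be a lattice point of \<open>P\<close> in the open
  segment, hence a vertex, which is impossible.\<close>

lemma primitive_edge:
  assumes ij: "i \<in> W" "j \<in> W" "i \<noteq> j" and d: "j - i = k *s z"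
  shows "k = 1 \<or> k = - 1"
proof (rule ccontr)
  assume "\<not> ?thesis"
  moreover have "k \<noteq> 0" using d ij(3) by auto
  ultimately have k: "2 \<le> \<bar>k\<bar>" by linarith
  define y where "y = sgn k *s z"
  have d': "j - i = \<bar>k\<bar> *s y"
    unfolding d y_def vector_smult_assoc abs_mult_sgn ..
  define t where "t = 1 / real_of_int \<bar>k\<bar>"
  have t: "0 < t" "t < 1" using k by (auto simp: t_def)
  have y: "rv y = t *\<^sub>R (rv j - rv i)"
  proof -
    have "rv j - rv i = real_of_int \<bar>k\<bar> *\<^sub>R rv y" unfolding rv_simps(2)[symmetric] d' rv_simps(5) ..
    then show ?thesis using k by (simp add: t_def)
  qed
  have e: "rv (i + y) = (1 - t) *\<^sub>R rv i + t *\<^sub>R rv j"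
    by (simp add: rv_simps(1) y algebra_simps)
  have "rv (i + y) \<in> P" unfolding e
    using ij t convex_P by (intro convexD) (auto simp: W_def)
  then have "i + y \<in> W" by (simp add: W_def)
  then have "rv (i + y) extreme_point_of P" by (rule extreme_W)
  moreover have "rv (i + y) \<in> open_segment (rv i) (rv j)"
    unfolding in_segment using ij t e by auto
  moreover have "rv i \<in> P" "rv j \<in> P" using ij by (auto simp: W_def)
  ultimately show False by (auto simp: extreme_point_of_def)
qed

lemma edgeI:
  assumes ij: "i \<in> W" "j \<in> W" "i \<noteq> j" and e: "exposed (rv ` W) {rv i, rv j}"
  shows "edge W i j"
proof -
  obtain \<sigma> where "pr \<sigma> i = 0" "pr \<sigma> j = 0" "\<And>w. w \<in> W - {i, j} \<Longrightarrow> 0 < pr \<sigma> w"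
    using edge_exposure[OF finite_W e ij(3)] by blast
  moreover obtain m where m: "idot m (j - i) = 1"
    using primitive_bezout[of "j - i"] primitive_edge[OF ij] ij(3) by (metis right_minus_eq)
  have "pr (m, - idot m i) i = 0" "pr (m, - idot m i) j = 1" using m by (simp_all add: pr_idot idot_simps)
  ultimately show ?thesis unfolding edge_def by blast
qed

lemma simplex_W:
  assumes "i \<in> W" "k \<in> W" "pr r i < pr r k"
  shows "\<exists>j\<in>W. edge W i j \<and> pr r i < pr r j"
proof -
  have lt: "rv (fst r) \<bullet> rv w < rv (fst r) \<bullet> rv w' \<longleftrightarrow> pr r w < pr r w'" for w w'
  proof -
    have "rv (fst r) \<bullet> rv w < rv (fst r) \<bullet> rv w' \<longleftrightarrow> real_of_int (pr r w) < real_of_int (pr r w')"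
      unfolding phi_rv[symmetric] phi_alt by simp
    then show ?thesis by simp
  qed
  obtain v where v: "v \<in> rv ` W" "v \<noteq> rv i" "exposed (rv ` W) {rv i, v}" "rv (fst r) \<bullet> rv i < rv (fst r) \<bullet> v"
    using simplex_step[of "rv ` W" "rv i" "rv k" "rv (fst r)"] finite_W exposed_vertex assms lt by (metis finite_imageI imageI)
  then obtain j where j: "j \<in> W" "v = rv j" by blast
  then show ?thesis using edgeI[OF assms(1) j(1)] v lt by auto
qed

lemma triv_if_big:
  assumes "locadd R \<gamma>" "w0 \<in> W" "2 \<le> pr R w0"
  shows "triv R \<gamma>"
  by (rule triv_if_ge_2[OF _ assms]) (rule simplex_W)

lemma not_combination:
  assumes "finite K" "K \<subseteq> W" "w \<in> W" "rv w \<in> convex hull (rv ` K)"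
  shows "w \<in> K"
proof -
  have "convex hull (rv ` K) \<subseteq> P" using assms(2) by (subst P_hull, intro hull_mono image_mono)
  then have "rv w extreme_point_of (convex hull (rv ` K))"
    using extreme_W[OF assms(3)] assms(4) by (auto simp: extreme_point_of_def)
  then show ?thesis using extreme_point_of_convex_hull by fastforce
qed

section \<open>Lattice triangles and parallelograms spanned by vertices\<close>

definition indep :: "int ^ 'n \<Rightarrow> int ^ 'n \<Rightarrow> int ^ 'n \<Rightarrow> bool" where
  "indep a b c \<longleftrightarrow> (\<forall>x y. x *\<^sub>R (rv b - rv a) + y *\<^sub>R (rv c - rv a) = 0 \<longrightarrow> x = 0 \<and> y = 0)"

lemma indep_eq:
  assumes "indep a b c" "x *\<^sub>R (rv b - rv a) + y *\<^sub>R (rv c - rv a) = x' *\<^sub>R (rv b - rv a) + y' *\<^sub>R (rv c - rv a)"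
  shows "x = x'" "y = y'"
proof -
  have "(x - x') *\<^sub>R (rv b - rv a) + (y - y') *\<^sub>R (rv c - rv a) = 0"
    using assms(2) by (simp add: algebra_simps)
  then have "x - x' = 0 \<and> y - y' = 0" using assms(1) unfolding indep_def by blast
  then show "x = x'" "y = y'" by auto
qed

lemma not_on_segment:
  assumes "a \<in> W" "b \<in> W" "c \<in> W" "b \<noteq> a" "b \<noteq> c" "0 \<le> t" "t \<le> 1"
  shows "rv b \<noteq> (1 - t) *\<^sub>R rv a + t *\<^sub>R rv c"
proof
  assume "rv b = (1 - t) *\<^sub>R rv a + t *\<^sub>R rv c"
  then have "rv b \<in> convex hull (rv ` {a, c})"
    using assms(6,7) by (auto simp: in_segment simp flip: segment_convex_hull)
  then show False using not_combination[of "{a, c}" b] assms by auto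
qed

text \<open>A nontrivial relation puts the three points on a line, and whichever is in the middle
  would be a vertex in the segment between two others.\<close>

lemma vertices_indep:
  assumes w: "a \<in> W" "b \<in> W" "c \<in> W" "a \<noteq> b" "a \<noteq> c" "b \<noteq> c"
  shows "indep a b c"
  unfolding indep_def
proof (intro allI impI)
  fix x y assume e: "x *\<^sub>R (rv b - rv a) + y *\<^sub>R (rv c - rv a) = 0"
  have "y = 0"
  proof (rule ccontr)
    assume "y \<noteq> 0"
    define t where "t = - x / y"
    have xt: "x = - y * t" using \<open>y \<noteq> 0\<close> by (simp add: t_def)
    have "y *\<^sub>R (rv c - rv a - t *\<^sub>R (rv b - rv a)) = 0" using e unfolding xt by (simp add: algebra_simps)
    then have "rv c - rv a - t *\<^sub>R (rv b - rv a) = 0" using \<open>y \<noteq> 0\<close> by (simp only: scaleR_eq_0_iff simp_thms)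
    then have t: "rv c = (1 - t) *\<^sub>R rv a + t *\<^sub>R rv b" by (simp add: algebra_simps)
    consider "0 \<le> t \<and> t \<le> 1" | "t < 0" | "1 < t" by linarith
    then show False
    proof cases
      case 1
      then show False using not_on_segment[of a c b t] t w by auto
    next
      case 2
      have "rv a = (1 / (1 - t)) *\<^sub>R ((1 - t) *\<^sub>R rv a)" using 2 by simp
      also have "(1 - t) *\<^sub>R rv a = rv c - t *\<^sub>R rv b" using t by (simp add: algebra_simps)
      also have "(1 / (1 - t)) *\<^sub>R (rv c - t *\<^sub>R rv b) = (1 / (1 - t)) *\<^sub>R rv c + (- t / (1 - t)) *\<^sub>R rv b"
        by (simp add: scaleR_right_diff_distrib)
      also have "1 / (1 - t) = 1 - - t / (1 - t)" using 2 by (simp add: field_simps)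
      finally show False using not_on_segment[of c a b "- t / (1 - t)"] w 2 by (auto simp: field_simps)
    next
      case 3
      have "rv b = (1 / t) *\<^sub>R (t *\<^sub>R rv b)" using 3 by simp
      also have "t *\<^sub>R rv b = rv c + (t - 1) *\<^sub>R rv a" using t by (simp add: algebra_simps)
      also have "(1 / t) *\<^sub>R (rv c + (t - 1) *\<^sub>R rv a) = ((t - 1) / t) *\<^sub>R rv a + (1 / t) *\<^sub>R rv c"
        by (simp add: scaleR_right_distrib)
      also have "(t - 1) / t = 1 - 1 / t" using 3 by (simp add: field_simps)
      finally show False using not_on_segment[of a b c "1 / t"] w 3 by (auto simp: field_simps)
    qed
  qed
  moreover have "rv b - rv a \<noteq> 0" using w by simp
  ultimately show "x = 0 \<and> y = 0" using e by simp
qed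

lemma in_triangle:
  assumes w: "a \<in> W" "b \<in> W" "c \<in> W" "p \<in> W" and p: "rv p = rv a + x *\<^sub>R (rv b - rv a) + y *\<^sub>R (rv c - rv a)"
    and xy: "0 \<le> x" "0 \<le> y" "x + y \<le> 1"
  shows "p = a \<or> p = b \<or> p = c"
proof -
  have "rv p = (1 - x - y) *\<^sub>R rv a + x *\<^sub>R rv b + y *\<^sub>R rv c" unfolding p by (simp add: algebra_simps)
  then have "rv p \<in> convex hull (rv ` {a, b, c})"
    unfolding image_insert image_empty convex_hull_3 using xy by (intro CollectI exI[of _ "1 - x - y"] exI[of _ x] exI[of _ y]) auto
  then show ?thesis using not_combination[of "{a, b, c}" p] w by auto
qed

text \<open>
  A triangle with no lattice points but its vertices is unimodular: the fractional part of a lattice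
  point of its plane, or the reflection of that part in the midpoint of \<open>bc\<close>, lies in the triangle.
\<close>

lemma triangle_unimodular:
  assumes w: "a \<in> W" "b \<in> W" "c \<in> W" and ind: "indep a b c"
    and p: "rv p = rv a + x *\<^sub>R (rv b - rv a) + y *\<^sub>R (rv c - rv a)"
  shows "x \<in> \<int>" "y \<in> \<int>"
proof -
  define q where "q = p - \<lfloor>x\<rfloor> *s (b - a) - \<lfloor>y\<rfloor> *s (c - a)"
  have q: "rv q = rv a + frac x *\<^sub>R (rv b - rv a) + frac y *\<^sub>R (rv c - rv a)"
    by (simp add: q_def rv_simps p frac_def algebra_simps)
  have inP: "p' \<in> W" if p': "rv p' = rv a + s *\<^sub>R (rv b - rv a) + t *\<^sub>R (rv c - rv a)" and st: "0 \<le> s" "0 \<le> t" "s + t \<le> 1" for p' s t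
  proof -
    have "rv p' = (1 - s - t) *\<^sub>R rv a + s *\<^sub>R rv b + t *\<^sub>R rv c" unfolding p' by (simp add: algebra_simps)
    then have "rv p' \<in> convex hull {rv a, rv b, rv c}"
      unfolding convex_hull_3 using st by (intro CollectI exI[of _ "1 - s - t"] exI[of _ s] exI[of _ t]) auto
    moreover have "convex hull {rv a, rv b, rv c} \<subseteq> P"
      using w convex_P by (intro hull_minimal) (auto simp: W_def)
    ultimately show ?thesis by (auto simp: W_def)
  qed
  have vert: "(s, t) = (0, 0) \<or> (s, t) = (1, 0) \<or> (s, t) = (0, 1)"
    if p': "rv p' = rv a + s *\<^sub>R (rv b - rv a) + t *\<^sub>R (rv c - rv a)" and st: "0 \<le> s" "0 \<le> t" "s + t \<le> 1" for p' s t
  proof -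
    have "p' = a \<or> p' = b \<or> p' = c" by (rule in_triangle[OF w inP[OF p' st] p' st])
    then have "s *\<^sub>R (rv b - rv a) + t *\<^sub>R (rv c - rv a) = 0 *\<^sub>R (rv b - rv a) + 0 *\<^sub>R (rv c - rv a) \<or>
       s *\<^sub>R (rv b - rv a) + t *\<^sub>R (rv c - rv a) = 1 *\<^sub>R (rv b - rv a) + 0 *\<^sub>R (rv c - rv a) \<or>
       s *\<^sub>R (rv b - rv a) + t *\<^sub>R (rv c - rv a) = 0 *\<^sub>R (rv b - rv a) + 1 *\<^sub>R (rv c - rv a)"
      using p' by (auto simp: algebra_simps)
    then show ?thesis using indep_eq[OF ind] by blast
  qed
  have "frac x = 0 \<and> frac y = 0"
  proof (cases "frac x + frac y \<le> 1")
    case True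
    then show ?thesis using vert[OF q frac_ge_0 frac_ge_0 True] frac_lt_1[of x] frac_lt_1[of y] by auto
  next
    case False
    have "rv (b + c - q) = rv a + (1 - frac x) *\<^sub>R (rv b - rv a) + (1 - frac y) *\<^sub>R (rv c - rv a)"
      by (simp add: rv_simps q algebra_simps)
    then have "(1 - frac x, 1 - frac y) = (0, 0) \<or> (1 - frac x, 1 - frac y) = (1, 0) \<or> (1 - frac x, 1 - frac y) = (0, 1)"
      by (rule vert) (use False frac_lt_1[of x] frac_lt_1[of y] in auto)
    then show ?thesis using False frac_lt_1[of x] frac_lt_1[of y] by auto
  qed
  then show "x \<in> \<int>" "y \<in> \<int>" by (simp_all add: frac_eq_0_iff)
qed

text \<open>The coordinates of \<open>p\<close> are integers. Exchanging \<open>p\<close> with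
  \<open>b\<close> or \<open>c\<close> in the triangle shows that \<open>1 / x\<close> and
  \<open>1 / y\<close> are integers too, so both coordinates are 1 or -1. Both equal to -1 would
  make \<open>a\<close> the centroid of \<open>p\<close>, \<open>b\<close>,
  \<open>c\<close>.\<close>

lemma fourth_point:
  assumes w: "a \<in> W" "b \<in> W" "c \<in> W" "p \<in> W" and dist: "a \<noteq> b" "a \<noteq> c" "b \<noteq> c" "p \<notin> {a, b, c}"
    and p: "rv p = rv a + x *\<^sub>R (rv b - rv a) + y *\<^sub>R (rv c - rv a)"
  shows "p = b + c - a \<or> p = a + b - c \<or> p = a + c - b"
proof -
  have dist': "p \<noteq> a" "p \<noteq> b" "p \<noteq> c" using dist(4) by auto
  have ind: "indep a b c" using w dist by (intro vertices_indep)
  have Z: "x \<in> \<int>" "y \<in> \<int>" using triangle_unimodular[OF w(1-3) ind p] by auto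
  have x0: "x \<noteq> 0"
  proof
    assume "x = 0"
    then have "y *\<^sub>R (rv c - rv a) + (- 1) *\<^sub>R (rv p - rv a) = 0" using p by simp
    then show False using vertices_indep[of a c p] w dist' dist(1-3) unfolding indep_def by fastforce
  qed
  have y0: "y \<noteq> 0"
  proof
    assume "y = 0"
    then have "x *\<^sub>R (rv b - rv a) + (- 1) *\<^sub>R (rv p - rv a) = 0" using p by simp
    then show False using vertices_indep[of a b p] w dist' dist(1-3) unfolding indep_def by fastforce
  qed
  have unit: "t = 1 \<or> t = - 1" if t: "t \<in> \<int>" "1 / t \<in> \<int>" "t \<noteq> 0" for t :: real
  proof -
    obtain m where m: "t = of_int m" using t(1) by (rule Ints_cases)
    obtain n where n: "1 / t = of_int n" using t(2) by (rule Ints_cases)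
    note mn = m n
    have "t * (1 / t) = 1" using t(3) by simp
    then have "real_of_int (m * n) = 1" unfolding n by (simp add: m)
    then have "m * n = 1" by linarith
    then show ?thesis using mn by (auto simp: zmult_eq_1_iff)
  qed
  have "rv b = rv a + (1 / x) *\<^sub>R (rv p - rv a) + (- y / x) *\<^sub>R (rv c - rv a)"
    unfolding p using x0 by (simp add: algebra_simps)
  then have "1 / x \<in> \<int>"
    by (rule triangle_unimodular(1)[OF w(1,4,3) vertices_indep[OF w(1,4,3) dist'(1)[symmetric] dist(2) dist'(3)]])
  then have x: "x = 1 \<or> x = - 1" using unit Z x0 by blast
  have "rv c = rv a + (1 / y) *\<^sub>R (rv p - rv a) + (- x / y) *\<^sub>R (rv b - rv a)"
    unfolding p using y0 by (simp add: algebra_simps)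
  then have "1 / y \<in> \<int>"
    by (rule triangle_unimodular(1)[OF w(1,4,2) vertices_indep[OF w(1,4,2) dist'(1)[symmetric] dist(1) dist'(2)]])
  then have y: "y = 1 \<or> y = - 1" using unit Z y0 by blast
  have "\<not> (x = - 1 \<and> y = - 1)"
  proof
    assume xy: "x = - 1 \<and> y = - 1"
    have "rv a = rv p + (1 / 3) *\<^sub>R (rv b - rv p) + (1 / 3) *\<^sub>R (rv c - rv p)"
      unfolding vec_eq_iff
    proof
      fix i
      have "rv p $ i = 3 * rv a $ i - rv b $ i - rv c $ i" using arg_cong[OF p, of "\<lambda>v. v $ i"] xy by simp
      then show "rv a $ i = (rv p + (1 / 3) *\<^sub>R (rv b - rv p) + (1 / 3) *\<^sub>R (rv c - rv p)) $ i"
        by (simp add: algebra_simps)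
    qed
    then have "a = p \<or> a = b \<or> a = c" by (rule in_triangle[OF w(4,2,3,1)]) auto
    then show False using dist' dist(1-3) by auto
  qed
  then have "x = 1 \<and> y = 1 \<or> x = 1 \<and> y = - 1 \<or> x = - 1 \<and> y = 1" using x y by blast
  then have "rv p = rv (b + c - a) \<or> rv p = rv (a + b - c) \<or> rv p = rv (a + c - b)"
    using p by (auto simp: rv_simps)
  then show ?thesis by simp
qed

text \<open>Each further point is one of the three that complete the triangle to a parallelogram,
  and any two of these have a vertex of the triangle as midpoint. So there is at most one.\<close>

lemma planar_face:
  assumes E: "E \<subseteq> W" "a \<in> E" "b \<in> E" "c \<in> E" "a \<noteq> b" "a \<noteq> c" "b \<noteq> c"
    and plane: "\<And>p. p \<in> E \<Longrightarrow> \<exists>x y. rv p = rv a + x *\<^sub>R (rv b - rv a) + y *\<^sub>R (rv c - rv a)"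
  shows "E = {a, b, c} \<or> (\<exists>a' b' c' d'. E = {a', b', c', d'} \<and> a' + c' = b' + d' \<and> a' \<noteq> b' \<and> a' \<noteq> d' \<and> b' \<noteq> d' \<and>
    {a', b', d'} \<subseteq> E \<and> c' \<notin> {a', b', d'})"
proof (cases "E = {a, b, c}")
  case False
  then obtain p where p: "p \<in> E" "p \<notin> {a, b, c}" using E by blast
  have w: "a \<in> W" "b \<in> W" "c \<in> W" using E by auto
  have opts: "q = b + c - a \<or> q = a + b - c \<or> q = a + c - b" if "q \<in> E" "q \<notin> {a, b, c}" for q
    using plane[OF that(1)] fourth_point[OF w _ E(5-7) that(2)] that(1) E(1) by auto
  have mid: False if "s \<in> E" "t \<in> E" "m \<in> E" "s + t = m + m" "m \<noteq> s" "m \<noteq> t" for s t m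
  proof -
    have "rv s + rv t = rv m + rv m" using that(4) by (metis rv_simps(1))
    then have "rv m = (1 - 1 / 2) *\<^sub>R rv s + (1 / 2) *\<^sub>R rv t"
      by (simp add: vec_eq_iff) (metis field_sum_of_halves add_divide_distrib mult_2 mult_2_right numeral_One)
    then show False using not_on_segment[of s m t "1/2"] that E(1) by auto
  qed
  have uniq: "q = p" if q: "q \<in> E" "q \<notin> {a, b, c}" for q
  proof (rule ccontr)
    assume "q \<noteq> p"
    have "p + q = b + b \<or> p + q = c + c \<or> p + q = a + a"
      using opts[OF p] opts[OF q] \<open>q \<noteq> p\<close> by (elim disjE; hypsubst; simp)
    then show False using mid[OF p(1) q(1)] p(2) q(2) E by auto
  qed
  have Eq: "E = {a, b, c, p}" using E p uniq by blast
  define Q where "Q a' b' c' d' \<longleftrightarrow> E = {a', b', c', d'} \<and> a' + c' = b' + d' \<and> a' \<noteq> b' \<and> a' \<noteq> d' \<and> b' \<noteq> d' \<and>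
    {a', b', d'} \<subseteq> E \<and> c' \<notin> {a', b', d'}" for a' b' c' d'
  consider "p = b + c - a" | "p = a + b - c" | "p = a + c - b" using opts[OF p] by blast
  then have "\<exists>a' b' c' d'. Q a' b' c' d'"
  proof cases
    case 1
    then have s: "a + p = b + c" by simp
    have "Q a b p c" unfolding Q_def s using Eq p E by auto
    then show ?thesis by blast
  next
    case 2
    then have s: "c + p = a + b" by simp
    have "Q c a p b" unfolding Q_def s using Eq p E by auto
    then show ?thesis by blast
  next
    case 3
    then have s: "b + p = a + c" by simp
    have "Q b a p c" unfolding Q_def s using Eq p E by auto
    then show ?thesis by blast
  qed
  then show ?thesis unfolding Q_def by blast
qed simp

end

section \<open>Square facets of three-dimensional polytopes\<close>

lemma plane_span:
  fixes n u v x :: "real ^ 3"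
  assumes n: "n \<noteq> 0" "n \<bullet> u = 0" "n \<bullet> v = 0" "n \<bullet> x = 0"
    and ind: "\<And>a b. a *\<^sub>R u + b *\<^sub>R v = 0 \<Longrightarrow> a = 0 \<and> b = 0"
  obtains a b where "x = a *\<^sub>R u + b *\<^sub>R v"
proof -
  have v0: "v \<noteq> 0" using ind[of 0 1] by auto
  have "u \<notin> span {v}"
  proof
    assume "u \<in> span {v}"
    then obtain k where "u = k *\<^sub>R v" by (auto simp: span_singleton)
    then show False using ind[of 1 "- k"] by simp
  qed
  then have "independent {u, v}" and "u \<noteq> v"
    using v0 by (auto simp: independent_insert span_base)
  then have d: "dim (span {u, v}) = 2" by (simp add: dim_eq_card_independent)
  have "span {u, v} = {x. n \<bullet> x = 0}"
  proof (rule subspace_dim_equal)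
    show "span {u, v} \<subseteq> {x. n \<bullet> x = 0}"
      using n by (intro span_minimal subspace_hyperplane) auto
    show "dim (span {u, v}) \<ge> dim {x. n \<bullet> x = 0}" using n(1) d by (simp add: dim_hyperplane)
  qed (auto simp: subspace_hyperplane)
  then have "x \<in> span {u, v}" using n by auto
  then obtain a where "x - a *\<^sub>R u \<in> span {v}" by (auto simp: span_insert)
  then obtain b where "x - a *\<^sub>R u = b *\<^sub>R v" by (auto simp: span_singleton)
  then show ?thesis using that[of a b] by (simp add: algebra_simps)
qed

text \<open>The part of \<open>m\<close> orthogonal to \<open>n\<close> lies in the plane of
  \<open>u\<close> and \<open>v\<close> and is orthogonal to it, so it is 0.\<close>

lemma perp_parallel:
  fixes n u v m :: "real ^ 3"
  assumes n: "n \<noteq> 0" "n \<bullet> u = 0" "n \<bullet> v = 0" and m: "m \<bullet> u = 0" "m \<bullet> v = 0"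
    and ind: "\<And>a b. a *\<^sub>R u + b *\<^sub>R v = 0 \<Longrightarrow> a = 0 \<and> b = 0"
  obtains k where "m = k *\<^sub>R n"
proof -
  define k where "k = (m \<bullet> n) / (n \<bullet> n)"
  define x where "x = m - k *\<^sub>R n"
  have "n \<bullet> x = 0" using n(1) by (simp add: x_def k_def inner_diff_right inner_commute)
  then obtain a b where x: "x = a *\<^sub>R u + b *\<^sub>R v" using plane_span[OF n _ ind] by blast
  have "x \<bullet> u = 0" "x \<bullet> v = 0" using n m by (simp_all add: x_def inner_diff_left)
  then have "x \<bullet> x = 0" by (subst (2) x) (simp add: inner_add_right)
  then show ?thesis using that[of k] by (simp add: x_def)
qed

definition gram :: "int ^ 'n::finite \<Rightarrow> int ^ 'n \<Rightarrow> int ^ 'n \<Rightarrow> int" where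
  "gram a b c = idot (b - a) (b - a) * idot (c - a) (c - a) - idot (b - a) (c - a) * idot (b - a) (c - a)"

text \<open>The linear part is the component of \<open>c - a\<close> orthogonal to
  \<open>b - a\<close>, scaled by the square length of \<open>b - a\<close> to be integral. So the
  functional vanishes on the line \<open>ab\<close>, and its value at \<open>c\<close> is the Gram
  determinant of the two sides.\<close>

definition gfun :: "int ^ 'n::finite \<Rightarrow> int ^ 'n \<Rightarrow> int ^ 'n \<Rightarrow> 'n mlat" where
  "gfun a b c = (let m = idot (b - a) (b - a) *s (c - a) - idot (b - a) (c - a) *s (b - a) in (m, - idot m a))"

lemma pr_diff: "pr s b - pr s a = idot (fst s) (b - a)"
  by (simp add: pr_def idot_def right_diff_distrib sum_subtractf)

lemma idot_lin: "idot (k *s x - l *s y) z = k * idot x z - l * idot y z"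
  by (simp add: idot_simps)

lemma pr_gfun: "pr (gfun a b c) a = 0" "pr (gfun a b c) b = 0" "pr (gfun a b c) c = gram a b c"
proof -
  show a: "pr (gfun a b c) a = 0" by (simp add: gfun_def Let_def pr_idot)
  have "idot (fst (gfun a b c)) (b - a) = 0"
    by (simp only: gfun_def Let_def fst_conv idot_lin idot_commute[of "c - a" "b - a"] mult.commute diff_self)
  then show "pr (gfun a b c) b = 0" using pr_diff[of "gfun a b c" b a] a by simp
  have "idot (fst (gfun a b c)) (c - a) = gram a b c"
    by (simp only: gfun_def Let_def fst_conv idot_lin gram_def)
  then show "pr (gfun a b c) c = gram a b c" using pr_diff[of "gfun a b c" c a] a by simp
qed

lemma gram_commute: "gram a b c = gram a c b"
  by (simp add: gram_def idot_commute[of "c - a" "b - a"])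

text \<open>After cancelling the gcd, each coefficient divides all coordinates of the vector on the
  other side, which is primitive; so both are units.\<close>

lemma primitive_parallel:
  fixes s s' :: "'n::finite mlat"
  assumes "primitive_mlat s" "primitive_mlat s'" and pq: "p \<noteq> 0" "q \<noteq> 0" "mlat_scale p s' = mlat_scale q s"
  shows "s' = s \<or> s' = - s"
proof -
  define g where "g = gcd p q"
  have g: "g \<noteq> 0" using pq by (simp add: g_def)
  obtain p' q' where p': "p = g * p'" "q = g * q'" "coprime p' q'"
    using gcd_coprime_exists[of p q] g unfolding g_def by (metis mult.commute)
  have unit: "k = 1 \<or> k = - 1" if s: "primitive_mlat s" and co: "coprime k l" and eq: "mlat_scale k s' = mlat_scale l s"
    for k l and s s' :: "'n mlat"
  proof -
    have "k * fst s' $ i = l * fst s $ i" for i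
      using arg_cong[OF eq, of "\<lambda>x. fst x $ i"] by (simp add: mlat_scale_def)
    then have "k dvd fst s $ i" for i using co by (metis coprime_dvd_mult_right_iff dvd_triv_left)
    moreover have "k * snd s' = l * snd s" using arg_cong[OF eq, of snd] by (simp add: mlat_scale_def)
    then have "k dvd snd s" using co by (metis coprime_dvd_mult_right_iff dvd_triv_left)
    ultimately have "s = mlat_scale k (\<chi> i. fst s $ i div k, snd s div k)"
      by (simp add: mlat_scale_def prod_eq_iff vec_eq_iff)
    then show ?thesis using s unfolding primitive_mlat_def by blast
  qed
  have eq: "mlat_scale p' s' = mlat_scale q' s"
    using pq(3) g unfolding p' by (simp add: mlat_scale_def prod_eq_iff vec_eq_iff mult.assoc)
  have "p' = 1 \<or> p' = - 1" by (rule unit[OF assms(1) p'(3) eq])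
  moreover have "q' = 1 \<or> q' = - 1" using p'(3) by (intro unit[OF assms(2) _ eq[symmetric]]) (simp add: coprime_commute)
  ultimately show ?thesis using eq by (auto simp: mlat_scale_simps)
qed

lemma primitive_factor:
  fixes u :: "'n::finite mlat"
  assumes "u \<noteq> 0"
  obtains g s where "1 \<le> g" "u = mlat_scale g s" "primitive_mlat s"
proof -
  define G where "G = {g::nat. \<exists>s. u = mlat_scale (int g) s}"
  \<comment> \<open>A nonzero coordinate of \<open>u\<close> bounds the divisors of
    \<open>u\<close>, so there is a largest one.\<close>
  obtain t where t: "t \<noteq> 0" "\<And>k s. u = mlat_scale k s \<Longrightarrow> k dvd t"
  proof (cases "snd u = 0")
    case True
    then obtain i where "fst u $ i \<noteq> 0" using assms by (auto simp: prod_eq_iff vec_eq_iff)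
    then show ?thesis by (intro that[of "fst u $ i"]) (auto simp: mlat_scale_def)
  next
    case False
    then show ?thesis by (intro that[of "snd u"]) (auto simp: mlat_scale_def)
  qed
  have "G \<subseteq> {..nat \<bar>t\<bar>}"
  proof
    fix g assume "g \<in> G"
    then have "int g dvd t" using t(2) by (auto simp: G_def)
    then have "int g \<le> \<bar>t\<bar>" using dvd_imp_le_int[OF t(1), of "int g"] by simp
    then show "g \<in> {..nat \<bar>t\<bar>}" by simp
  qed
  then have fin: "finite G" using finite_subset by blast
  have "1 \<in> G" by (auto simp: G_def mlat_scale_simps(2))
  define g where "g = Max G"
  have g: "g \<in> G" "1 \<le> g" "\<And>h. h \<in> G \<Longrightarrow> h \<le> g"
    unfolding g_def using fin \<open>1 \<in> G\<close> Max_in[of G] Max_ge[of G] by blast+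
  obtain s where s: "u = mlat_scale (int g) s" using g(1) by (auto simp: G_def)
  have "primitive_mlat s"
    unfolding primitive_mlat_def
  proof (intro conjI allI impI)
    show "s \<noteq> 0" using s assms by (auto simp: mlat_scale_def prod_eq_iff vec_eq_iff)
    fix k t assume k: "s = mlat_scale k t"
    have k0: "k \<noteq> 0" using k \<open>s \<noteq> 0\<close> by (auto simp: mlat_scale_simps)
    have "u = mlat_scale (int (g * nat \<bar>k\<bar>)) (mlat_scale (sgn k) t)"
      by (simp add: s k mlat_scale_simps mult.assoc abs_mult_sgn)
    then have "g * nat \<bar>k\<bar> \<in> G" unfolding G_def by blast
    then have "g * nat \<bar>k\<bar> \<le> g" by (rule g(3))
    then have "nat \<bar>k\<bar> \<le> 1" using g(2) by simp
    then show "k = 1 \<or> k = - 1" using k0 by linarith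
  qed
  then show ?thesis using that[of "int g" s] s g(2) by simp
qed

locale empty_polytope3 = empty_lattice_polytope P for P :: "(real ^ 3) set"
begin

lemma indepD: "indep a b c \<Longrightarrow> x *\<^sub>R (rv b - rv a) + y *\<^sub>R (rv c - rv a) = 0 \<Longrightarrow> x = 0 \<and> y = 0"
  unfolding indep_def by blast

lemma gram_pos:
  assumes "indep a b c" shows "0 < gram a b c"
proof -
  define u v where "u = rv b - rv a" and "v = rv c - rv a"
  define x where "x = (u \<bullet> u) *\<^sub>R v - (u \<bullet> v) *\<^sub>R u"
  have "u \<noteq> 0" using indepD[OF assms, of 1 0] by (auto simp: u_def)
  then have uu: "0 < u \<bullet> u" by simp
  have "x \<noteq> 0"
  proof
    assume "x = 0"
    then have "(- (u \<bullet> v)) *\<^sub>R u + (u \<bullet> u) *\<^sub>R v = 0" by (simp add: x_def)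
    then show False using indepD[OF assms, of "- (u \<bullet> v)" "u \<bullet> u"] uu by (simp add: u_def v_def)
  qed
  have "x \<bullet> u = 0" unfolding x_def inner_diff_left inner_scaleR_left by (simp add: inner_commute[of v u])
  then have "x \<bullet> x = (u \<bullet> u) * (x \<bullet> v)" by (subst (2) x_def) (simp add: inner_diff_right)
  then have "0 < (u \<bullet> u) * (x \<bullet> v)" using \<open>x \<noteq> 0\<close> by (metis inner_gt_zero_iff)
  then have "0 < x \<bullet> v" using uu by (simp add: zero_less_mult_iff)
  also have "x \<bullet> v = of_int (gram a b c)"
    by (simp add: x_def gram_def inner_diff_left rv_inner[symmetric] rv_simps u_def v_def)
  finally show ?thesis by simp
qed

text \<open>\<open>gfun a b d\<close> vanishes at \<open>a\<close> and \<open>b\<close> and is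
  positive at the other points of \<open>E\<close>, which lie on the side of \<open>d\<close>. So it
  exposes the pair in \<open>E\<close>, and being exposed is transitive.\<close>

lemma edge_of_face:
  assumes E: "E \<subseteq> W" "exposed (rv ` W) (rv ` E)" and ab: "a \<in> E" "b \<in> E" "a \<noteq> b"
    and ind: "indep a b d"
    and side: "\<And>w. w \<in> E - {a, b} \<Longrightarrow> \<exists>x y. 0 < y \<and> w - a = x *s (b - a) + y *s (d - a)"
  shows "edge W a b"
proof -
  have gd: "pr (gfun a b d) w = y * gram a b d" if "w - a = x *s (b - a) + y *s (d - a)" for w x y
  proof -
    have "pr (gfun a b d) w - pr (gfun a b d) a = x * (pr (gfun a b d) b - pr (gfun a b d) a) + y * (pr (gfun a b d) d - pr (gfun a b d) a)"
      unfolding pr_diff that by (simp only: idot_simps(3,6))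
    then show ?thesis by (simp add: pr_gfun)
  qed
  have v: "rv (fst (gfun a b d)) \<bullet> rv w = of_int (pr (gfun a b d) w) - of_int (snd (gfun a b d))" for w
    using phi_rv[of "gfun a b d" w] by (simp add: phi_alt)
  have pos: "0 < pr (gfun a b d) w" if "w \<in> E - {a, b}" for w
    using side[OF that] gd gram_pos[OF ind] by (auto simp: zero_less_mult_iff)
  have "exposed (rv ` E) {rv a, rv b}"
    unfolding exposed_def
  proof (intro conjI exI ballI)
    fix x assume "x \<in> rv ` E"
    then obtain w where w: "w \<in> E" "x = rv w" by blast
    have "w = a \<or> w = b \<or> w \<in> E - {a, b}" using w by blast
    then show "- of_int (snd (gfun a b d)) \<le> rv (fst (gfun a b d)) \<bullet> x"
      "rv (fst (gfun a b d)) \<bullet> x = - of_int (snd (gfun a b d)) \<longleftrightarrow> x \<in> {rv a, rv b}"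
      using pos[of w] by (auto simp: w v pr_gfun)
  qed (use ab in auto)
  then have "exposed (rv ` W) {rv a, rv b}"
    using exposed_trans[OF _ E(2)] finite_W by blast
  then show ?thesis using ab E(1) by (intro edgeI) auto
qed

lemma exposed_zero_set:
  assumes "\<And>w. w \<in> W \<Longrightarrow> 0 \<le> pr u w"
  shows "exposed (rv ` W) (rv ` {w \<in> W. pr u w = 0})"
proof -
  have v: "rv (fst u) \<bullet> rv w = of_int (pr u w) - of_int (snd u)" for w
    using phi_rv[of u w] by (simp add: phi_alt)
  show ?thesis
    unfolding exposed_def
    by (intro conjI exI[of _ "rv (fst u)"] exI[of _ "- of_int (snd u)"]) (auto simp: v assms)
qed

lemma plane_of_zero_set:
  assumes u: "u \<noteq> 0" and z: "pr u a = 0" "pr u b = 0" "pr u c = 0" "pr u p = 0" and ind: "indep a b c"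
  obtains x y where "rv p = rv a + x *\<^sub>R (rv b - rv a) + y *\<^sub>R (rv c - rv a)"
proof -
  have d: "rv (fst u) \<bullet> (rv w - rv a) = 0" if "pr u w = 0" for w
    using pr_diff[of u w a] that z(1) by (simp add: rv_inner flip: rv_simps)
  have "fst u \<noteq> 0"
  proof
    assume "fst u = 0"
    then have "snd u = 0" using z(1) by (simp add: pr_def)
    then show False using u \<open>fst u = 0\<close> by (simp add: prod_eq_iff)
  qed
  then have n: "rv (fst u) \<noteq> 0" using rv_inject[of "fst u" 0] by (simp add: rv_simps)
  obtain x y where "rv p - rv a = x *\<^sub>R (rv b - rv a) + y *\<^sub>R (rv c - rv a)"
    using plane_span[OF n d[OF z(2)] d[OF z(3)] d[OF z(4)] indepD[OF ind]] by blast
  then have "rv p = rv a + x *\<^sub>R (rv b - rv a) + y *\<^sub>R (rv c - rv a)" by (simp add: algebra_simps)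
  then show ?thesis by (rule that)
qed

text \<open>A parallelogram with its corners in cyclic order. For corners in \<open>W\<close>,
  emptiness makes it unimodular by \<open>triangle_unimodular\<close>.\<close>

definition square :: "(int ^ 3) set \<Rightarrow> int ^ 3 \<Rightarrow> int ^ 3 \<Rightarrow> int ^ 3 \<Rightarrow> int ^ 3 \<Rightarrow> bool" where
  "square E a b c d \<longleftrightarrow> E = {a, b, c, d} \<and> a + c = b + d \<and> a \<noteq> b \<and> a \<noteq> d \<and> b \<noteq> d \<and> c \<notin> {a, b, d}"

lemma square_rotate: "square E a b c d \<Longrightarrow> square E b c d a"
  unfolding square_def by (auto simp: add.commute)

lemma square_edge:
  assumes E: "E \<subseteq> W" "exposed (rv ` W) (rv ` E)" and sq: "square E a b c d"
  shows "edge W a b"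
proof (rule edge_of_face[OF E])
  show "a \<in> E" "b \<in> E" "a \<noteq> b" using sq by (auto simp: square_def)
  show "indep a b d" using sq E(1) by (intro vertices_indep) (auto simp: square_def)
  fix w assume "w \<in> E - {a, b}"
  then have "w = c \<or> w = d" using sq by (auto simp: square_def)
  moreover have "c = b + d - a" using sq by (simp add: square_def algebra_simps)
  ultimately have "w - a = 1 *s (b - a) + 1 *s (d - a) \<or> w - a = 0 *s (b - a) + 1 *s (d - a)"
    by (auto simp: vec_eq_iff)
  then show "\<exists>x y. 0 < y \<and> w - a = x *s (b - a) + y *s (d - a)" by (metis zero_less_one)
qed

lemma pr_square: "a + c = b + d \<Longrightarrow> pr u a + pr u c = pr u b + pr u d"
proof -
  assume "a + c = b + d"
  then have "c - b = d - a" by (simp add: algebra_simps)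
  then have "pr u c - pr u b = pr u d - pr u a" unfolding pr_diff by simp
  then show ?thesis by simp
qed

section \<open>Three-dimensional polytopes: degrees with all values at most one\<close>

context
  fixes R :: "3 mlat" and E
  assumes R: "\<And>w. w \<in> W \<Longrightarrow> pr R w \<le> 1" and E: "E = {w \<in> W. pr R w = 1}"
begin

lemma E_exposed: "E \<subseteq> W" "exposed (rv ` W) (rv ` E)"
  using exposed_zero_set[of "R_star - R"] R by (auto simp: E eq_commute[of 1])

lemma square_T1:
  assumes sq: "square E a b c d"
  obtains \<gamma> where "locadd R \<gamma>" "\<not> triv R \<gamma>" "\<And>\<gamma>'. locadd R \<gamma>' \<Longrightarrow> \<exists>\<alpha>. triv R (\<lambda>s. \<gamma>' s - \<alpha> * \<gamma> s)"
proof -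
  note rot = sq square_rotate[OF sq] square_rotate[OF square_rotate[OF sq]] square_rotate[OF square_rotate[OF square_rotate[OF sq]]]
  note edges = rot[THEN square_edge[OF E_exposed]]
  have abcd: "E = {a, b, c, d}" and par: "a + c = b + d" using sq by (auto simp: square_def)
  note par = pr_square[OF par]
  have "indep a b d" using sq E_exposed(1) by (intro vertices_indep) (auto simp: square_def)
  then have g: "0 < gram a b d" by (rule gram_pos)
  define Pf Qf where "Pf = gfun a d b" and "Qf = gfun a b d"
  have P: "pr Pf a = 0" "pr Pf b = gram a b d" "pr Pf c = gram a b d" "pr Pf d = 0"
    using par[of Pf] by (simp_all add: Pf_def pr_gfun gram_commute[of a d b])
  have Q: "pr Qf a = 0" "pr Qf b = 0" "pr Qf c = gram a b d" "pr Qf d = gram a b d"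
    using par[of Qf] by (simp_all add: Qf_def pr_gfun)
  show ?thesis
  proof (rule that)
    show "locadd R (\<lambda>s. of_int (min (pr s a) (pr s b)))"
      by (rule square_locadd[OF R E abcd par])
    show "\<not> triv R (\<lambda>s. of_int (min (pr s a) (pr s b)))"
      by (rule square_not_triv[OF R E abcd P Q g])
    fix \<gamma>' assume \<gamma>': "locadd R \<gamma>'"
    \<comment> \<open>Its values are \<open>gram a b d\<close> at \<open>a\<close> and
      \<open>b\<close>, and 0 at \<open>c\<close> and \<open>d\<close>, as
      \<open>square_span\<close> asks.\<close>
    let ?x = "mlat_scale (gram a b d) R_star - Qf"
    show "\<exists>\<alpha>. triv R (\<lambda>s. \<gamma>' s - \<alpha> * of_int (min (pr s a) (pr s b)))"
      by (rule square_span[OF R E \<gamma>' abcd edges(1,2,3) edge_sym[OF edges(4)] par, of ?x])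
        (use Q g in simp_all)
  qed
qed

text \<open>Since \<open>R\<close> differs from \<open>R_star\<close>, the nonzero functional
  \<open>R_star - R\<close> vanishes on \<open>E\<close>, which makes \<open>E\<close> planar. Up to
  three points are covered by the triviality lemmas, and more than three can only form a
  parallelogram.\<close>

lemma nontrivial_imp_square:
  assumes \<gamma>: "locadd R \<gamma>" "\<not> triv R \<gamma>" and R0: "R \<noteq> R_star"
  shows "\<exists>a b c d. square E a b c d"
proof (rule ccontr)
  assume no: "\<not> ?thesis"
  have u: "R_star - R \<noteq> 0" using R0 by simp
  have z: "pr (R_star - R) w = 0" if "w \<in> E" for w using that by (simp add: E)
  have "E \<noteq> {}" using triv_empty[OF R E] \<gamma>(2) by blast
  then obtain a where a: "a \<in> E" by blast
  have "E \<noteq> {a}" using triv_vertex[OF R E \<gamma>(1)] \<gamma>(2) by blast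
  then obtain b where b: "b \<in> E" "b \<noteq> a" using a by blast
  have "E \<noteq> {a, b}"
  proof
    assume ab: "E = {a, b}"
    then have "edge W a b" using E_exposed a b by (intro edgeI) auto
    then show False using triv_edge[OF R E \<gamma>(1) ab] \<gamma>(2) by blast
  qed
  then obtain c where c: "c \<in> E" "c \<noteq> a" "c \<noteq> b" using a b by blast
  have in_W: "a \<in> W" "b \<in> W" "c \<in> W" using a b c E by auto
  have ind: "indep x y z" if "{x, y, z} = {a, b, c}" "x \<noteq> y" "x \<noteq> z" "y \<noteq> z" for x y z
    using that in_W by (intro vertices_indep) auto
  have "\<exists>x y. rv p = rv a + x *\<^sub>R (rv b - rv a) + y *\<^sub>R (rv c - rv a)" if "p \<in> E" for p
    by (rule plane_of_zero_set[OF u z[OF a] z[OF b(1)] z[OF c(1)] z[OF that] ind]) (use b c in auto)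
  then have "E = {a, b, c} \<or> (\<exists>a' b' c' d'. E = {a', b', c', d'} \<and> a' + c' = b' + d' \<and> a' \<noteq> b' \<and> a' \<noteq> d' \<and> b' \<noteq> d' \<and>
      {a', b', d'} \<subseteq> E \<and> c' \<notin> {a', b', d'})"
    using planar_face[OF E_exposed(1) a b(1) c(1)] b c by metis
  then have abc: "E = {a, b, c}" using no unfolding square_def by blast
  have tri_edge: "edge W x y" if xyz: "{x, y, z} = {a, b, c}" "x \<noteq> y" "x \<noteq> z" "y \<noteq> z" for x y z
  proof (rule edge_of_face[OF E_exposed _ _ _ ind[OF xyz]])
    show "x \<in> E" "y \<in> E" "x \<noteq> y" using xyz abc by auto
    fix w assume "w \<in> E - {x, y}"
    then have "w - x = 0 *s (y - x) + 1 *s (z - x)" using xyz(1) abc by auto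
    then show "\<exists>p q. 0 < q \<and> w - x = p *s (y - x) + q *s (z - x)" by (metis zero_less_one)
  qed
  have "gram b c a > 0" using b c by (intro gram_pos ind) auto
  then have "triv R \<gamma>"
    using b c by (intro triv_triangle[OF R E \<gamma>(1) abc, of "gfun b c a"] tri_edge[of a b c] tri_edge[of a c b] tri_edge[of b c a])
      (auto simp: pr_gfun)
  then show False using \<gamma>(2) by blast
qed

end

end

section \<open>Facet generators and square facets\<close>

context empty_polytope3
begin

lemma S_nonneg: "(\<forall>x\<in>sigma_cone P. 0 \<le> real_of_mlat s \<bullet> x) \<longleftrightarrow> (\<forall>w\<in>W. 0 \<le> pr s w)"
proof -
  have "s \<in> S_monoid P \<longleftrightarrow> s \<in> lat_cone W" by (simp only: S_monoid_P)
  then show ?thesis unfolding S_monoid_def dual_cone_def lat_cone_def mem_Collect_eq .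
qed

text \<open>Three independent zeros fix the normal of \<open>u\<close> up to a scalar, so the
  primitive vector on the ray of \<open>u\<close> is the only candidate in the definite description
  \<open>s_facet\<close>; a vertex off the face fixes its sign.\<close>

lemma s_facet_eq:
  assumes nonneg: "\<And>w. w \<in> W \<Longrightarrow> 0 \<le> pr u w" and u0: "u \<noteq> 0"
    and z: "a \<in> W" "b \<in> W" "c \<in> W" "pr u a = 0" "pr u b = 0" "pr u c = 0" and ind: "indep a b c"
  obtains g where "1 \<le> g" "u = mlat_scale g (s_facet P {v \<in> P. phi u v = 0})"
proof -
  let ?F = "{v \<in> P. phi u v = 0}"
  obtain g s where gs: "1 \<le> g" "u = mlat_scale g s" "primitive_mlat s"
    using primitive_factor[OF u0] by blast
  have pu: "pr u w = g * pr s w" for w by (simp add: gs(2))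
  have phi_u: "phi u v = of_int g * phi s v" for v
    by (simp add: gs(2) phi_alt mlat_scale_def rv_simps algebra_simps)
  let ?Q = "\<lambda>s. primitive_mlat s \<and> (\<forall>x\<in>sigma_cone P. 0 \<le> real_of_mlat s \<bullet> x) \<and>
    (\<forall>v\<in>P. real_of_mlat s \<bullet> (v, 1) = 0 \<longleftrightarrow> v \<in> ?F)"
  have s: "?Q s"
    unfolding S_nonneg phi_def[symmetric]
  proof (intro conjI ballI)
    show "0 \<le> pr s w" if "w \<in> W" for w using nonneg[OF that] gs(1) by (simp add: pu zero_le_mult_iff)
    show "phi s v = 0 \<longleftrightarrow> v \<in> ?F" if "v \<in> P" for v using that gs(1) by (simp add: phi_u)
  qed (rule gs(3))
  have zs: "pr s a = 0" "pr s b = 0" "pr s c = 0" using z gs(1) by (simp_all add: pu)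
  obtain w where w: "w \<in> W" "pr u w \<noteq> 0" using vanish_W_imp_0[of u] u0 by blast
  have sw: "0 < pr s w" using nonneg[OF w(1)] w(2) gs(1) by (simp add: pu zero_le_mult_iff less_le)
  have perp: "rv (fst s') \<bullet> (rv x - rv a) = 0" if "pr s' a = 0" "pr s' x = 0" for s' x
    using pr_diff[of s' x a] that by (simp add: rv_inner flip: rv_simps)
  have snd_s: "snd s' = - idot (fst s') a" if "pr s' a = 0" for s' :: "3 mlat"
    using that by (simp add: pr_def idot_def)
  have fst0: "fst s' \<noteq> 0" if "primitive_mlat s'" "pr s' a = 0" for s'
    using snd_s[OF that(2)] that(1) by (auto simp: primitive_mlat_def prod_eq_iff idot_def)
  have uniq: "s' = s" if s': "?Q s'" for s'
  proof -
    have pos: "0 \<le> pr s' w" if "w \<in> W" for w using s' that unfolding S_nonneg by blast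
    have "pr s' x = 0" if "x \<in> W" "pr u x = 0" for x
    proof -
      have "rv x \<in> ?F" using that by (simp add: W_def phi_rv)
      then have "phi s' (rv x) = 0" using s' unfolding phi_def[symmetric] by blast
      then show ?thesis by (simp add: phi_rv)
    qed
    then have zs': "pr s' a = 0" "pr s' b = 0" "pr s' c = 0" using z by auto
    have n: "rv (fst s) \<noteq> 0" using fst0[OF gs(3) zs(1)] rv_inject[of "fst s" 0] by (simp add: rv_simps)
    obtain k where k: "rv (fst s') = k *\<^sub>R rv (fst s)"
      using perp_parallel[OF n perp[OF zs(1,2)] perp[OF zs(1,3)] perp[OF zs'(1,2)] perp[OF zs'(1,3)] indepD[OF ind]] by blast
    obtain i where i: "fst s $ i \<noteq> 0" using fst0[OF gs(3) zs(1)] by (auto simp: vec_eq_iff)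
    \<comment> \<open>The scalar \<open>k\<close> is the quotient \<open>q / p\<close> at a
      coordinate where \<open>fst s\<close> is nonzero; cross-multiplication gives an integral
      relation.\<close>
    define p q where "p = fst s $ i" and "q = fst s' $ i"
    have comp: "real_of_int (fst s' $ j) = k * of_int (fst s $ j)" for j
      using arg_cong[OF k, of "\<lambda>x. x $ j"] by (simp add: rv_simps)
    have "real_of_int (p * fst s' $ j) = real_of_int (q * fst s $ j)" for j
      using comp[of j] comp[of i] by (simp add: p_def q_def)
    then have pq: "p * fst s' $ j = q * fst s $ j" for j by (simp only: of_int_eq_iff)
    then have pqs: "p *s fst s' = q *s fst s" by (simp add: vec_eq_iff)
    have "p * snd s' = q * snd s"
      using arg_cong[OF pqs, of "\<lambda>m. idot m a"] unfolding snd_s[OF zs(1)] snd_s[OF zs'(1)] idot_simps by simp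
    then have eq: "mlat_scale p s' = mlat_scale q s" using pqs by (simp add: mlat_scale_def)
    have p0: "p \<noteq> 0" using i by (simp add: p_def)
    have q0: "q \<noteq> 0"
    proof
      assume "q = 0"
      then have "fst s' = 0" using pq p0 by (simp add: vec_eq_iff)
      then show False using fst0 s' zs'(1) by blast
    qed
    have "s' = s \<or> s' = - s" using primitive_parallel[OF gs(3) _ p0 q0 eq] s' by blast
    moreover have "s' \<noteq> - s" using pos[OF w(1)] sw by auto
    ultimately show ?thesis by blast
  qed
  have "s_facet P ?F = s" unfolding s_facet_def by (rule the_equality) (fact s, fact uniq)
  then show ?thesis using that[of g] gs by simp
qed

lemma face_hull:
  assumes "\<And>w. w \<in> W \<Longrightarrow> 0 \<le> pr u w"
  shows "{v \<in> P. phi u v = 0} face_of P" "{v \<in> P. phi u v = 0} = convex hull (rv ` {w \<in> W. pr u w = 0})"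
proof -
  let ?F = "{v \<in> P. phi u v = 0}"
  have "- real_of_int (snd u) \<le> rv (fst u) \<bullet> v" if "v \<in> P" for v
    using phi_le[of "- u" 0 v] assms that by (simp add: phi_alt rv_simps)
  then have "P \<inter> {x. rv (fst u) \<bullet> x = - real_of_int (snd u)} face_of P"
    using convex_P by (intro face_of_Int_supporting_hyperplane_ge) auto
  moreover have "P \<inter> {x. rv (fst u) \<bullet> x = - real_of_int (snd u)} = ?F"
    by (auto simp: phi_alt)
  ultimately show f: "?F face_of P" by simp
  have "polytope ?F" using f face_of_polytope_polytope polytope_P by blast
  then have "?F = convex hull {x. x extreme_point_of ?F}"
    by (intro Krein_Milman_Minkowski polytope_imp_compact polytope_imp_convex)
  also have "{x. x extreme_point_of ?F} = rv ` {w \<in> W. pr u w = 0}"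
  proof -
    have "x extreme_point_of ?F \<longleftrightarrow> x \<in> vertices P \<and> x \<in> ?F" for x
      using extreme_point_of_face[OF f] by (simp add: vertices_def)
    then have "{x. x extreme_point_of ?F} = {x. x \<in> rv ` W \<and> x \<in> ?F}" by (simp only: vertices_W)
    also have "\<dots> = rv ` {w \<in> W. pr u w = 0}" by (auto simp: phi_rv W_def)
    finally show ?thesis .
  qed
  finally show "?F = convex hull (rv ` {w \<in> W. pr u w = 0})" .
qed

lemma unit_square_hull: "affine hull unit_square = UNIV"
proof -
  let ?v = "\<lambda>i j. vector [i, j] :: real ^ 2"
  have "x \<in> affine hull {?v 0 0, ?v 1 0, ?v 0 1}" for x
  proof -
    have "x = (1 - x $ 1 - x $ 2) *\<^sub>R ?v 0 0 + (x $ 1) *\<^sub>R ?v 1 0 + (x $ 2) *\<^sub>R ?v 0 1"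
      by (simp add: vec_eq_iff forall_2)
    then show ?thesis unfolding affine_hull_3
      by (intro CollectI exI[of _ "1 - x $ 1 - x $ 2"] exI[of _ "x $ 1"] exI[of _ "x $ 2"]) simp
  qed
  moreover have "affine hull {?v 0 0, ?v 1 0, ?v 0 1} \<subseteq> affine hull unit_square"
    unfolding unit_square_def affine_hull_convex_hull by (rule hull_mono) auto
  ultimately show ?thesis by blast
qed

text \<open>The affine map sends the corners of the unit square to those of the parallelogram, and
  it matches the lattices because the triangle \<open>abd\<close> is unimodular.\<close>

lemma square_face_lattice_equivalent:
  assumes sq: "square E a b c d" "E \<subseteq> W"
  shows "lattice_equivalent unit_square (convex hull (rv ` E))" "aff_dim (convex hull (rv ` E)) = 2"
proof -
  have ind: "indep a b d" using sq by (intro vertices_indep) (auto simp: square_def)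
  have c: "c = b + d - a" using sq by (simp add: square_def algebra_simps)
  have inW: "a \<in> W" "b \<in> W" "d \<in> W" using sq by (auto simp: square_def)
  define L where "L x = (x $ 1) *\<^sub>R (rv b - rv a) + (x $ 2) *\<^sub>R (rv d - rv a)" for x :: "real ^ 2"
  let ?f = "\<lambda>x. rv a + L x"
  have lin: "linear L" by (intro linearI) (simp_all add: L_def algebra_simps)
  have injL: "inj L"
  proof (rule injI)
    fix x y assume "L x = L y"
    then have "x $ 1 = y $ 1" "x $ 2 = y $ 2" unfolding L_def by (rule indep_eq[OF ind])+
    then show "x = y" by (simp add: vec_eq_iff forall_2)
  qed
  have img: "?f ` S = (\<lambda>x. rv a + x) ` (L ` S)" for S by (simp add: image_image)
  have sqE: "?f ` unit_square = convex hull (rv ` E)"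
  proof -
    have "?f ` unit_square = convex hull (?f ` {vector [0, 0], vector [1, 0], vector [0, 1], vector [1, 1]})"
      unfolding unit_square_def img convex_hull_linear_image[OF lin] convex_hull_translation ..
    also have "?f ` {vector [0, 0], vector [1, 0], vector [0, 1], vector [1, 1]} = rv ` E"
      using sq by (auto simp: square_def L_def c rv_simps)
    finally show ?thesis .
  qed
  have aff: "?f ` (affine hull unit_square) = affine hull (convex hull (rv ` E))"
    unfolding sqE[symmetric] img affine_hull_linear_image[OF lin[unfolded linear_conv_bounded_linear]] affine_hull_translation ..
  have "bij_betw ?f (affine hull unit_square) (affine hull (convex hull (rv ` E)))"
    unfolding bij_betw_def aff using injL by (auto simp: inj_on_def)
  moreover have "?f ` (affine hull unit_square \<inter> lattice_points) = affine hull (convex hull (rv ` E)) \<inter> lattice_points"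
  proof -
    have "?f x \<in> lattice_points \<longleftrightarrow> x \<in> lattice_points" for x
    proof
      assume "?f x \<in> lattice_points"
      then obtain p where "rv p = rv a + (x $ 1) *\<^sub>R (rv b - rv a) + (x $ 2) *\<^sub>R (rv d - rv a)"
        by (auto simp: lattice_points_rv L_def add.assoc)
      then have "x $ 1 \<in> \<int>" "x $ 2 \<in> \<int>" using triangle_unimodular[OF inW ind] by blast+
      then show "x \<in> lattice_points" by (simp add: lattice_points_def forall_2)
    next
      assume "x \<in> lattice_points"
      then obtain z where x: "x = rv z" by (auto simp: lattice_points_rv)
      have "?f x = rv (a + z $ 1 *s (b - a) + z $ 2 *s (d - a))"
        by (simp only: L_def x rv_simps add.assoc)
      then show "?f x \<in> lattice_points" by (simp add: lattice_points_rv)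
    qed
    then show ?thesis unfolding aff[symmetric] unit_square_hull by auto
  qed
  ultimately show "lattice_equivalent unit_square (convex hull (rv ` E))"
    unfolding lattice_equivalent_def Let_def using lin sqE by blast
  have "aff_dim (convex hull (rv ` E)) = aff_dim (L ` unit_square)"
    unfolding sqE[symmetric] img aff_dim_translation_eq ..
  also have "\<dots> = aff_dim (affine hull unit_square)"
    using aff_dim_injective_linear_image[OF lin injL] by simp
  also have "\<dots> = 2" by (simp add: unit_square_hull)
  finally show "aff_dim (convex hull (rv ` E)) = 2" .
qed

lemma square_facetI:
  assumes nonneg: "\<And>w. w \<in> W \<Longrightarrow> 0 \<le> pr u w" and sq: "square {w \<in> W. pr u w = 0} a b c d"
  shows "{v \<in> P. phi u v = 0} \<in> square_facets P"
proof -
  note face = face_hull[OF nonneg]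
  note le = square_face_lattice_equivalent[OF sq]
  have "aff_dim {v \<in> P. phi u v = 0} = 2" using face(2) le(2) by auto
  moreover have "aff_dim P = 3" using full by (simp add: full_dimensional_def)
  ultimately have "{v \<in> P. phi u v = 0} facet_of P"
    unfolding facet_of_def using face(1) by (auto simp: aff_dim_empty)
  moreover have "lattice_equivalent unit_square {v \<in> P. phi u v = 0}"
    using face(2) le(1) by auto
  ultimately show ?thesis by (simp add: square_facets_def)
qed

text \<open>The exposing normal of a square facet is a multiple of the integral cross product of its sides.\<close>

lemma square_facetE:
  assumes F: "F \<in> square_facets P"
  obtains u a b c d where "u \<noteq> 0" "\<And>w. w \<in> W \<Longrightarrow> 0 \<le> pr u w" "F = {v \<in> P. phi u v = 0}"
    "square {w \<in> W. pr u w = 0} a b c d"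
proof -
  have facet: "F facet_of P" and "lattice_equivalent unit_square F" using F by (auto simp: square_facets_def)
  then obtain a0 L where lin: "linear L" and bij: "bij_betw (\<lambda>x. a0 + L x) UNIV (affine hull F)"
    and lat: "(\<lambda>x. a0 + L x) ` lattice_points = affine hull F \<inter> lattice_points"
    and img: "(\<lambda>x. a0 + L x) ` unit_square = F"
    unfolding lattice_equivalent_def Let_def unit_square_hull by auto
  let ?v = "\<lambda>i j. vector [i, j] :: real ^ 2"
  have injL: "L x = L y \<longleftrightarrow> x = y" for x y using bij unfolding bij_betw_def inj_on_def by auto
  \<comment> \<open>The equivalence maps lattice points to lattice points, so the images of the four
    corners are integral.\<close>
  have rvf: "\<exists>w. rv w = a0 + L (?v i j)" if "i \<in> \<int>" "j \<in> \<int>" for i j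
  proof -
    have "?v i j \<in> lattice_points" using that by (simp add: lattice_points_def forall_2)
    then have "a0 + L (?v i j) \<in> lattice_points" using lat by blast
    then show ?thesis by (metis lattice_points_rv imageE)
  qed
  obtain a b c d where abcd: "rv a = a0 + L (?v 0 0)" "rv b = a0 + L (?v 1 0)" "rv c = a0 + L (?v 1 1)" "rv d = a0 + L (?v 0 1)"
    using rvf[of 0 0] rvf[of 1 0] rvf[of 1 1] rvf[of 0 1] by (auto simp: Ints_0 Ints_1)
  have vne: "?v i j = ?v i' j' \<longleftrightarrow> i = i' \<and> j = j'" for i j i' j' by (simp add: vec_eq_iff forall_2)
  have ne: "a \<noteq> b" "a \<noteq> d" "b \<noteq> d" "c \<noteq> a" "c \<noteq> b" "c \<noteq> d"
    using abcd injL vne by (metis add_left_imp_eq zero_neq_one)+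
  have "?v 0 0 + ?v 1 1 = ?v 1 0 + ?v 0 1" by (simp add: vec_eq_iff forall_2)
  then have "L (?v 0 0) + L (?v 1 1) = L (?v 1 0) + L (?v 0 1)" by (simp flip: linear_add[OF lin])
  then have "rv (a + c) = rv (b + d)" unfolding rv_simps abcd by (simp add: algebra_simps)
  then have par: "a + c = b + d" by simp
  have Fhull: "F = convex hull (rv ` {a, b, c, d})"
  proof -
    have "F = (\<lambda>x. a0 + x) ` (L ` unit_square)" using img by (simp add: image_image)
    also have "\<dots> = convex hull ((\<lambda>x. a0 + x) ` (L ` {?v 0 0, ?v 1 0, ?v 0 1, ?v 1 1}))"
      unfolding unit_square_def convex_hull_linear_image[OF lin] convex_hull_translation ..
    also have "(\<lambda>x. a0 + x) ` (L ` {?v 0 0, ?v 1 0, ?v 0 1, ?v 1 1}) = rv ` {a, b, c, d}"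
      by (auto simp: abcd)
    finally show ?thesis .
  qed
  have FP: "F \<subseteq> P" using facet facet_of_imp_subset by blast
  have inF: "rv ` {a, b, c, d} \<subseteq> F" unfolding Fhull by (rule hull_subset)
  then have inW: "a \<in> W" "b \<in> W" "c \<in> W" "d \<in> W" using FP by (auto simp: W_def)
  have ind: "indep a b d" using inW ne by (intro vertices_indep)
  have "F exposed_face_of P"
    using facet by (simp add: facet_of_def exposed_face_of_polyhedron polytope_imp_polyhedron polytope_P)
  then obtain \<alpha> \<beta> where \<alpha>: "P \<subseteq> {x. \<alpha> \<bullet> x \<le> \<beta>}" "F = P \<inter> {x. \<alpha> \<bullet> x = \<beta>}"
    unfolding exposed_face_of_def by blast
  have on: "\<alpha> \<bullet> rv w = \<beta>" if "w \<in> {a, b, c, d}" for w using inF that \<alpha>(2) by auto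
  have "\<alpha> \<noteq> 0"
  proof
    assume "\<alpha> = 0"
    then have "F = P" using \<alpha> on[of a] by auto
    then show False using facet by (simp add: facet_of_def)
  qed
  define e f where "e = b - a" and "f = d - a"
  define N :: "int ^ 3" where "N = vector [e $ 2 * f $ 3 - e $ 3 * f $ 2, e $ 3 * f $ 1 - e $ 1 * f $ 3, e $ 1 * f $ 2 - e $ 2 * f $ 1]"
  have N: "rv N = cross3 (rv e) (rv f)"
    by (simp add: N_def cross3_def vec_eq_iff forall_3 rv_simps)
  have ef: "rv e = rv b - rv a" "rv f = rv d - rv a" by (simp_all add: e_def f_def rv_simps)
  have N0: "rv N \<noteq> 0"
  proof
    assume "rv N = 0"
    then have "collinear {0, rv e, rv f}" by (simp add: N cross_eq_0)
    then have "rv e = 0 \<or> rv f = 0 \<or> (\<exists>k. rv f = k *\<^sub>R rv e)" by (simp add: collinear_lemma)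
    then show False
    proof (elim disjE exE)
      fix k assume "rv f = k *\<^sub>R rv e"
      then have "(- k) *\<^sub>R (rv b - rv a) + 1 *\<^sub>R (rv d - rv a) = 0" by (simp add: ef)
      then show False using indepD[OF ind] by fastforce
    qed (use ne in \<open>auto simp: ef\<close>)
  qed
  have perp: "rv N \<bullet> (rv b - rv a) = 0" "rv N \<bullet> (rv d - rv a) = 0"
    unfolding N ef[symmetric] by (simp_all add: dot_cross_self)
  have "\<alpha> \<bullet> (rv b - rv a) = 0" "\<alpha> \<bullet> (rv d - rv a) = 0" using on by (simp_all add: inner_diff_right)
  then obtain k where k: "\<alpha> = k *\<^sub>R rv N" using perp_parallel[OF N0 perp _ _ indepD[OF ind]] by blast
  have k0: "k \<noteq> 0" using k \<open>\<alpha> \<noteq> 0\<close> by auto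
  \<comment> \<open>\<open>\<alpha>\<close> is bounded above on \<open>P\<close> with its maximum on
    the facet, while \<open>u\<close> has to be nonnegative; \<open>h\<close> chooses the sign of
    the cross product accordingly.\<close>
  define h :: int where "h = (if 0 < k then - 1 else 1)"
  define u where "u = (h *s N, - idot (h *s N) a)"
  have kh: "real_of_int h * \<bar>k\<bar> = - k" using k0 by (simp add: h_def)
  have phi_u: "\<bar>k\<bar> * phi u v = \<beta> - \<alpha> \<bullet> v" for v
  proof -
    have "phi u v = of_int h * (rv N \<bullet> v - rv N \<bullet> rv a)"
      by (simp add: phi_alt u_def rv_simps idot_simps rv_inner algebra_simps)
    then have "\<bar>k\<bar> * phi u v = (real_of_int h * \<bar>k\<bar>) * (rv N \<bullet> v - rv N \<bullet> rv a)" by simp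
    also have "\<dots> = \<alpha> \<bullet> rv a - \<alpha> \<bullet> v" unfolding kh k by (simp add: algebra_simps)
    finally show ?thesis using on[of a] by simp
  qed
  have F_u: "F = {v \<in> P. phi u v = 0}"
  proof -
    have "phi u v = 0 \<longleftrightarrow> \<alpha> \<bullet> v = \<beta>" for v using phi_u[of v] k0 by auto
    then show ?thesis using \<alpha>(2) by auto
  qed
  have nonneg: "0 \<le> pr u w" if "w \<in> W" for w
  proof -
    have "\<alpha> \<bullet> rv w \<le> \<beta>" using \<alpha>(1) that by (auto simp: W_def)
    then have "0 \<le> \<bar>k\<bar> * phi u (rv w)" unfolding phi_u by simp
    then have "0 \<le> phi u (rv w)" using k0 by (simp add: zero_le_mult_iff)
    then show ?thesis by (simp add: phi_rv)
  qed
  have "{w \<in> W. pr u w = 0} = {a, b, c, d}"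
  proof (intro equalityI subsetI)
    fix w assume "w \<in> {w \<in> W. pr u w = 0}"
    then have "w \<in> W" "rv w \<in> F" unfolding F_u by (auto simp: phi_rv W_def)
    then show "w \<in> {a, b, c, d}" using not_combination[of "{a, b, c, d}" w] inW Fhull by auto
  next
    fix w assume w: "w \<in> {a, b, c, d}"
    then have "rv w \<in> F" using inF by blast
    then have "phi u (rv w) = 0" unfolding F_u by simp
    then show "w \<in> {w \<in> W. pr u w = 0}" using w inW by (auto simp: phi_rv)
  qed
  then have "square {w \<in> W. pr u w = 0} a b c d" using par ne by (auto simp: square_def)
  moreover have "u \<noteq> 0" 
  proof
    assume "u = 0"
    then have "h *s N = 0" by (simp add: u_def prod_eq_iff)
    then have "N = 0" by (auto simp: vec_eq_iff h_def split: if_splits)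
    then show False using N0 by (simp add: rv_simps)
  qed
  ultimately show ?thesis using that nonneg F_u by blast
qed

lemma phi_R_minus: "phi (R_star - mlat_scale n s) v = 1 - of_int n * phi s v"
  by (simp add: phi_alt R_star_def mlat_scale_def rv_simps algebra_simps)

text \<open>\<open>R_star\<close> has value 1 everywhere, so on \<open>P\<close> subtracting a
  positive multiple of the facet generator leaves the value 1 exactly on the facet and lowers it
  elsewhere.\<close>

lemma square_facet_degree:
  assumes F: "F \<in> square_facets P" and n: "1 \<le> n"
  obtains a b c d where "\<And>w. w \<in> W \<Longrightarrow> pr (R_star - mlat_scale n (s_facet P F)) w \<le> 1"
    "square {w \<in> W. pr (R_star - mlat_scale n (s_facet P F)) w = 1} a b c d"
    "F_at P (R_star - mlat_scale n (s_facet P F)) = F" "s_facet P F \<noteq> 0"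
proof -
  obtain u a b c d where u: "u \<noteq> 0" "\<And>w. w \<in> W \<Longrightarrow> 0 \<le> pr u w" "F = {v \<in> P. phi u v = 0}"
    "square {w \<in> W. pr u w = 0} a b c d"
    using square_facetE[OF F] by blast
  have z: "w \<in> W" "pr u w = 0" if "w \<in> {a, b, d}" for w using u(4) that by (auto simp: square_def)
  have ind: "indep a b d" using u(4) z(1) by (intro vertices_indep) (auto simp: square_def)
  obtain g where g: "1 \<le> g" "u = mlat_scale g (s_facet P F)"
    using s_facet_eq[OF u(2,1) z(1)[of a] z(1)[of b] z(1)[of d] z(2)[of a] z(2)[of b] z(2)[of d] ind]
    unfolding u(3)[symmetric] by auto
  let ?s = "s_facet P F"
  have pu: "pr u w = g * pr ?s w" for w using g(2) by (metis pr_simps(5))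
  have phiu: "phi u v = of_int g * phi ?s v" for v
    by (subst g(2)) (simp add: phi_alt mlat_scale_def rv_simps algebra_simps)
  have s0: "0 \<le> pr ?s w" if "w \<in> W" for w using u(2)[OF that] g(1) by (simp add: pu zero_le_mult_iff)
  show ?thesis
  proof (rule that)
    show "pr (R_star - mlat_scale n ?s) w \<le> 1" if "w \<in> W" for w using s0[OF that] n by simp
    have "{w \<in> W. pr (R_star - mlat_scale n ?s) w = 1} = {w \<in> W. pr u w = 0}"
      using n g(1) by (auto simp: pu)
    then show "square {w \<in> W. pr (R_star - mlat_scale n ?s) w = 1} a b c d" using u(4) by simp
    show "F_at P (R_star - mlat_scale n ?s) = F"
    proof -
      have "phi (R_star - mlat_scale n ?s) v = 1 \<longleftrightarrow> phi u v = 0" for v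
        using n g(1) by (simp add: phi_R_minus phiu[of v])
      then have "F_at P (R_star - mlat_scale n ?s) = {v \<in> P. phi u v = 0}" by (simp only: F_at_def)
      then show ?thesis by (simp only: u(3)[symmetric])
    qed
    show "?s \<noteq> 0" using g(2) u(1) by (auto simp: mlat_scale_simps mlat_scale_def prod_eq_iff vec_eq_iff)
  qed
qed

lemma square_degree_T1:
  assumes F: "F \<in> square_facets P" and n: "1 \<le> n"
  shows "\<exists>\<gamma>. locadd (R_star - mlat_scale n (s_facet P F)) \<gamma> \<and> \<not> triv (R_star - mlat_scale n (s_facet P F)) \<gamma> \<and>
    (\<forall>\<gamma>'. locadd (R_star - mlat_scale n (s_facet P F)) \<gamma>' \<longrightarrow>
      (\<exists>\<alpha>. triv (R_star - mlat_scale n (s_facet P F)) (\<lambda>s. \<gamma>' s - \<alpha> * \<gamma> s)))"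
proof (rule square_facet_degree[OF F n])
  fix a b c d
  assume le: "\<And>w. w \<in> W \<Longrightarrow> pr (R_star - mlat_scale n (s_facet P F)) w \<le> 1"
    and sq: "square {w \<in> W. pr (R_star - mlat_scale n (s_facet P F)) w = 1} a b c d"
  show ?thesis
    by (rule square_T1[OF le refl sq]) blast+
qed

lemma nontrivial_degree:
  assumes r: "r \<noteq> R_star" and \<gamma>: "locadd r \<gamma>" "\<not> triv r \<gamma>"
  shows "\<exists>F\<in>square_facets P. \<exists>n::int. n \<ge> 1 \<and> r = R_star - mlat_scale n (s_facet P F)"
proof -
  have le: "pr r w \<le> 1" if "w \<in> W" for w
    using triv_if_big[OF \<gamma>(1) that] \<gamma>(2) by force
  obtain a b c d where sq: "square {w \<in> W. pr r w = 1} a b c d"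
    using nontrivial_imp_square[OF le refl \<gamma> r] by blast
  define u where "u = R_star - r"
  have nonneg: "0 \<le> pr u w" if "w \<in> W" for w using le[OF that] by (simp add: u_def)
  have E: "{w \<in> W. pr r w = 1} = {w \<in> W. pr u w = 0}" by (auto simp: u_def)
  have squ: "square {w \<in> W. pr u w = 0} a b c d" using sq unfolding E .
  let ?F = "{v \<in> P. phi u v = 0}"
  have F: "?F \<in> square_facets P" by (rule square_facetI[OF nonneg squ])
  have z: "w \<in> W" "pr u w = 0" if "w \<in> {a, b, d}" for w using squ that by (auto simp: square_def)
  have ind: "indep a b d" using squ z(1) by (intro vertices_indep) (auto simp: square_def)
  have u0: "u \<noteq> 0" using r by (simp add: u_def)
  obtain g where g: "1 \<le> g" "u = mlat_scale g (s_facet P ?F)"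
    using s_facet_eq[OF nonneg u0 z(1)[of a] z(1)[of b] z(1)[of d] z(2)[of a] z(2)[of b] z(2)[of d] ind] by auto
  have "r = R_star - mlat_scale g (s_facet P ?F)" unfolding g(2)[symmetric] by (simp add: u_def)
  then show ?thesis using F g(1) by blast
qed

end

theorem proposition4p5:
  fixes P :: "(real ^ 3) set"
  assumes "lattice_polytope P" and "full_dimensional P" and "empty_polytope P"
  shows
    "((\<forall>r. r \<noteq> R_star \<longrightarrow>
        (T1_deg (coord_ring P) (- r) \<noteq> {T1_zero (coord_ring P)} \<longleftrightarrow>
          (\<exists>F\<in>square_facets P. \<exists>n::int. n \<ge> 1 \<and> r = R_star - mlat_scale n (s_facet P F))))
      \<and> (\<forall>F\<in>square_facets P. \<forall>n::int. n \<ge> 1 \<longrightarrow>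
          F_at P (R_star - mlat_scale n (s_facet P F)) = F \<and>
          T1_part_iso_complex (coord_ring P)
            (T1_deg (coord_ring P) (- (R_star - mlat_scale n (s_facet P F))))))
     \<and> (F_at P R_star = P \<and>
        (\<forall>r. T1_deg (coord_ring P) (- r) \<noteq> {T1_zero (coord_ring P)} \<longrightarrow> (\<forall>v\<in>P. phi r v \<le> 1)))
     \<and> T1_direct_sum (coord_ring P)
        (insert None (Some ` (square_facets P \<times> {n::int. n \<ge> 1})))
        (\<lambda>i. case i of
           None \<Rightarrow> T1_deg (coord_ring P) (- R_star)
         | Some (F, n) \<Rightarrow> T1_deg (coord_ring P) (- (R_star - mlat_scale n (s_facet P F))))"
proof -
  interpret empty_polytope3 P by (intro empty_polytope3.intro empty_lattice_polytope.intro assms)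
  have deg: "\<exists>\<gamma>. locadd r \<gamma> \<and> \<not> triv r \<gamma>" "T1_part_iso_complex A (T1_deg A (- r))" "F_at P r = F"
    if F: "F \<in> square_facets P" "1 \<le> n" and r: "r = R_star - mlat_scale n (s_facet P F)" for F n r
  proof -
    obtain \<gamma> where \<gamma>: "locadd r \<gamma>" "\<not> triv r \<gamma>" and "\<forall>\<gamma>'. locadd r \<gamma>' \<longrightarrow> (\<exists>\<alpha>. triv r (\<lambda>s. \<gamma>' s - \<alpha> * \<gamma> s))"
      using square_degree_T1[OF F] unfolding r[symmetric] by blast
    then have span: "\<exists>\<alpha>. triv r (\<lambda>s. \<gamma>' s - \<alpha> * \<gamma> s)" if "locadd r \<gamma>'" for \<gamma>' using that by blast
    show "\<exists>\<gamma>. locadd r \<gamma> \<and> \<not> triv r \<gamma>" using \<gamma> by blast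
    show "T1_part_iso_complex A (T1_deg A (- r))" by (rule T1_part_iso_complexI[OF \<gamma> span])
    show "F_at P r = F" unfolding r by (rule square_facet_degree[OF F])
  qed
  \<comment> \<open>The negative of the degree attached to an index; \<open>None\<close> stands for
    \<open>R_star\<close>.\<close>
  define \<rho> where "\<rho> i = (case i of None \<Rightarrow> R_star | Some (F, n) \<Rightarrow> R_star - mlat_scale n (s_facet P F))" for i :: "((real ^ 3) set \<times> int) option"
  let ?I = "insert None (Some ` (square_facets P \<times> {n::int. n \<ge> 1}))"
  have F_R: "F_at P R_star = P" by (auto simp: F_at_def phi_alt R_star_def rv_simps)
  have bound: "phi r v \<le> 1" if r: "T1_deg A (- r) \<noteq> {T1_zero A}" and v: "v \<in> P" for r v
  proof -
    obtain \<gamma> where \<gamma>: "locadd r \<gamma>" "\<not> triv r \<gamma>" using r unfolding T1_deg_nonzero_iff by blast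
    have "pr r w \<le> 1" if "w \<in> W" for w using triv_if_big[OF \<gamma>(1) that] \<gamma>(2) by force
    then show ?thesis using phi_le[of r 1 v] v by simp
  qed
  have nP: "F \<noteq> P" if "F \<in> square_facets P" for F using that by (auto simp: square_facets_def facet_of_def)
  \<comment> \<open>The face \<open>F_at\<close> recovers the facet from the degree, with
    \<open>P\<close> itself for \<open>R_star\<close>; the multiple is recovered because
    \<open>s_facet P F\<close> is nonzero.\<close>
  have inj: "inj_on \<rho> ?I"
  proof (rule inj_onI)
    fix i j assume i: "i \<in> ?I" and j: "j \<in> ?I" and eq: "\<rho> i = \<rho> j"
    have F: "F_at P (\<rho> (Some (F, n))) = F" if "F \<in> square_facets P" "1 \<le> n" for F n
      using deg(3)[OF that refl] by (simp add: \<rho>_def)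
    have N: "F_at P (\<rho> None) = P" by (simp add: \<rho>_def F_R)
    consider "i = None" "j = None"
      | F n where "i = None" "j = Some (F, n)" "F \<in> square_facets P" "1 \<le> n"
      | F n where "j = None" "i = Some (F, n)" "F \<in> square_facets P" "1 \<le> n"
      | F n F' n' where "i = Some (F, n)" "j = Some (F', n')" "F \<in> square_facets P" "1 \<le> n" "F' \<in> square_facets P" "1 \<le> n'"
      using i j by auto
    then show "i = j"
    proof cases
      case 4
      then have "F = F'" using F eq by metis
      obtain s where s: "s = s_facet P F" "s \<noteq> 0" using square_facet_degree[OF 4(3,4)] by metis
      have "mlat_scale n s = mlat_scale n' s" using eq 4 \<open>F = F'\<close> s by (simp add: \<rho>_def)
      then have "mlat_scale (n - n') s = 0" by (simp add: mlat_scale_simps(1)[of n "- n'", simplified] mlat_scale_simps)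
      then have "n = n'" using s(2) by (auto simp: mlat_scale_def prod_eq_iff vec_eq_iff)
      then show ?thesis using 4 \<open>F = F'\<close> by simp
    qed (use F N eq nP in metis)+
  qed
  have all: "R \<in> \<rho> ` ?I" if \<gamma>: "locadd R \<gamma>" "\<not> triv R \<gamma>" for R \<gamma>
  proof (cases "R = R_star")
    case True
    then show ?thesis by (intro image_eqI[of _ _ None]) (auto simp: \<rho>_def)
  next
    case False
    then obtain F n where "F \<in> square_facets P" "1 \<le> n" "R = R_star - mlat_scale n (s_facet P F)"
      using nontrivial_degree[OF _ \<gamma>] by blast
    then show ?thesis by (intro image_eqI[of _ _ "Some (F, n)"]) (auto simp: \<rho>_def)
  qed
  have ds: "T1_direct_sum A ?I (\<lambda>i. case i of None \<Rightarrow> T1_deg A (- R_star)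
         | Some (F, n) \<Rightarrow> T1_deg A (- (R_star - mlat_scale n (s_facet P F))))"
    by (rule T1_direct_sumI[OF inj _ all]) (auto simp: \<rho>_def split: option.split)
  have nz: "T1_deg A (- r) \<noteq> {T1_zero A} \<longleftrightarrow>
      (\<exists>F\<in>square_facets P. \<exists>n::int. n \<ge> 1 \<and> r = R_star - mlat_scale n (s_facet P F))" if "r \<noteq> R_star" for r
    unfolding T1_deg_nonzero_iff using nontrivial_degree[OF that] deg(1) by blast
  show ?thesis
    unfolding coord_ring_P
    by (intro conjI allI ballI impI)
      (rule nz deg(3)[OF _ _ refl] deg(2)[OF _ _ refl] F_R bound ds, assumption?, assumption?)+
qed

end
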